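(* Let $F:[0,1]^{N+1}\to\mathbb{R}$ satisfy Assumptions (A) and (B) stated in the context. Then there exist a real $c$ and two functions $\phi_1:\mathbb{R}\to\mathbb{R}$ and $\phi_2:\mathbb{R}\to\mathbb{R}$ that solve $$\begin{cases} c\,\phi_1'(z)=\alpha_0(\phi_2(z)-\phi_1(z)),\\ c\,\phi_2'(z)=2F((\phi_1(z+r_i))_{i=0,\dots,N})+\alpha_0(\phi_1(z)-\phi_2(z)),\\ \phi_1,\ \phi_2\ \text{are non-decreasing over }\mathbb{R},\\ \phi_1(-\infty)=0,\quad\phi_1(+\infty)=1,\\ \phi_2(-\infty)=0,\quad\phi_2(+\infty)=1, \end{cases}$$ in the classical sense if $c\ne0$ and almost everywhere if $c=0$.
   Context: Data: a constant $\alpha_0>0$, a nonnegative integer $N$, and real shifts $r_0,\dots,r_N$ with $r^*=\max_{i=0,\dots,N}|r_i|>0$. $\phi_i(\pm\infty)$ denotes the limit of $\phi_i$ at $\pm\infty$. Assumption (A): $F$ is globally Lipschitz continuous over $[0,1]^{N+1}$; $F(X_0,\dots,X_N)$ is non-decreasing in $X_i$ for each $i\ne0$; and $2\frac{\partial F}{\partial X_0}+\alpha_0>0$. Set $f(v)=F(v,\dots,v)$. Assumption (B): $f(0)=0=f(1)$, and there exists $b\in[0,1]$ such that $f(b)=0$, $f<0$ on $(0,b)$, $f>0$ on $(b,1)$ and $f'(b)>0$; moreover $F$ is $C^1$ in a neighborhood of $\{b\}^{N+1}$ (that is, of the point $(b,\dots,b)$).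
   Formalization: The shifts are additionally assumed to satisfy r_0 = 0; without this the claim fails, e.g. for α_0 = 1, N = 1, r_0 = 1, r_1 = 0, F(X_0,X_1) = (X_1−X_0)/4 + X_1(1−X_1)(X_1−1/2)/4. *)

theory Defs
  imports "HOL-Analysis.Analysis"
begin

text \<open>
  Vectors \<open>(X_0, \<dots>, X_N)\<close> are elements of \<^typ>\<open>real ^ 'n\<close> with \<open>CARD('n) = N + 1\<close>.  Class
  \<^class>\<open>zero\<close> is used only to name a distinguished index \<open>0 :: 'n\<close>.
\<close>

definition unit_cube :: "(real ^ 'n) set" where
  "unit_cube = {X. \<forall>i. 0 \<le> X $ i \<and> X $ i \<le> 1}"

definition diagonal :: "(real ^ 'n \<Rightarrow> real) \<Rightarrow> real \<Rightarrow> real" where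
  "diagonal F v = F (vec v)"

definition has_partial_derivative_0 ::
    "(real ^ 'n::{finite,zero} \<Rightarrow> real) \<Rightarrow> real \<Rightarrow> real ^ 'n::{finite,zero} \<Rightarrow> bool" where
  "has_partial_derivative_0 F d X \<longleftrightarrow>
     ((\<lambda>x. F (\<chi> j. if j = 0 then x else X $ j)) has_real_derivative d)
       (at (X $ 0) within {0..1})"

text \<open>
  A Lipschitz \<open>F\<close> is differentiable only almost everywhere, so the inequality
  \<open>2 \<partial>F/\<partial>X_0 + \<alpha>0 > 0\<close> is read almost everywhere on the cube.
\<close>

definition assumption_A :: "real \<Rightarrow> (real ^ 'n::{finite,zero} \<Rightarrow> real) \<Rightarrow> bool" where
  "assumption_A \<alpha>0 F \<longleftrightarrow>
     (\<exists>L. L-lipschitz_on unit_cube F) \<and>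
     (\<forall>i. i \<noteq> 0 \<longrightarrow>
        (\<forall>X\<in>unit_cube. \<forall>Y\<in>unit_cube.
           X $ i \<le> Y $ i \<and> (\<forall>j. j \<noteq> i \<longrightarrow> X $ j = Y $ j) \<longrightarrow> F X \<le> F Y)) \<and>
     (AE X in lebesgue. X \<in> unit_cube \<longrightarrow>
        (\<exists>d. has_partial_derivative_0 F d X \<and> 2 * d + \<alpha>0 > 0))"

text \<open>
  \<open>F\<close> is given on the closed cube only and \<open>b\<close> may be an endpoint of \<open>[0,1]\<close>; hence derivatives
  and neighbourhoods are relative to the cube (respectively to \<open>[0,1]\<close>).  For \<open>0 < b < 1\<close> these are
  the ordinary notions.  \<open>G\<close> is the gradient of \<open>F\<close>.
\<close>

definition C1_near :: "(real ^ 'n \<Rightarrow> real) \<Rightarrow> real ^ 'n \<Rightarrow> bool" where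
  "C1_near F P \<longleftrightarrow>
     (\<exists>U G. open U \<and> P \<in> U \<and>
        (\<forall>X\<in>U \<inter> unit_cube. (F has_derivative (\<lambda>h. G X \<bullet> h)) (at X within unit_cube)) \<and>
        continuous_on (U \<inter> unit_cube) G)"

definition assumption_B :: "(real ^ 'n \<Rightarrow> real) \<Rightarrow> bool" where
  "assumption_B F \<longleftrightarrow>
     diagonal F 0 = 0 \<and> diagonal F 1 = 0 \<and>
     (\<exists>b\<in>{0..1}.
        diagonal F b = 0 \<and>
        (\<forall>v\<in>{0<..<b}. diagonal F v < 0) \<and>
        (\<forall>v\<in>{b<..<1}. diagonal F v > 0) \<and>
        (\<exists>d>0. (diagonal F has_real_derivative d) (at b within {0..1})) \<and>
        C1_near F (vec b))"

definition wave_equations_at ::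
    "real \<Rightarrow> (real ^ 'n \<Rightarrow> real) \<Rightarrow> ('n \<Rightarrow> real) \<Rightarrow> real \<Rightarrow>
     (real \<Rightarrow> real) \<Rightarrow> (real \<Rightarrow> real) \<Rightarrow> real \<Rightarrow> bool" where
  "wave_equations_at \<alpha>0 F r c \<phi>1 \<phi>2 z \<longleftrightarrow>
     c * deriv \<phi>1 z = \<alpha>0 * (\<phi>2 z - \<phi>1 z) \<and>
     c * deriv \<phi>2 z = 2 * F (\<chi> i. \<phi>1 (z + r i)) + \<alpha>0 * (\<phi>1 z - \<phi>2 z)"

text \<open>
  For \<open>c = 0\<close> the left-hand sides above vanish, whatever \<^const>\<open>deriv\<close> returns at a jump of a
  profile, so no differentiability is demanded in that case.

  The distinguished slot \<open>X_0\<close> of \<open>F\<close>, the only one in which \<open>F\<close> may decrease, is the on-site one: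
  the shifts \<open>r\<close> are used with the convention \<open>r 0 = 0\<close>.  The existence of a wave fails without it,
  for instance for \<open>\<alpha>0 = 1\<close>, \<open>N = 1\<close>, \<open>r_0 = 1\<close>, \<open>r_1 = 0\<close>,
  \<open>F(X_0, X_1) = (X_1 - X_0)/4 + X_1(1 - X_1)(X_1 - 1/2)/4\<close>.
\<close>

definition wave_solution ::
    "real \<Rightarrow> (real ^ 'n \<Rightarrow> real) \<Rightarrow> ('n \<Rightarrow> real) \<Rightarrow> real \<Rightarrow>
     (real \<Rightarrow> real) \<Rightarrow> (real \<Rightarrow> real) \<Rightarrow> bool" where
  "wave_solution \<alpha>0 F r c \<phi>1 \<phi>2 \<longleftrightarrow>
     (if c \<noteq> 0
      then \<phi>1 C1_differentiable_on UNIV \<and> \<phi>2 C1_differentiable_on UNIV \<and>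
           (\<forall>z. wave_equations_at \<alpha>0 F r c \<phi>1 \<phi>2 z)
      else (AE z in lebesgue. wave_equations_at \<alpha>0 F r c \<phi>1 \<phi>2 z))"

end

theory Submission
  imports Defs "HOL-Probability.Probability"
begin

text \<open>
  Solving both equations by Duhamel's formula turns the system into a single fixed point problem
  \<open>\<phi> = T c \<phi>\<close>, where \<open>T c \<phi> z\<close> is the expectation of \<open>G(\<phi>(z + r_i - c S))\<close>, with
  \<open>G X = X_0 + 2 F X / \<alpha>0\<close> monotone by (A) and \<open>S\<close> the sum of two independent exponential variables of
  rate \<open>\<alpha>0\<close>.  This makes sense for \<open>c = 0\<close> too and preserves order and non-decreasing functions.

  Call \<open>c\<close> a left speed if there is a profile from \<open>0\<close> to \<open>1\<close> which vanishes on \<open>z < 0\<close> and satisfies the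
  equation on \<open>z \<ge> 0\<close> (a subsolution), and a right speed if there is one which equals \<open>1\<close> on
  \<open>z \<ge> 0\<close> and satisfies the equation on \<open>z < 0\<close> (a supersolution).  A speed of both kinds carries
  an ordered pair of sub- and supersolution, hence a wave.  Very negative speeds are left speeds and very
  large ones right speeds.  If there is no wave, then both sets of speeds are closed, and they cover the
  line because solutions on long intervals \<open>[0, n]\<close> converge, after translation, to profiles on a
  half-line or the line; so they meet by connectedness, a contradiction.

  The compactness argument could only fail by producing, at one and the same speed, a front from \<open>0\<close> to
  \<open>b\<close> and one from \<open>b\<close> to \<open>1\<close>.  Near \<open>b\<close> both are superharmonic for a convolution kernel of mass
  \<open>> 1\<close> (this is \<open>f'(b) > 0\<close>), which makes the first front impossible when the drift of the kernel is
  negative and the second when it is positive.  The remaining case is \<open>c = 0\<close> and fronts that reach the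
  value \<open>b\<close> exactly; these can be glued.
\<close>

section \<open>Non-decreasing right-continuous profiles\<close>

text \<open>At speed 0 the average over \<open>S\<close> is trivial and the fixed point equation
  smooths nothing, so profiles may jump. They are normalised by right-continuity instead: decreasing
  limits keep it, and it extends an equation known off a countable set to every point. Speed 0 is
  special once more, because gluing two fronts may leave a profile with two finite ends, which shows
  neither kind of speed. Bounded intervals are therefore used only for \<open>c \<noteq> 0\<close>,
  and closedness of the two sets of speeds supplies 0.

  The danger in the compactness step is that a limit stops at the intermediate equilibrium
  \<open>b\<close>. Translates are normalised at one level below \<open>b\<close> and at one above
  it: either one of the two limits runs from 0 to 1, or they form the colliding pair of fronts.
  Excluding that pair is the only use of \<open>f'(b) > 0\<close>.

  Monotonicity of \<open>G\<close> is what 2 dF/dX_0 + \<alpha>0 > 0 provides: the term \<alpha>0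
  X_0 offsets a decrease of \<open>F\<close> in slot 0. It is the term \<alpha>0 \<phi>1 of the
  second equation, which is why slot 0 must be the on-site one.\<close>

definition profile :: "(real \<Rightarrow> real) \<Rightarrow> bool" where
  "profile \<phi> \<longleftrightarrow> mono \<phi> \<and> (\<forall>z. 0 \<le> \<phi> z \<and> \<phi> z \<le> 1) \<and> (\<forall>z. continuous (at_right z) \<phi>)"

lemma profileD:
  assumes "profile \<phi>"
  shows "mono \<phi>" "0 \<le> \<phi> z" "\<phi> z \<le> 1" "continuous (at_right z) \<phi>" "\<phi> \<in> borel_measurable borel"
  using assms by (auto simp: profile_def intro: borel_measurable_mono)

lemma profile_translate:
  assumes "profile \<phi>"
  shows "profile (\<lambda>z. \<phi> (z + a))"
proof -
  have "continuous (at_right z) (\<lambda>z. \<phi> (z + a))" for z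
  proof -
    have "(\<phi> \<longlongrightarrow> \<phi> (z + a)) (at_right (z + a))"
      using profileD(4)[OF assms] by (simp add: continuous_within)
    then show ?thesis
      by (subst (asm) at_right_to_0) (subst continuous_within, subst at_right_to_0, simp add: filterlim_filtermap algebra_simps)
  qed
  then show ?thesis
    using assms by (auto simp: profile_def mono_def)
qed

text \<open>For non-decreasing functions right-continuity is upper semicontinuity, which infima
  preserve. Increasing limits can lose it, so later iterations descend from a supersolution.\<close>

lemma decseq_limit_profile:
  assumes prof: "\<And>k. profile (\<psi> k)" and dec: "\<And>k z. \<psi> (Suc k) z \<le> \<psi> k z"
  shows "\<exists>\<phi>. profile \<phi> \<and> (\<forall>z. (\<lambda>k. \<psi> k z) \<longlonglongrightarrow> \<phi> z) \<and> (\<forall>k z. \<phi> z \<le> \<psi> k z)"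
proof -
  have "\<exists>l. (\<lambda>k. \<psi> k z) \<longlonglongrightarrow> l \<and> (\<forall>k. l \<le> \<psi> k z)" for z
  proof -
    have d: "decseq (\<lambda>k. \<psi> k z)" using dec by (simp add: decseq_Suc_iff)
    obtain l where "(\<lambda>k. \<psi> k z) \<longlonglongrightarrow> l" "\<forall>k. l \<le> \<psi> k z"
      using decseq_convergent[OF d, of 0] profileD(2)[OF prof] by blast
    then show ?thesis by auto
  qed
  then obtain \<phi> where lim: "\<And>z. (\<lambda>k. \<psi> k z) \<longlonglongrightarrow> \<phi> z" and le: "\<And>k z. \<phi> z \<le> \<psi> k z" by metis
  have mono: "mono \<phi>"
    by (rule monoI, rule LIMSEQ_le[OF lim lim]) (use profileD(1)[OF prof] in \<open>auto simp: mono_def\<close>)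
  have "continuous (at_right z) \<phi>" for z
    unfolding continuous_within
  proof (rule order_tendstoI)
    show "\<forall>\<^sub>F x in at_right z. a < \<phi> x" if "a < \<phi> z" for a
      unfolding eventually_at_right_field using that monoD[OF mono] less_le_trans
      by (intro exI[of _ "z + 1"]) (auto intro: less_le_trans)
    fix a assume "\<phi> z < a"
    then obtain k where "\<psi> k z < a"
      using order_tendstoD(2)[OF lim[of z]] eventually_happens by (metis trivial_limit_sequentially)
    then have "\<forall>\<^sub>F x in at_right z. \<psi> k x < a"
      using profileD(4)[OF prof, of z k] order_tendstoD(2) unfolding continuous_within by blast
    then show "\<forall>\<^sub>F x in at_right z. \<phi> x < a"
      by eventually_elim (use le le_less_trans in blast)
  qed
  moreover have "0 \<le> \<phi> z" "\<phi> z \<le> 1" for z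
    using LIMSEQ_le_const[OF lim[of z], of 0] profileD(2)[OF prof] le[of z 0] profileD(3)[OF prof, of 0 z] by auto
  ultimately show ?thesis using mono lim le unfolding profile_def by blast
qed

lemma profile_step: "profile (\<lambda>z. if z < 0 then 0 else 1)"
proof -
  have "continuous (at_right z) (\<lambda>z::real. if z < 0 then 0 else 1::real)" for z
  proof (cases "z < 0")
    case True
    then have "\<forall>\<^sub>F y in at_right z. (if y < 0 then 0 else 1::real) = 0"
      unfolding eventually_at_right_field by (intro exI[of _ 0]) auto
    then show ?thesis unfolding continuous_within using True by (subst tendsto_cong[where g = "\<lambda>_. 0"]) auto
  next
    case False
    then have "\<forall>\<^sub>F y in at_right z. (if y < 0 then 0 else 1::real) = 1"
      unfolding eventually_at_right_field by (intro exI[of _ "z + 1"]) auto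
    then show ?thesis unfolding continuous_within using False by (subst tendsto_cong[where g = "\<lambda>_. 1"]) auto
  qed
  then show ?thesis by (auto simp: profile_def mono_def)
qed

lemma profile_0: "profile (\<lambda>_. 0)"
  by (auto simp: profile_def mono_def)

text \<open>A profile may jump over \<theta>, so the crossing is described by two weak inequalities,
  which unlike an equation survive limits. The point is the infimum of the superlevel set, where
  right-continuity gives the second inequality.\<close>

lemma profile_crossing:
  assumes p: "profile \<phi>" "(\<phi> \<longlongrightarrow> 0) at_bot" "(\<phi> \<longlongrightarrow> 1) at_top" and \<theta>: "0 < \<theta>" "\<theta> < 1"
  obtains a where "\<And>z. z < 0 \<Longrightarrow> \<phi> (z + a) \<le> \<theta>" "\<And>z. 0 \<le> z \<Longrightarrow> \<theta> \<le> \<phi> (z + a)"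
proof -
  let ?A = "{z. \<theta> \<le> \<phi> z}"
  have "\<forall>\<^sub>F z in at_top. \<theta> < \<phi> z" "\<forall>\<^sub>F z in at_bot. \<phi> z < \<theta>"
    using p(2,3) \<theta> by (auto simp: order_tendsto_iff)
  then obtain u v where u: "\<theta> < \<phi> u" and v: "\<And>z. z \<le> v \<Longrightarrow> \<phi> z < \<theta>"
    by (auto simp: eventually_at_top_linorder eventually_at_bot_linorder)
  have ne: "?A \<noteq> {}" using u by (auto intro!: exI[of _ u])
  have bdd: "bdd_below ?A" using v by (intro bdd_belowI[of _ v]) (metis leD linear mem_Collect_eq)
  have 1: "\<phi> z \<le> \<theta>" if "z < Inf ?A" for z
    using cInf_lower[OF _ bdd, of z] that by (auto simp: not_le intro: leI)
  have 2: "\<theta> \<le> \<phi> z" if "Inf ?A < z" for z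
    using cInf_lessD[OF ne that] monoD[OF profileD(1)[OF p(1)], of _ z]
    by (metis less_imp_le mem_Collect_eq order_trans)
  have 3: "\<theta> \<le> \<phi> (Inf ?A)"
  proof (rule tendsto_lowerbound)
    show "(\<phi> \<longlongrightarrow> \<phi> (Inf ?A)) (at_right (Inf ?A))"
      using profileD(4)[OF p(1)] by (simp add: continuous_within)
    show "\<forall>\<^sub>F z in at_right (Inf ?A). \<theta> \<le> \<phi> z"
      unfolding eventually_at_right_field using 2 by (intro exI[of _ "Inf ?A + 1"]) auto
  qed auto
  show ?thesis
    by (rule that[of "Inf ?A"]) (use 1 2 3 in \<open>auto simp: le_less[of 0]\<close>)
qed

text \<open>The moving point is eventually trapped between nearby continuity points of the limit,
  where the values converge. Needed because with varying speeds the arguments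
  \<open>z + r i - cs n * s\<close> move with \<open>n\<close>.\<close>

lemma tendsto_moving_point:
  fixes \<phi> :: "real \<Rightarrow> real"
  assumes mono: "\<And>n. mono (\<phi>s n)" "mono \<phi>"
    and conv: "\<And>y. isCont \<phi> y \<Longrightarrow> (\<lambda>n. \<phi>s n y) \<longlonglongrightarrow> \<phi> y"
    and y: "ys \<longlonglongrightarrow> y" "isCont \<phi> y"
  shows "(\<lambda>n. \<phi>s n (ys n)) \<longlonglongrightarrow> \<phi> y"
proof (rule order_tendstoI)
  have cpt: "\<exists>x. u < x \<and> x < v \<and> isCont \<phi> x" if "u < v" for u v
  proof -
    have "\<not> {u<..<v} \<subseteq> {a. \<not> isCont \<phi> a}"
      using mono_ctble_discont[OF mono(2)] countable_subset uncountable_open_interval[of u v] that by blast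
    then show ?thesis by auto
  qed
  have near: "\<forall>\<^sub>F x in at y. \<bar>\<phi> x - \<phi> y\<bar> < e" if "e > 0" for e
    using y(2) that by (auto simp: isCont_def tendsto_iff dist_real_def)
  {
    fix a assume a: "a < \<phi> y"
    from near[of "\<phi> y - a"] a obtain d where d: "d > 0" "\<And>x. x \<noteq> y \<Longrightarrow> dist x y < d \<Longrightarrow> \<bar>\<phi> x - \<phi> y\<bar> < \<phi> y - a"
      by (auto simp: eventually_at)
    obtain x where x: "y - d < x" "x < y" "isCont \<phi> x" using cpt[of "y - d" y] d by auto
    have "a < \<phi> x" using d(2)[of x] x by (auto simp: dist_real_def)
    then have "\<forall>\<^sub>F n in sequentially. a < \<phi>s n x"
      using conv[OF x(3)] by (auto simp: order_tendsto_iff)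
    moreover have "\<forall>\<^sub>F n in sequentially. x < ys n"
      using y(1) x(2) by (auto simp: order_tendsto_iff)
    ultimately show "\<forall>\<^sub>F n in sequentially. a < \<phi>s n (ys n)"
    proof eventually_elim
      case (elim n)
      then show ?case using monoD[OF mono(1)[of n], of x "ys n"] by simp
    qed
  }
  {
    fix a assume a: "a > \<phi> y"
    from near[of "a - \<phi> y"] a obtain d where d: "d > 0" "\<And>x. x \<noteq> y \<Longrightarrow> dist x y < d \<Longrightarrow> \<bar>\<phi> x - \<phi> y\<bar> < a - \<phi> y"
      by (auto simp: eventually_at)
    obtain x where x: "y < x" "x < y + d" "isCont \<phi> x" using cpt[of y "y + d"] d by auto
    have "\<phi> x < a" using d(2)[of x] x by (auto simp: dist_real_def)
    then have "\<forall>\<^sub>F n in sequentially. \<phi>s n x < a"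
      using conv[OF x(3)] by (auto simp: order_tendsto_iff)
    moreover have "\<forall>\<^sub>F n in sequentially. ys n < x"
      using y(1) x(1) by (auto simp: order_tendsto_iff)
    ultimately show "\<forall>\<^sub>F n in sequentially. \<phi>s n (ys n) < a"
    proof eventually_elim
      case (elim n)
      then show ?case using monoD[OF mono(1)[of n], of "ys n" x] by simp
    qed
  }
qed

lemma countable_avoid_right:
  fixes z :: real
  assumes "countable D" "z < u"
  obtains zs :: "nat \<Rightarrow> real" where "zs \<longlonglongrightarrow> z" "\<And>n. z < zs n" "\<And>n. zs n < u" "\<And>n. zs n \<notin> D"
proof -
  have "\<exists>x. z < x \<and> x < min u (z + 1 / Suc n) \<and> x \<notin> D" for n
  proof -
    have "z < min u (z + 1 / Suc n)" using assms by simp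
    then have "\<not> {z<..<min u (z + 1 / Suc n)} \<subseteq> D"
      using assms countable_subset uncountable_open_interval by blast
    then show ?thesis by auto
  qed
  then obtain zs where zs: "\<And>n. z < zs n \<and> zs n < min u (z + 1 / real (Suc n)) \<and> zs n \<notin> D"
    by metis
  have "zs \<longlonglongrightarrow> z"
  proof (rule tendsto_sandwich)
    show "\<forall>\<^sub>F n in sequentially. z \<le> zs n" using zs by (auto intro!: always_eventually less_imp_le)
    show "\<forall>\<^sub>F n in sequentially. zs n \<le> z + 1 / Suc n"
      using zs by (intro always_eventually allI less_imp_le) (metis min_less_iff_conj)
    show "(\<lambda>n. z + 1 / real (Suc n)) \<longlonglongrightarrow> z"
      using tendsto_add[OF tendsto_const[of z] LIMSEQ_inverse_real_of_nat] by (simp add: inverse_eq_divide)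
  qed auto
  with zs show ?thesis by (intro that[of zs]) auto
qed

text \<open>Translation moves the window to \<open>{A + x..B + x}\<close>. For
  \<open>x \<ge> 0\<close> the piece lost at \<open>A\<close> costs at most \<open>x * w A\<close>;
  for \<open>x < 0\<close> the piece gained there is worth at least \<open>- x * w A\<close>. One
  signed term covers both cases, so that averaging over \<open>x\<close> turns it into a drift; the
  loss at \<open>B\<close> remains as an error.\<close>

lemma interval_shift_bound:
  fixes w :: "real \<Rightarrow> real"
  assumes w: "antimono w" "\<And>z. 0 \<le> w z" and AB: "A \<le> B"
  shows "(\<integral>z. indicator {A..B} z * w z \<partial>lborel) - x * w A - \<bar>x\<bar> * w (B - \<bar>x\<bar>)
    \<le> (\<integral>z. indicator {A..B} z * w (z + x) \<partial>lborel)"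
proof -
  have [measurable]: "w \<in> borel_measurable borel"
    using borel_measurable_mono[of "\<lambda>z. - w z"] w(1) by (simp add: mono_def antimono_def)
  have int: "integrable lborel (\<lambda>z. indicator {u..v} z * w z)" for u v :: real
  proof (rule Bochner_Integration.integrable_bound)
    show "integrable lborel (\<lambda>z. indicator {u..v} z * w u)"
      by (cases "u \<le> v") auto
    show "AE z in lborel. norm (indicator {u..v} z * w z) \<le> norm (indicator {u..v} z * w u)"
      using w by (auto simp: indicator_def antimono_def)
  qed auto
  have shift: "(\<integral>z. indicator {A..B} z * w (z + x) \<partial>lborel) = (\<integral>y. indicator {A + x..B + x} y * w y \<partial>lborel)"
    by (subst lborel_integral_real_affine[where c = 1 and t = x])
      (auto intro!: Bochner_Integration.integral_cong simp: indicator_def add.commute)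
  have anti: "w v \<le> w u" if "u \<le> v" for u v using w(1) that by (simp add: antimono_def)
  show ?thesis
  proof (cases "x \<ge> 0")
    case True
    have "(\<integral>z. indicator {A..B} z * w z \<partial>lborel) - x * w A
        = (\<integral>y. indicator {A..B} y * w y - indicator {A..<A + x} y * w A \<partial>lborel)"
      using True int by (subst Bochner_Integration.integral_diff) auto
    also have "\<dots> \<le> (\<integral>y. indicator {A + x..B + x} y * w y \<partial>lborel)"
    proof (rule integral_mono)
      show "integrable lborel (\<lambda>y. indicator {A..B} y * w y - indicator {A..<A + x} y * w A)"
        using True by (intro Bochner_Integration.integrable_diff int) auto
    qed (use True int w AB anti in \<open>auto simp: indicator_def\<close>)
    also have "0 \<le> \<bar>x\<bar> * w (B - \<bar>x\<bar>)" using w by simp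
    ultimately show ?thesis by (simp add: shift)
  next
    case False
    have "(\<integral>z. indicator {A..B} z * w z \<partial>lborel) - x * w A - \<bar>x\<bar> * w (B - \<bar>x\<bar>)
        = (\<integral>y. indicator {A..B} y * w y + indicator {A + x..<A} y * w A - indicator {B + x<..B} y * w (B + x) \<partial>lborel)"
      using False int by (subst Bochner_Integration.integral_diff, simp, simp, subst Bochner_Integration.integral_add) auto
    also have "\<dots> \<le> (\<integral>y. indicator {A + x..B + x} y * w y \<partial>lborel)"
    proof (rule integral_mono)
      show "integrable lborel (\<lambda>y. indicator {A..B} y * w y + indicator {A + x..<A} y * w A - indicator {B + x<..B} y * w (B + x))"
        using False by (intro Bochner_Integration.integrable_diff Bochner_Integration.integrable_add int) auto
    qed (use False int w AB anti in \<open>auto simp: indicator_def\<close>)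
    finally show ?thesis by (simp add: shift)
  qed
qed

section \<open>The monotone fixed point operator\<close>

text \<open>In the application \<open>G\<close> is \<open>wave_map\<close> and \<nu> the law of
  \<open>S\<close>. Positivity makes exponential moments small, which gives the extreme speeds; the
  absence of atoms makes countably many discontinuities harmless for \<open>c \<noteq> 0\<close> and
  forces rigid fronts to stand still; the first moment defines the drift.\<close>

locale transfer_operator =
  fixes G :: "real ^ 'n \<Rightarrow> real" and r :: "'n \<Rightarrow> real" and \<nu> :: "real measure" and L :: real
  assumes lipschitz: "L-lipschitz_on UNIV G"
    and mono_G: "mono G"
    and G_0: "G (vec 0) = 0"
    and G_1: "G (vec 1) = 1"
    and prob: "prob_space \<nu>"
    and sets_nu [measurable_cong]: "sets \<nu> = sets borel"
    and pos_nu: "AE s in \<nu>. 0 < s"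
    and integrable_nu: "integrable \<nu> (\<lambda>s. s)"
    and no_atom: "\<And>a. AE s in \<nu>. s \<noteq> a"
begin

sublocale prob_space \<nu> by (rule prob)

definition react :: "(real \<Rightarrow> real) \<Rightarrow> real \<Rightarrow> real" where
  "react \<phi> z = G (\<chi> i. \<phi> (z + r i))"

definition transfer :: "real \<Rightarrow> (real \<Rightarrow> real) \<Rightarrow> real \<Rightarrow> real" where
  "transfer c \<phi> z = (\<integral>s. react \<phi> (z - c * s) \<partial>\<nu>)"

lemma continuous_G: "continuous_on UNIV G"
  using lipschitz by (rule lipschitz_on_continuous_on)

lemma measurable_G [measurable]: "G \<in> borel_measurable borel"
  using continuous_G by (rule borel_measurable_continuous_onI)

lemma tendsto_G:
  assumes "\<And>i. ((\<lambda>x. f x i) \<longlongrightarrow> l i) A"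
  shows "((\<lambda>x. G (\<chi> i. f x i)) \<longlongrightarrow> G (\<chi> i. l i)) A"
proof -
  have "isCont G (\<chi> i. l i)" using continuous_G by (simp add: continuous_on_eq_continuous_at)
  then show ?thesis by (rule isCont_tendsto_compose) (intro tendsto_intros assms)
qed

lemma G_mono: "(\<And>i. x i \<le> y i) \<Longrightarrow> G (\<chi> i. x i) \<le> G (\<chi> i. y i)"
  using mono_G by (auto simp: mono_def less_eq_vec_def)

lemma G_const: "G (\<chi> i. 0) = 0" "G (\<chi> i. 1) = 1"
  using G_0 G_1 by (simp_all add: vec_def)

lemma G_bounds:
  assumes "\<And>i. 0 \<le> x i" "\<And>i. x i \<le> 1"
  shows "0 \<le> G (\<chi> i. x i)" "G (\<chi> i. x i) \<le> 1"
  using G_mono[of "\<lambda>_. 0" x] G_mono[of x "\<lambda>_. 1"] assms by (auto simp: G_const)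

lemma react_bounds:
  assumes "\<And>z. 0 \<le> \<phi> z \<and> \<phi> z \<le> 1"
  shows "0 \<le> react \<phi> z" "react \<phi> z \<le> 1"
  using G_bounds[of "\<lambda>i. \<phi> (z + r i)"] assms by (auto simp: react_def)

lemma measurable_react:
  assumes [measurable]: "\<phi> \<in> borel_measurable borel"
  shows "react \<phi> \<in> borel_measurable borel"
proof -
  have "(\<lambda>z. \<chi> i. \<phi> (z + r i)) \<in> borel_measurable borel"
    by (subst borel_measurable_euclidean_space) (auto simp: Basis_vec_def inner_axis)
  then show ?thesis
    unfolding react_def[abs_def] by (rule measurable_compose[OF _ measurable_G])
qed

lemma measurable_react_shift [measurable]:
  assumes [measurable]: "\<phi> \<in> borel_measurable borel"
  shows "(\<lambda>s. react \<phi> (z - c * s)) \<in> borel_measurable \<nu>"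
  by (intro measurable_compose[OF _ measurable_react[OF assms]]) measurable

lemma integrable_react:
  assumes "\<phi> \<in> borel_measurable borel" "\<And>z. 0 \<le> \<phi> z \<and> \<phi> z \<le> 1"
  shows "integrable \<nu> (\<lambda>s. react \<phi> (z - c * s))"
  by (rule integrable_const_bound[of _ 1])
    (use react_bounds[of \<phi>, OF assms(2)] assms(1) in \<open>auto intro!: measurable_react_shift AE_I2\<close>)

lemma transfer_bounds:
  assumes "\<phi> \<in> borel_measurable borel" "\<And>z. 0 \<le> \<phi> z \<and> \<phi> z \<le> 1"
  shows "0 \<le> transfer c \<phi> z" "transfer c \<phi> z \<le> 1"
  using react_bounds[OF assms(2)] integrable_react[OF assms]
  unfolding transfer_def
  by (auto intro!: integral_nonneg integral_le_const)

lemma react_mono: "mono \<phi> \<Longrightarrow> x \<le> y \<Longrightarrow> react \<phi> x \<le> react \<phi> y"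
  unfolding react_def by (rule G_mono) (simp add: monoD)

lemma react_le: "(\<And>z. \<phi> z \<le> \<psi> z) \<Longrightarrow> react \<phi> z \<le> react \<psi> z"
  unfolding react_def by (rule G_mono) simp

lemma transfer_le:
  assumes "\<phi> \<in> borel_measurable borel" "\<psi> \<in> borel_measurable borel"
    and "\<And>z. 0 \<le> \<phi> z \<and> \<phi> z \<le> 1" "\<And>z. 0 \<le> \<psi> z \<and> \<psi> z \<le> 1" "\<And>z. \<phi> z \<le> \<psi> z"
  shows "transfer c \<phi> z \<le> transfer c \<psi> z"
  unfolding transfer_def
  by (intro integral_mono integrable_react assms react_le)

lemma mono_transfer:
  assumes "profile \<phi>"
  shows "mono (transfer c \<phi>)"
  unfolding transfer_def mono_def
  using profileD[OF assms]
  by (auto intro!: integral_mono integrable_react react_mono)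

lemma transfer_translate: "transfer c (\<lambda>z. \<phi> (z + a)) z = transfer c \<phi> (z + a)"
  by (simp add: transfer_def react_def algebra_simps)

lemma transfer_0: "transfer 0 \<phi> = react \<phi>"
  by (simp add: transfer_def prob_space fun_eq_iff)

text \<open>Speed, profile and base point vary together, so that one dominated convergence serves
  right-continuity, the iteration, compactness in the speed and the limits at infinity.\<close>

lemma transfer_tendsto:
  assumes "\<And>n. \<phi>s n \<in> borel_measurable borel" "\<And>n z. 0 \<le> \<phi>s n z \<and> \<phi>s n z \<le> 1"
    and [measurable]: "\<phi> \<in> borel_measurable borel"
    and "AE s in \<nu>. \<forall>i. (\<lambda>n. \<phi>s n (zs n + r i - cs n * s)) \<longlonglongrightarrow> \<phi> (z + r i - c * s)"
  shows "(\<lambda>n. transfer (cs n) (\<phi>s n) (zs n)) \<longlonglongrightarrow> transfer c \<phi> z"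
  unfolding transfer_def
proof (rule integral_dominated_convergence[where w = "\<lambda>_. 1"])
  show "AE s in \<nu>. (\<lambda>n. react (\<phi>s n) (zs n - cs n * s)) \<longlonglongrightarrow> react \<phi> (z - c * s)"
    using assms(4)
  proof eventually_elim
    case (elim s)
    then show ?case unfolding react_def by (intro tendsto_G) (simp add: algebra_simps)
  qed
  show "AE s in \<nu>. norm (react (\<phi>s n) (zs n - cs n * s)) \<le> 1" for n
    using react_bounds[of "\<phi>s n", OF assms(2)] by (intro AE_I2) auto
qed (use assms in \<open>auto intro!: measurable_react_shift\<close>)

lemma rcont_transfer:
  assumes "profile \<phi>"
  shows "continuous (at_right z) (transfer c \<phi>)"
  unfolding continuous_within_sequentially
proof (intro allI impI)
  fix x :: "nat \<Rightarrow> real" assume x: "(\<forall>n. x n \<in> {z<..}) \<and> x \<longlonglongrightarrow> z"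
  have "(\<lambda>n. \<phi> (x n + r i - c * s)) \<longlonglongrightarrow> \<phi> (z + r i - c * s)" for i s
  proof -
    have "\<forall>u. (\<forall>n. u n \<in> {z + r i - c * s<..}) \<and> u \<longlonglongrightarrow> z + r i - c * s \<longrightarrow> (\<phi> \<circ> u) \<longlonglongrightarrow> \<phi> (z + r i - c * s)"
      using profileD(4)[OF assms, of "z + r i - c * s"] unfolding continuous_within_sequentially .
    from spec[OF this, of "\<lambda>n. x n + r i - c * s"] show ?thesis using x
      by (auto simp: o_def intro!: tendsto_intros)
  qed
  then show "(transfer c \<phi> \<circ> x) \<longlonglongrightarrow> transfer c \<phi> z"
    unfolding o_def using profileD[OF assms]
    by (intro transfer_tendsto) auto
qed

lemma profile_transfer:
  assumes "profile \<phi>" shows "profile (transfer c \<phi>)"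
  using mono_transfer[OF assms] rcont_transfer[OF assms] transfer_bounds profileD[OF assms]
  by (auto simp: profile_def)

text \<open>
  For \<open>m = \<infinity>\<close> such a profile is a subsolution of \<open>\<phi> = transfer c \<phi>\<close> on the whole line, for
  \<open>l = -\<infinity>\<close> a supersolution.
\<close>

definition shape :: "real \<Rightarrow> ereal \<Rightarrow> ereal \<Rightarrow> (real \<Rightarrow> real) \<Rightarrow> bool" where
  "shape c l m \<phi> \<longleftrightarrow> profile \<phi> \<and> (\<forall>z. ereal z < l \<longrightarrow> \<phi> z = 0) \<and> (\<forall>z. m \<le> ereal z \<longrightarrow> \<phi> z = 1) \<and>
     (\<forall>z. l \<le> ereal z \<and> ereal z < m \<longrightarrow> \<phi> z = transfer c \<phi> z)"

text \<open>With ends \<open>0\<close> and \<infinity> this says that \<open>c\<close> is a left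
  speed, with -\<infinity> and \<open>0\<close> a right speed, with -\<infinity> and \<infinity>
  that there is a wave. General ends occur because fixing a level at the origin translates
  them.\<close>

definition connects :: "real \<Rightarrow> ereal \<Rightarrow> ereal \<Rightarrow> bool" where
  "connects c l m \<longleftrightarrow> (\<exists>\<phi>. shape c l m \<phi> \<and> (\<phi> \<longlongrightarrow> 0) at_bot \<and> (\<phi> \<longlongrightarrow> 1) at_top)"

section \<open>Translation, truncation and monotone iteration\<close>

lemma shape_translate:
  assumes "shape c l m \<phi>"
  shows "shape c (l - ereal a) (m - ereal a) (\<lambda>z. \<phi> (z + a))"
proof -
  have "(ereal z < l - ereal a) = (ereal (z + a) < l)" "(m - ereal a \<le> ereal z) = (m \<le> ereal (z + a))" for z
    by (cases l; cases m; auto)+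
  moreover from this have "(l - ereal a \<le> ereal z) = (l \<le> ereal (z + a))" "(ereal z < m - ereal a) = (ereal (z + a) < m)" for z
    by (meson not_le)+
  ultimately show ?thesis
    using assms by (auto simp: shape_def transfer_translate profile_translate)
qed

lemma connects_translate:
  assumes "connects c l m" shows "connects c (l - ereal a) (m - ereal a)"
proof -
  from assms obtain \<phi> where \<phi>: "shape c l m \<phi>" "(\<phi> \<longlongrightarrow> 0) at_bot" "(\<phi> \<longlongrightarrow> 1) at_top"
    by (auto simp: connects_def)
  have "filterlim (\<lambda>z. z + a) at_bot at_bot" "filterlim (\<lambda>z. z + a) at_top at_top"
    unfolding filterlim_at_bot filterlim_at_top eventually_at_bot_linorder eventually_at_top_linorder
    by (metis add.commute add_le_cancel_left diff_add_cancel)+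
  then show ?thesis
    unfolding connects_def
    by (intro exI[of _ "\<lambda>z. \<phi> (z + a)"]) (auto intro!: shape_translate \<phi> filterlim_compose[OF \<phi>(2)] filterlim_compose[OF \<phi>(3)])
qed

text \<open>For \<open>l \<le> m\<close> the profiles fixed by this monotone map are those of
  \<open>shape c l m\<close>: the conditions at both ends are absorbed into one fixed point
  problem.\<close>

definition truncate :: "real \<Rightarrow> ereal \<Rightarrow> ereal \<Rightarrow> (real \<Rightarrow> real) \<Rightarrow> real \<Rightarrow> real" where
  "truncate c l m \<phi> z = (if ereal z < l then 0 else if m \<le> ereal z then 1 else transfer c \<phi> z)"

lemma profile_truncate:
  assumes "profile \<phi>"
  shows "profile (truncate c l m \<phi>)"
proof -
  note T = profileD[OF profile_transfer[OF assms, of c]]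
  have "mono (truncate c l m \<phi>)"
  proof (rule monoI)
    fix x y :: real assume "x \<le> y"
    then have "ereal y < l \<Longrightarrow> ereal x < l" "m \<le> ereal x \<Longrightarrow> m \<le> ereal y"
      by (metis ereal_less_eq(3) le_less_trans, metis ereal_less_eq(3) order_trans)
    then show "truncate c l m \<phi> x \<le> truncate c l m \<phi> y"
      using T(2,3) monoD[OF T(1) \<open>x \<le> y\<close>] by (auto simp: truncate_def)
  qed
  moreover have "continuous (at_right z) (truncate c l m \<phi>)" for z
  proof -
    consider "ereal z < l" | "l \<le> ereal z" "m \<le> ereal z" | "l \<le> ereal z" "ereal z < m" by force
    then show ?thesis
    proof cases
      case 1
      then obtain u where u: "ereal z < ereal u" "ereal u < l" using ereal_dense2 by blast
      have "\<forall>\<^sub>F y in at_right z. truncate c l m \<phi> y = 0"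
        unfolding eventually_at_right_field
        by (intro exI[of _ u]) (use u in \<open>auto simp: truncate_def intro: less_trans[of "ereal _" "ereal u" l]\<close>)
      then show ?thesis unfolding continuous_within
        using 1 by (subst tendsto_cong[where g = "\<lambda>_. 0"]) (auto simp: truncate_def)
    next
      case 2
      have "\<forall>\<^sub>F y in at_right z. truncate c l m \<phi> y = 1"
        unfolding eventually_at_right_field
      proof (intro exI[of _ "z + 1"] conjI allI impI)
        fix y assume "z < y"
        then have "l \<le> ereal y" "m \<le> ereal y" using 2
          by (meson ereal_less_eq(3) less_imp_le order_trans)+
        then show "truncate c l m \<phi> y = 1" by (auto simp: truncate_def)
      qed auto
      then show ?thesis unfolding continuous_within
        using 2 by (subst tendsto_cong[where g = "\<lambda>_. 1"]) (auto simp: truncate_def)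
    next
      case 3
      then obtain u where u: "ereal z < ereal u" "ereal u < m" using ereal_dense2 by blast
      have "\<forall>\<^sub>F y in at_right z. truncate c l m \<phi> y = transfer c \<phi> y"
        unfolding eventually_at_right_field
      proof (intro exI[of _ u] conjI allI impI)
        fix y assume "z < y" "y < u"
        then have "l \<le> ereal y" "ereal y < m" using 3 u
          by (meson ereal_less_eq(3) less_imp_le order_trans, meson ereal_less_eq(3) le_less_trans less_imp_le)
        then show "truncate c l m \<phi> y = transfer c \<phi> y" by (auto simp: truncate_def)
      qed (use u in auto)
      then show ?thesis unfolding continuous_within
        using 3 T(4)[of z] by (subst tendsto_cong[where g = "transfer c \<phi>"]) (auto simp: truncate_def continuous_within)
    qed
  qed
  ultimately show ?thesis
    using T(2,3) by (auto simp: profile_def truncate_def)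
qed

lemma truncate_le:
  assumes "profile \<phi>" "profile \<psi>" "\<And>z. \<phi> z \<le> \<psi> z"
  shows "truncate c l m \<phi> z \<le> truncate c l m \<psi> z"
  using transfer_le[of \<phi> \<psi> c z] profileD[OF assms(1)] profileD[OF assms(2)] assms(3)
  by (auto simp: truncate_def)

text \<open>Iterating the truncated operator downwards from \<psi> gives decreasing profiles that
  stay above \<sigma>; their limit is a profile, and dominated convergence makes it a fixed point.
  The two barriers are what later fixes the limits at infinity.\<close>

lemma shape_between:
  assumes lm: "l \<le> m"
    and \<sigma>: "profile \<sigma>" "\<And>z. \<sigma> z \<le> truncate c l m \<sigma> z"
    and \<psi>: "profile \<psi>" "\<And>z. truncate c l m \<psi> z \<le> \<psi> z"
    and le: "\<And>z. \<sigma> z \<le> \<psi> z"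
  shows "\<exists>\<phi>. shape c l m \<phi> \<and> (\<forall>z. \<sigma> z \<le> \<phi> z \<and> \<phi> z \<le> \<psi> z)"
proof -
  define it where "it k = (truncate c l m ^^ k) \<psi>" for k
  have it_Suc: "it (Suc k) = truncate c l m (it k)" for k by (simp add: it_def)
  have prof: "profile (it k)" for k
    by (induction k) (simp_all add: it_Suc profile_truncate, simp add: it_def \<psi>)
  have dec: "it (Suc k) z \<le> it k z" for k z
  proof (induction k arbitrary: z)
    case 0 then show ?case using \<psi>(2) by (simp add: it_def)
  next
    case (Suc k)
    show ?case using truncate_le[OF prof prof Suc.IH] by (simp add: it_Suc)
  qed
  have ge: "\<sigma> z \<le> it k z" for k z
  proof (induction k arbitrary: z)
    case 0 then show ?case using le by (simp add: it_def)
  next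
    case (Suc k)
    have "\<sigma> z \<le> truncate c l m \<sigma> z" by (rule \<sigma>)
    also have "\<dots> \<le> it (Suc k) z" unfolding it_Suc by (intro truncate_le prof \<sigma> Suc.IH)
    finally show ?case .
  qed
  obtain \<phi> where \<phi>: "profile \<phi>" "\<And>z. (\<lambda>k. it k z) \<longlonglongrightarrow> \<phi> z" "\<And>k z. \<phi> z \<le> it k z"
    using decseq_limit_profile[of it] prof dec by blast
  have fixed: "\<phi> z = truncate c l m \<phi> z" for z
  proof (rule LIMSEQ_unique[OF LIMSEQ_Suc[OF \<phi>(2)]])
    have "(\<lambda>k. transfer c (it k) z) \<longlonglongrightarrow> transfer c \<phi> z"
      by (intro transfer_tendsto[where zs="\<lambda>_. z" and cs = "\<lambda>_. c"]) (use profileD[OF prof] profileD[OF \<phi>(1)] \<phi>(2) in auto)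
    then show "(\<lambda>k. it (Suc k) z) \<longlonglongrightarrow> truncate c l m \<phi> z"
      by (simp add: it_Suc truncate_def)
  qed
  have "shape c l m \<phi>"
    unfolding shape_def
    using \<phi>(1) fixed lm by (auto simp: truncate_def)
  moreover have "\<sigma> z \<le> \<phi> z" for z by (rule LIMSEQ_le_const[OF \<phi>(2)]) (use ge in auto)
  moreover have "\<phi> z \<le> \<psi> z" for z using \<phi>(3)[of z 0] by (simp add: it_def)
  ultimately show ?thesis by auto
qed

text \<open>For \<open>c \<noteq> 0\<close> the law of \<open>c * s\<close> inherits the absence of
  atoms. At speed 0 the argument is deterministic, which is why that speed is treated apart
  below.\<close>

lemma AE_countable_avoid:
  assumes "c \<noteq> 0" "countable D"
  shows "AE s in \<nu>. \<forall>i. z + r i - c * s \<notin> D"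
proof -
  have "AE s in \<nu>. \<forall>y\<in>D. z + r i - c * s \<noteq> y" for i
    unfolding AE_ball_countable[OF assms(2)]
  proof
    fix y assume "y \<in> D"
    show "AE s in \<nu>. z + r i - c * s \<noteq> y"
      using no_atom[of "(z + r i - y) / c"] by eventually_elim (use assms in \<open>auto simp: field_simps\<close>)
  qed
  then have "AE s in \<nu>. z + r i - c * s \<notin> D" for i
    by (rule AE_mp[where P = "\<lambda>s. \<forall>y\<in>D. z + r i - c * s \<noteq> y"]) auto
  then show ?thesis by (simp add: AE_all_countable)
qed

lemma continuous_transfer:
  assumes p: "profile \<phi>" and c: "c \<noteq> 0"
  shows "continuous_on UNIV (transfer c \<phi>)"
  unfolding continuous_on_sequentially
proof (intro allI impI ballI)
  fix zs :: "nat \<Rightarrow> real" and z assume "(\<forall>n. zs n \<in> UNIV) \<and> zs \<longlonglongrightarrow> z"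
  then have zs: "zs \<longlonglongrightarrow> z" by simp
  have "AE s in \<nu>. \<forall>i. z + r i - c * s \<notin> {a. \<not> isCont \<phi> a}"
    by (rule AE_countable_avoid[OF c mono_ctble_discont[OF profileD(1)[OF p]]])
  then have "AE s in \<nu>. \<forall>i. (\<lambda>n. \<phi> (zs n + r i - c * s)) \<longlonglongrightarrow> \<phi> (z + r i - c * s)"
  proof eventually_elim
    case (elim s)
    have "(\<lambda>n. zs n + r i - c * s) \<longlonglongrightarrow> z + r i - c * s" for i by (intro tendsto_intros zs)
    then show ?case using elim isCont_tendsto_compose by blast
  qed
  then show "(transfer c \<phi> \<circ> zs) \<longlonglongrightarrow> transfer c \<phi> z"
    unfolding o_def using profileD[OF p] by (intro transfer_tendsto) auto
qed

lemma continuous_react: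
  assumes "continuous_on UNIV \<phi>" shows "continuous_on UNIV (react \<phi>)"
proof -
  have "continuous_on UNIV (\<lambda>z. \<chi> i. \<phi> (z + r i))"
    by (intro continuous_on_vec_lambda continuous_on_compose2[OF assms] continuous_intros) auto
  then show ?thesis
    unfolding react_def[abs_def] by (rule continuous_on_compose2[OF continuous_G]) auto
qed

text \<open>The left profile vanishes on \<open>z < 0\<close> and the right one is 1 on
  \<open>z \<ge> 0\<close>, so they are ordered whatever they do elsewhere. Since
  \<open>transfer\<close> has values in [0,1], they are a sub- and a supersolution on the whole
  line. A fixed point between them takes its limit 0 from the upper and its limit 1 from the lower
  one.\<close>

lemma connects_between:
  assumes "connects c 0 \<infinity>" "connects c (-\<infinity>) 0"
  shows "connects c (-\<infinity>) \<infinity>"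
proof -
  from assms obtain \<phi> \<psi> where \<phi>: "shape c 0 \<infinity> \<phi>" "(\<phi> \<longlongrightarrow> 1) at_top"
    and \<psi>: "shape c (-\<infinity>) 0 \<psi>" "(\<psi> \<longlongrightarrow> 0) at_bot"
    by (auto simp: connects_def)
  have p: "profile \<phi>" "profile \<psi>" using \<phi> \<psi> by (auto simp: shape_def)
  have "\<phi> z \<le> \<psi> z" for z
    using \<phi>(1) \<psi>(1) profileD(2)[OF p(2), of z] profileD(3)[OF p(1), of z]
    by (cases "z < 0") (auto simp: shape_def)
  moreover have "\<phi> z \<le> truncate c (-\<infinity>) \<infinity> \<phi> z" for z
    using \<phi>(1) profileD(2)[OF profile_transfer[OF p(1)], of c z]
    by (cases "z < 0") (auto simp: shape_def truncate_def)
  moreover have "truncate c (-\<infinity>) \<infinity> \<psi> z \<le> \<psi> z" for z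
    using \<psi>(1) profileD(3)[OF profile_transfer[OF p(2)], of c z]
    by (cases "z < 0") (auto simp: shape_def truncate_def)
  ultimately obtain \<theta> where \<theta>: "shape c (-\<infinity>) \<infinity> \<theta>" "\<And>z. \<phi> z \<le> \<theta> z \<and> \<theta> z \<le> \<psi> z"
    using shape_between[of "-\<infinity>" \<infinity> \<phi> c \<psi>] p by auto
  have pt: "profile \<theta>" using \<theta> by (auto simp: shape_def)
  have "(\<theta> \<longlongrightarrow> 0) at_bot"
    by (rule tendsto_sandwich[OF _ _ tendsto_const \<psi>(2)]) (use profileD(2)[OF pt] \<theta>(2) in \<open>auto intro: always_eventually\<close>)
  moreover have "(\<theta> \<longlongrightarrow> 1) at_top"
    by (rule tendsto_sandwich[OF _ _ \<phi>(2) tendsto_const]) (use profileD(3)[OF pt] \<theta>(2) in \<open>auto intro: always_eventually\<close>)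
  ultimately show ?thesis using \<theta>(1) by (auto simp: connects_def)
qed

text \<open>On a bounded interval truncation prescribes both end values, so the zero function and
  the unit step are barriers for every speed.\<close>

lemma connects_truncated:
  assumes "n > 0"
  shows "connects c 0 (ereal n)"
proof -
  let ?\<psi> = "\<lambda>z::real. if z < 0 then 0 else 1::real"
  have "(0::real) \<le> truncate c 0 (ereal n) (\<lambda>_. 0) z" for z
    using transfer_bounds(1)[of "\<lambda>_. 0"] by (auto simp: truncate_def)
  moreover have "truncate c 0 (ereal n) ?\<psi> z \<le> ?\<psi> z" for z
    using profileD(3)[OF profile_transfer[OF profile_step]] by (auto simp: truncate_def)
  moreover have "0 \<le> ?\<psi> z" for z by auto
  ultimately obtain \<phi> where \<phi>: "shape c 0 (ereal n) \<phi>" "\<And>z. 0 \<le> \<phi> z \<and> \<phi> z \<le> ?\<psi> z"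
    using shape_between[of 0 "ereal n" "\<lambda>_. 0" c ?\<psi>] profile_step profile_0 assms by auto
  have "\<forall>\<^sub>F z in at_bot. \<phi> z = 0"
    using \<phi>(1) unfolding eventually_at_bot_linorder by (intro exI[of _ "-1"]) (auto simp: shape_def)
  moreover have "\<forall>\<^sub>F z in at_top. \<phi> z = 1"
    using \<phi>(1) unfolding eventually_at_top_linorder by (intro exI[of _ n]) (auto simp: shape_def)
  ultimately show ?thesis
    unfolding connects_def using \<phi>(1) by (blast intro: tendsto_eventually)
qed

section \<open>Exponential barriers at extreme speeds\<close>

lemma react_lipschitz:
  "\<bar>react \<phi> z - react \<psi> z\<bar> \<le> L * (\<Sum>i\<in>UNIV. \<bar>\<phi> (z + r i) - \<psi> (z + r i)\<bar>)"
proof -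
  have L: "0 \<le> L" using lipschitz by (rule lipschitz_on_nonneg)
  have "\<bar>react \<phi> z - react \<psi> z\<bar> \<le> L * norm ((\<chi> i. \<phi> (z + r i)) - (\<chi> i. \<psi> (z + r i)))"
    using lipschitz_onD[OF lipschitz, of "\<chi> i. \<phi> (z + r i)" "\<chi> i. \<psi> (z + r i)"]
    by (simp add: react_def dist_norm)
  also have "\<dots> \<le> L * (\<Sum>i\<in>UNIV. \<bar>\<phi> (z + r i) - \<psi> (z + r i)\<bar>)"
    using norm_le_l1_cart[of "(\<chi> i. \<phi> (z + r i)) - (\<chi> i. \<psi> (z + r i))"] L
    by (intro mult_left_mono) auto
  finally show ?thesis .
qed

text \<open>The integrand tends to 0 almost surely because \<open>s > 0\<close>. The integral is the
  factor by which speed \<open>k\<close> damps an exponential barrier.\<close>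

lemma laplace_small:
  assumes "e > 0"
  obtains k :: nat where "integrable \<nu> (\<lambda>s. exp (- real k * s))" "(\<integral>s. exp (- real k * s) \<partial>\<nu>) < e"
proof -
  have int: "integrable \<nu> (\<lambda>s. exp (- real k * s))" for k
    by (rule integrable_const_bound[of _ 1]) (use pos_nu in auto)
  have "(\<lambda>k. \<integral>s. exp (- real k * s) \<partial>\<nu>) \<longlonglongrightarrow> (\<integral>s. 0 \<partial>\<nu>)"
  proof (rule integral_dominated_convergence[where w = "\<lambda>_. 1"])
    show "AE s in \<nu>. (\<lambda>k. exp (- real k * s)) \<longlonglongrightarrow> 0"
      using pos_nu
    proof eventually_elim
      case (elim s)
      have "(\<lambda>k. exp (-s) ^ k) \<longlonglongrightarrow> 0" using elim by (intro LIMSEQ_power_zero) auto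
      then show ?case by (simp add: exp_of_nat_mult[symmetric])
    qed
    show "AE s in \<nu>. norm (exp (- real k * s)) \<le> 1" for k
      using pos_nu by eventually_elim auto
  qed auto
  then have "\<forall>\<^sub>F k in sequentially. (\<integral>s. exp (- real k * s) \<partial>\<nu>) < e"
    using assms by (auto simp: order_tendsto_iff)
  then show ?thesis using that int by (auto simp: eventually_sequentially)
qed

text \<open>On \<open>min 1 (exp z)\<close> the map \<open>react\<close> costs at most the Lipschitz
  factor \<open>C\<close>, and transport at speed \<open>k\<close> multiplies by the small moment of
  \<open>exp (- k * s)\<close>. At large speed the barrier is thus a supersolution, and it forces
  the limit 0 at -\<infinity>; the limit 1 is prescribed.\<close>

lemma ex_connects_right: "\<exists>c. connects c (-\<infinity>) 0"
proof -
  let ?\<psi> = "\<lambda>z::real. min 1 (exp z)"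
  define C where "C = L * (\<Sum>i\<in>UNIV. exp (r i))"
  have L: "0 \<le> L" using lipschitz by (rule lipschitz_on_nonneg)
  then have C: "0 \<le> C" unfolding C_def by (intro mult_nonneg_nonneg sum_nonneg) auto
  obtain k :: nat where k: "integrable \<nu> (\<lambda>s. exp (- real k * s))" "(\<integral>s. exp (- real k * s) \<partial>\<nu>) < 1 / (C + 1)"
    using laplace_small[of "1 / (C + 1)"] C by auto
  have "\<forall>z. continuous (at_right z) ?\<psi>"
    by (auto simp: continuous_within intro!: tendsto_eq_intros)
  then have p: "profile ?\<psi>"
    by (auto simp: profile_def mono_def min_def)
  have react_le: "react ?\<psi> z \<le> C * exp z" for z
  proof -
    have "react ?\<psi> z = \<bar>react ?\<psi> z - react (\<lambda>_. 0) z\<bar>"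
      using react_bounds(1)[of ?\<psi> z] by (simp add: react_def G_const)
    also have "\<dots> \<le> L * (\<Sum>i\<in>UNIV. \<bar>?\<psi> (z + r i) - 0\<bar>)" by (rule react_lipschitz)
    also have "\<dots> \<le> L * (\<Sum>i\<in>UNIV. exp (z + r i))"
      using L by (intro mult_left_mono sum_mono) auto
    also have "\<dots> = C * exp z" by (simp add: C_def exp_add sum_distrib_left mult.commute mult.left_commute)
    finally show ?thesis .
  qed
  have "transfer (real k) ?\<psi> z \<le> exp z" for z
  proof -
    have "transfer (real k) ?\<psi> z \<le> (\<integral>s. C * exp z * exp (- real k * s) \<partial>\<nu>)"
      unfolding transfer_def
    proof (rule integral_mono)
      show "integrable \<nu> (\<lambda>s. react ?\<psi> (z - real k * s))"
        by (rule integrable_react) auto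
      show "react ?\<psi> (z - real k * s) \<le> C * exp z * exp (- real k * s)" for s
        using react_le[of "z - real k * s"] by (simp add: exp_diff exp_minus field_simps)
    qed (use k in auto)
    also have "\<dots> = C * exp z * (\<integral>s. exp (- real k * s) \<partial>\<nu>)" by simp
    also have "\<dots> \<le> C * exp z * (1 / (C + 1))" using k C by (intro mult_left_mono) auto
    also have "\<dots> \<le> 1 * exp z" using C by (simp add: field_simps)
    finally show ?thesis by simp
  qed
  then have sup: "truncate (real k) (-\<infinity>) 0 ?\<psi> z \<le> ?\<psi> z" for z
    using profileD(3)[OF profile_transfer[OF p], of "real k" z] by (auto simp: truncate_def)
  have "(0::real) \<le> truncate (real k) (-\<infinity>) 0 (\<lambda>_. 0) z" for z
    using transfer_bounds(1)[of "\<lambda>_. 0"] by (auto simp: truncate_def)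
  then obtain \<phi> where \<phi>: "shape (real k) (-\<infinity>) 0 \<phi>" "\<And>z. 0 \<le> \<phi> z \<and> \<phi> z \<le> ?\<psi> z"
    using shape_between[of "-\<infinity>" 0 "\<lambda>_. 0" "real k" ?\<psi>] profile_0 p sup by auto
  have "(\<phi> \<longlongrightarrow> 0) at_bot"
  proof (rule tendsto_sandwich[OF _ _ tendsto_const exp_at_bot])
    show "\<forall>\<^sub>F z in at_bot. 0 \<le> \<phi> z" using \<phi>(2) by auto
    show "\<forall>\<^sub>F z in at_bot. \<phi> z \<le> exp z" using \<phi>(2) by (intro always_eventually allI) (metis min.boundedE)
  qed
  moreover have "\<forall>\<^sub>F z in at_top. \<phi> z = 1"
    using \<phi>(1) unfolding eventually_at_top_linorder by (intro exI[of _ 0]) (auto simp: shape_def)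
  ultimately show ?thesis
    unfolding connects_def using \<phi>(1) by (blast intro: tendsto_eventually)
qed

text \<open>Mirror image of the previous argument about the state 1: the subsolution is
  \<open>max 0 (1 - exp (- z))\<close> and the speed is \<open>- k\<close>.\<close>

lemma ex_connects_left: "\<exists>c. connects c 0 \<infinity>"
proof -
  let ?\<sigma> = "\<lambda>z::real. max 0 (1 - exp (- z))"
  let ?\<psi> = "\<lambda>z::real. if z < 0 then 0 else 1::real"
  define C where "C = L * (\<Sum>i\<in>UNIV. exp (- r i))"
  have L: "0 \<le> L" using lipschitz by (rule lipschitz_on_nonneg)
  then have C: "0 \<le> C" unfolding C_def by (intro mult_nonneg_nonneg sum_nonneg) auto
  obtain k :: nat where k: "integrable \<nu> (\<lambda>s. exp (- real k * s))" "(\<integral>s. exp (- real k * s) \<partial>\<nu>) < 1 / (C + 1)"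
    using laplace_small[of "1 / (C + 1)"] C by auto
  define c where "c = - real k"
  have "\<forall>z. continuous (at_right z) ?\<sigma>"
    by (auto simp: continuous_within intro!: tendsto_eq_intros)
  then have p: "profile ?\<sigma>"
    by (auto simp: profile_def mono_def max_def)
  have react_ge: "1 - react ?\<sigma> z \<le> C * exp (-z)" for z
  proof -
    have "1 - react ?\<sigma> z = \<bar>react (\<lambda>_. 1) z - react ?\<sigma> z\<bar>"
      using react_bounds(2)[of ?\<sigma> z] by (simp add: react_def G_const)
    also have "\<dots> \<le> L * (\<Sum>i\<in>UNIV. \<bar>1 - ?\<sigma> (z + r i)\<bar>)" by (rule react_lipschitz)
    also have "\<dots> \<le> L * (\<Sum>i\<in>UNIV. exp (- z - r i))"
      using L by (intro mult_left_mono sum_mono) (auto simp: max_def not_le)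
    also have "\<dots> = C * exp (- z)" by (simp add: C_def exp_diff exp_minus field_simps sum_distrib_left)
    finally show ?thesis .
  qed
  have "1 - exp (-z) \<le> transfer c ?\<sigma> z" for z
  proof -
    have i1: "integrable \<nu> (\<lambda>s. react ?\<sigma> (z - c * s))"
      by (rule integrable_react) auto
    have "1 - transfer c ?\<sigma> z = (\<integral>s. 1 - react ?\<sigma> (z - c * s) \<partial>\<nu>)"
      unfolding transfer_def using i1 by (simp add: prob_space)
    also have "\<dots> \<le> (\<integral>s. C * exp (-z) * exp (- real k * s) \<partial>\<nu>)"
    proof (rule integral_mono)
      show "1 - react ?\<sigma> (z - c * s) \<le> C * exp (-z) * exp (- real k * s)" for s
        using react_ge[of "z - c * s"] by (simp add: exp_diff exp_minus exp_add field_simps c_def)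
    qed (use k i1 in auto)
    also have "\<dots> = C * exp (-z) * (\<integral>s. exp (- real k * s) \<partial>\<nu>)" by simp
    also have "\<dots> \<le> C * exp (-z) * (1 / (C + 1))" using k C by (intro mult_left_mono) auto
    also have "\<dots> \<le> 1 * exp (-z)" using C by (simp add: field_simps)
    finally show ?thesis by simp
  qed
  then have sub: "?\<sigma> z \<le> truncate c 0 \<infinity> ?\<sigma> z" for z
    using profileD(2)[OF profile_transfer[OF p], of c z] by (auto simp: truncate_def)
  have "truncate c 0 \<infinity> ?\<psi> z \<le> ?\<psi> z" for z
    using profileD(3)[OF profile_transfer[OF profile_step]] by (auto simp: truncate_def)
  moreover have "?\<sigma> z \<le> ?\<psi> z" for z by auto
  ultimately obtain \<phi> where \<phi>: "shape c 0 \<infinity> \<phi>" "\<And>z. ?\<sigma> z \<le> \<phi> z \<and> \<phi> z \<le> ?\<psi> z"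
    using shape_between[of 0 \<infinity> ?\<sigma> c ?\<psi>] profile_step p sub by auto
  have "(\<phi> \<longlongrightarrow> 1) at_top"
  proof (rule tendsto_sandwich[OF _ _ _ tendsto_const])
    show "\<forall>\<^sub>F z in at_top. 1 - exp (-z) \<le> \<phi> z"
      using \<phi>(2) by (intro always_eventually allI) (metis max.boundedE)
    show "\<forall>\<^sub>F z in at_top. \<phi> z \<le> 1" using \<phi>(1) by (auto simp: shape_def profile_def)
    show "((\<lambda>z::real. 1 - exp (- z)) \<longlongrightarrow> (1::real)) at_top"
      using tendsto_diff[OF tendsto_const[of "1::real"] filterlim_compose[OF exp_at_bot filterlim_uminus_at_bot_at_top]] by simp
  qed
  moreover have "\<forall>\<^sub>F z in at_bot. \<phi> z = 0"
    using \<phi>(1) unfolding eventually_at_bot_linorder by (intro exI[of _ "-1"]) (auto simp: shape_def)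
  ultimately show ?thesis
    unfolding connects_def using \<phi>(1) by (blast intro: tendsto_eventually)
qed

section \<open>Compactness of profiles with a fixed level at the origin\<close>

lemma transfer_limit_off_countable:
  assumes prof: "\<And>n. profile (\<phi>s n)" "profile \<phi>"
    and conv: "\<And>y. isCont \<phi> y \<Longrightarrow> (\<lambda>n. \<phi>s n y) \<longlonglongrightarrow> \<phi> y"
    and cs: "cs \<longlonglongrightarrow> c"
  shows "\<exists>D. countable D \<and> (\<forall>z. z \<notin> D \<longrightarrow> (\<lambda>n. transfer (cs n) (\<phi>s n) z) \<longlonglongrightarrow> transfer c \<phi> z)"
proof -
  define D0 where "D0 = {a. \<not> isCont \<phi> a}"
  have D0: "countable D0" unfolding D0_def by (rule mono_ctble_discont[OF profileD(1)[OF prof(2)]])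
  \<comment> \<open>At speed 0 the arguments \<open>z + r i\<close> are deterministic, so
    \<open>z\<close> has to avoid these translates of the discontinuities. At other speeds almost
    every \<open>s\<close> avoids them for any \<open>z\<close>.\<close>
  define D where "D = (\<Union>i. (\<lambda>y. y - r i) ` D0)"
  have D: "countable D" unfolding D_def using D0 by auto
  have "(\<lambda>n. transfer (cs n) (\<phi>s n) z) \<longlonglongrightarrow> transfer c \<phi> z" if z: "z \<notin> D" for z
  proof (rule transfer_tendsto[where zs = "\<lambda>_. z"])
    have "AE s in \<nu>. \<forall>i. z + r i - c * s \<notin> D0"
    proof (cases "c = 0")
      case True
      have "z + r i \<notin> D0" for i using z by (force simp: D_def)
      then show ?thesis using True by auto
    qed (use AE_countable_avoid D0 in auto)
    then show "AE s in \<nu>. \<forall>i. (\<lambda>n. \<phi>s n (z + r i - cs n * s)) \<longlonglongrightarrow> \<phi> (z + r i - c * s)"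
    proof eventually_elim
      case (elim s)
      show ?case
      proof
        fix i
        show "(\<lambda>n. \<phi>s n (z + r i - cs n * s)) \<longlonglongrightarrow> \<phi> (z + r i - c * s)"
        proof (rule tendsto_moving_point[where ys = "\<lambda>n. z + r i - cs n * s" and \<phi>s = \<phi>s and \<phi> = \<phi> and y = "z + r i - c * s"])
          show "isCont \<phi> (z + r i - c * s)" using elim by (auto simp: D0_def)
        qed (use conv cs profileD(1)[OF prof(1)] profileD(1)[OF prof(2)] in \<open>auto intro!: tendsto_intros\<close>)
      qed
    qed
  qed (use profileD[OF prof(1)] profileD[OF prof(2)] in auto)
  then show ?thesis using D by auto
qed

text \<open>Helly's theorem gives a right-continuous limit, the ends converge in
  \<open>ereal\<close>, and the equation passes to the limit off a countable set. Fixing a level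
  strictly between 0 and 1 at the origin prevents the limit from being identically 0 or 1.\<close>

lemma shape_compact:
  assumes shape: "\<And>n. shape (cs n) (ls n) (ms n) (\<phi>s n)" and cs: "cs \<longlonglongrightarrow> c"
    and lvl: "\<And>n z. z < 0 \<Longrightarrow> \<phi>s n z \<le> \<theta>" "\<And>n z. 0 \<le> z \<Longrightarrow> \<theta> \<le> \<phi>s n z"
    and \<theta>: "0 < \<theta>" "\<theta> < 1"
  shows "\<exists>\<phi> l m s. strict_mono (s :: nat \<Rightarrow> nat) \<and> (ls \<circ> s) \<longlonglongrightarrow> l \<and> (ms \<circ> s) \<longlonglongrightarrow> m \<and>
    shape c l m \<phi> \<and> (\<forall>z<0. \<phi> z \<le> \<theta>) \<and> (\<forall>z\<ge>0. \<theta> \<le> \<phi> z)"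
proof -
  have prof: "profile (\<phi>s n)" for n using shape by (auto simp: shape_def)
  have l_le: "ls n \<le> 0" for n
    using shape[of n] lvl(2)[of 0 n] \<theta> by (force simp: shape_def not_less[symmetric] zero_ereal_def)
  have m_ge: "0 \<le> ms n" for n
  proof (rule ccontr)
    assume "\<not> 0 \<le> ms n"
    then obtain z where "ms n < ereal z" "z < 0" by (metis ereal_dense2 ereal_less(2) not_le zero_ereal_def ereal_less_eq(3) less_ereal.simps(1))
    then show False using shape[of n] lvl(1)[of z n] \<theta> by (auto simp: shape_def)
  qed
  obtain s1 :: "nat \<Rightarrow> nat" and l where s1: "strict_mono s1" "(ls \<circ> s1) \<longlonglongrightarrow> l"
    using compact_complete_linorder[of ls] by auto
  obtain s2 :: "nat \<Rightarrow> nat" and m where s2: "strict_mono s2" "((ms \<circ> s1) \<circ> s2) \<longlonglongrightarrow> m"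
    using compact_complete_linorder[of "ms \<circ> s1"] by auto
  have "\<exists>s::nat\<Rightarrow>nat. strict_mono s \<and> (\<exists>F. (\<forall>x. continuous (at_right x) F) \<and> mono F \<and> (\<forall>x. \<bar>F x\<bar> \<le> 1) \<and>
    (\<forall>x. continuous (at x) F \<longrightarrow> (\<lambda>n. \<phi>s (s1 (s2 (s n))) x) \<longlonglongrightarrow> F x))"
    by (rule Helly_selection) (use profileD[OF prof] in \<open>auto simp: abs_le_iff intro: order_trans[of _ 0]\<close>)
  then obtain s3 \<phi> where s3: "strict_mono (s3 :: nat \<Rightarrow> nat)"
    and rc: "\<And>x. continuous (at_right x) \<phi>" and mono: "mono \<phi>"
    and conv: "\<And>x. isCont \<phi> x \<Longrightarrow> (\<lambda>n. \<phi>s (s1 (s2 (s3 n))) x) \<longlonglongrightarrow> \<phi> x" by blast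
  define s where "s = s1 \<circ> s2 \<circ> s3"
  have s: "strict_mono s" unfolding s_def by (intro strict_mono_o s1 s2 s3)
  have lim_l: "(ls \<circ> s) \<longlonglongrightarrow> l"
    using LIMSEQ_subseq_LIMSEQ[OF s1(2) strict_mono_o[OF s2(1) s3]] by (simp add: s_def o_assoc)
  have lim_m: "(ms \<circ> s) \<longlonglongrightarrow> m"
    using LIMSEQ_subseq_LIMSEQ[OF s2(2) s3] by (simp add: s_def o_assoc)
  have lim_c: "(\<lambda>n. cs (s n)) \<longlonglongrightarrow> c"
    using LIMSEQ_subseq_LIMSEQ[OF cs s] by (simp add: o_def)
  have conv: "(\<lambda>n. \<phi>s (s n) x) \<longlonglongrightarrow> \<phi> x" if "isCont \<phi> x" for x
    using conv[OF that] by (simp add: s_def)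
  define D0 where "D0 = {a. \<not> isCont \<phi> a}"
  have D0: "countable D0" unfolding D0_def by (rule mono_ctble_discont[OF mono])
  have between: "\<exists>x. u < x \<and> x < v \<and> x \<notin> D0" if "u < v" for u v
    using countable_avoid_right[OF D0 that] by metis
  text \<open>Pointwise bounds of the approximants pass to the limit, since continuity points are dense.\<close>
  have upper: "\<phi> z \<le> a" if "z < u" and ev: "\<And>y. y < u \<Longrightarrow> \<forall>\<^sub>F n in sequentially. \<phi>s (s n) y \<le> a" for z u a
  proof -
    obtain y where y: "z < y" "y < u" "y \<notin> D0" using between[OF \<open>z < u\<close>] by auto
    have "\<phi> z \<le> \<phi> y" using y monoD[OF mono] by simp
    also have "\<phi> y \<le> a" by (rule tendsto_upperbound[OF conv ev]) (use y in \<open>auto simp: D0_def\<close>)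
    finally show ?thesis .
  qed
  have lower: "a \<le> \<phi> z" if ev: "\<And>y. u < y \<Longrightarrow> \<forall>\<^sub>F n in sequentially. a \<le> \<phi>s (s n) y" and "u \<le> z" for z u a
  proof -
    have *: "a \<le> \<phi> x" if "u < x" for x
    proof -
      obtain y where y: "u < y" "y < x" "y \<notin> D0" using between[OF \<open>u < x\<close>] by auto
      have "a \<le> \<phi> y" by (rule tendsto_lowerbound[OF conv ev]) (use y in \<open>auto simp: D0_def\<close>)
      also have "\<phi> y \<le> \<phi> x" using y monoD[OF mono] by simp
      finally show ?thesis .
    qed
    show ?thesis
    proof (rule tendsto_lowerbound)
      show "(\<phi> \<longlongrightarrow> \<phi> z) (at_right z)" using rc by (simp add: continuous_within)
      show "\<forall>\<^sub>F x in at_right z. a \<le> \<phi> x"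
        unfolding eventually_at_right_field using * \<open>u \<le> z\<close> by (intro exI[of _ "z + 1"]) auto
    qed auto
  qed
  have prof\<phi>: "profile \<phi>"
    using mono rc lower[of "z - 1" 0 z for z] upper[of z "z + 1" 1 for z] profileD[OF prof]
    by (auto simp: profile_def)
  have z_l: "\<phi> z = 0" if z: "ereal z < l" for z
  proof -
    obtain u where u: "ereal z < ereal u" "ereal u < l" using ereal_dense2[OF z] by auto
    have "\<phi> z \<le> 0"
    proof (rule upper[of z u])
      fix y assume "y < u"
      have "\<forall>\<^sub>F n in sequentially. ereal u < ls (s n)" using order_tendstoD(1)[OF lim_l u(2)] by simp
      then show "\<forall>\<^sub>F n in sequentially. \<phi>s (s n) y \<le> 0"
      proof eventually_elim
        case (elim n)
        then have "ereal y < ls (s n)" using \<open>y < u\<close> by (meson ereal_less_eq(3) le_less_trans less_imp_le)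
        then show ?case using shape[of "s n"] by (auto simp: shape_def)
      qed
    qed (use u in auto)
    then show ?thesis using profileD(2)[OF prof\<phi>, of z] by simp
  qed
  have z_m: "\<phi> z = 1" if z: "m \<le> ereal z" for z
  proof -
    have "1 \<le> \<phi> z"
    proof (rule lower[of z])
      fix y assume "z < y"
      then have "m < ereal y" using z by (meson le_less_trans less_ereal.simps(1))
      then have "\<forall>\<^sub>F n in sequentially. ms (s n) < ereal y" using order_tendstoD(2)[OF lim_m] by simp
      then show "\<forall>\<^sub>F n in sequentially. 1 \<le> \<phi>s (s n) y"
      proof eventually_elim
        case (elim n)
        then show ?case using shape[of "s n"] by (auto simp: shape_def)
      qed
    qed auto
    then show ?thesis using profileD(3)[OF prof\<phi>, of z] by simp
  qed
  obtain D1 where D1: "countable D1" "\<And>z. z \<notin> D1 \<Longrightarrow> (\<lambda>n. transfer (cs (s n)) (\<phi>s (s n)) z) \<longlonglongrightarrow> transfer c \<phi> z"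
    using transfer_limit_off_countable[of "\<lambda>n. \<phi>s (s n)" \<phi> "\<lambda>n. cs (s n)" c] prof prof\<phi> conv lim_c by auto
  have off: "\<phi> z = transfer c \<phi> z" if "l < ereal z" "ereal z < m" "z \<notin> D0 \<union> D1" for z
  proof (rule LIMSEQ_unique[OF conv])
    show "isCont \<phi> z" using that by (auto simp: D0_def)
    have "\<forall>\<^sub>F n in sequentially. ls (s n) < ereal z" "\<forall>\<^sub>F n in sequentially. ereal z < ms (s n)"
      using order_tendstoD(2)[OF lim_l that(1)] order_tendstoD(1)[OF lim_m that(2)] by simp_all
    then have "\<forall>\<^sub>F n in sequentially. transfer (cs (s n)) (\<phi>s (s n)) z = \<phi>s (s n) z"
      by eventually_elim (use shape in \<open>auto simp: shape_def\<close>)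
    moreover have "(\<lambda>n. transfer (cs (s n)) (\<phi>s (s n)) z) \<longlonglongrightarrow> transfer c \<phi> z"
      using D1(2)[of z] that by auto
    ultimately show "(\<lambda>n. \<phi>s (s n) z) \<longlonglongrightarrow> transfer c \<phi> z"
      by (rule Lim_transform_eventually[rotated])
  qed
  \<comment> \<open>Right-continuity of both sides extends the equation to the excluded points and
    to the end \<open>z = l\<close>, which is approached from inside the interval.\<close>
  have eq: "\<phi> z = transfer c \<phi> z" if z: "l \<le> ereal z" "ereal z < m" for z
  proof -
    obtain u where u: "ereal z < ereal u" "ereal u < m" using ereal_dense2[OF z(2)] by auto
    obtain zs where zs: "zs \<longlonglongrightarrow> z" "\<And>n. z < zs n" "\<And>n. zs n < u" "\<And>n. zs n \<notin> D0 \<union> D1"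
      using countable_avoid_right[of "D0 \<union> D1" z u] D0 D1(1) u by auto
    have *: "\<phi> (zs n) = transfer c \<phi> (zs n)" for n
    proof (rule off)
      show "l < ereal (zs n)" using z(1) zs(2)[of n] by (meson le_less_trans less_ereal.simps(1))
      show "ereal (zs n) < m" using u(2) zs(3)[of n] by (meson less_trans less_ereal.simps(1))
    qed (rule zs)
    have "(\<phi> \<circ> zs) \<longlonglongrightarrow> \<phi> z" "(transfer c \<phi> \<circ> zs) \<longlonglongrightarrow> transfer c \<phi> z"
      using rc[of z] rcont_transfer[OF prof\<phi>, of z c] zs(1,2)
      unfolding continuous_within_sequentially by auto
    then show ?thesis using * by (auto simp: o_def intro: LIMSEQ_unique)
  qed
  have "shape c l m \<phi>" using prof\<phi> z_l z_m eq by (auto simp: shape_def)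
  moreover have "\<phi> z \<le> \<theta>" if "z < 0" for z
    by (rule upper[of z 0]) (use that lvl in auto)
  moreover have "\<theta> \<le> \<phi> z" if "z \<ge> 0" for z
    by (rule lower[of 0]) (use that lvl in auto)
  ultimately show ?thesis using s lim_l lim_m by blast
qed

subsection \<open>Fronts at the unstable state\<close>

text \<open>The kernel gives mass \<open>a i\<close> to the law of the displacement \<rho> i - c s;
  this is its mean displacement, not divided by the total mass.\<close>

definition drift :: "('n \<Rightarrow> real) \<Rightarrow> ('n \<Rightarrow> real) \<Rightarrow> real \<Rightarrow> real" where
  "drift a \<rho> c = (\<Sum>i\<in>UNIV. a i * (\<rho> i - c * (\<integral>s. s \<partial>\<nu>)))"

text \<open>Reflecting the line changes the signs of the shifts and of the speed. In this way fronts
  above \<open>b\<close> are handled as reflected fronts below \<open>b\<close>.\<close>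

lemma drift_uminus: "drift a (\<lambda>i. - \<rho> i) (- c) = - drift a \<rho> c"
  by (simp add: drift_def sum_negf[symmetric] algebra_simps)

text \<open>
  Integrating the inequality over \<open>[A, B]\<close> gains a factor \<open>\<Sum>a > 1\<close>; the loss at \<open>A\<close> is
  \<open>drift * w A \<le> 0\<close> and the loss at \<open>B\<close> tends to zero.
\<close>

lemma superharmonic_vanishes:
  fixes w :: "real \<Rightarrow> real"
  assumes w: "antimono w" "\<And>z. 0 \<le> w z" "\<And>z. w z \<le> \<delta>" "(w \<longlongrightarrow> 0) at_top"
    and a: "\<And>i. 0 \<le> a i" "1 < (\<Sum>i\<in>UNIV. a i)"
    and drift: "drift a \<rho> c \<le> 0"
    and le: "\<And>z. A \<le> z \<Longrightarrow> (\<Sum>i\<in>UNIV. a i * (\<integral>s. w (z + \<rho> i - c * s) \<partial>\<nu>)) \<le> w z"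
    and z: "A < z"
  shows "w z = 0"
proof -
  have [measurable]: "w \<in> borel_measurable borel"
    using borel_measurable_mono[of "\<lambda>z. - w z"] w(1) by (simp add: mono_def antimono_def)
  have \<delta>: "0 \<le> \<delta>" using w(2,3) order_trans by blast
  define x where "x i s = \<rho> i - c * s" for i s
  \<comment> \<open>The loss through the right end \<open>B\<close>, averaged over the kernel: the
    last term of \<open>interval_shift_bound\<close>.\<close>
  define \<epsilon> where "\<epsilon> B = (\<Sum>i\<in>UNIV. a i * (\<integral>s. \<bar>x i s\<bar> * w (B - \<bar>x i s\<bar>) \<partial>\<nu>))" for B
  have x_int: "integrable \<nu> (x i)" for i
    unfolding x_def using integrable_nu by auto
  have xw_int: "integrable \<nu> (\<lambda>s. \<bar>x i s\<bar> * w (B - \<bar>x i s\<bar>))" for i B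
  proof (rule Bochner_Integration.integrable_bound)
    show "integrable \<nu> (\<lambda>s. \<bar>x i s\<bar> * \<delta>)" using x_int by auto
    show "AE s in \<nu>. norm (\<bar>x i s\<bar> * w (B - \<bar>x i s\<bar>)) \<le> norm (\<bar>x i s\<bar> * \<delta>)"
      using w(2,3) \<delta> by (auto simp: abs_mult intro!: mult_left_mono)
  qed (simp add: x_def)
  have main: "((\<Sum>i\<in>UNIV. a i) - 1) * ((z - A) * w z) \<le> \<epsilon> B" if B: "z \<le> B" for B
  proof -
    have AB: "A \<le> B" using z B by simp
    define M where "M = restrict_space lborel {A..B}"
    interpret M: finite_measure M
      by (rule finite_measureI) (use AB in \<open>simp add: M_def emeasure_restrict_space space_restrict_space\<close>)
    interpret pair_sigma_finite M \<nu> ..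
    interpret P: finite_measure "M \<Otimes>\<^sub>M \<nu>"
      by (rule finite_measure_pair_measure) unfold_locales
    have int_M: "(\<integral>z. f z \<partial>M) = (\<integral>z. indicator {A..B} z * f z \<partial>lborel)" for f :: "real \<Rightarrow> real"
      unfolding M_def by (subst integral_restrict_space) auto
    have M_space: "z \<in> space M \<longleftrightarrow> A \<le> z \<and> z \<le> B" for z by (auto simp: M_def space_restrict_space)
    have id_M: "(\<lambda>z. z) \<in> borel_measurable M"
      unfolding M_def by (intro measurable_restrict_space1) auto
    have id_nu: "(\<lambda>s. s) \<in> borel_measurable \<nu>" by measurable
    define I where "I = (\<integral>z. w z \<partial>M)"
    have fst_M: "fst \<in> borel_measurable (M \<Otimes>\<^sub>M \<nu>)"
      by (rule measurable_compose[OF measurable_fst id_M])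
    have snd_nu: "snd \<in> borel_measurable (M \<Otimes>\<^sub>M \<nu>)"
      by (rule measurable_compose[OF measurable_snd id_nu])
    have Pint: "integrable (M \<Otimes>\<^sub>M \<nu>) (\<lambda>(z, s). w (z + x i s))" for i
    proof (rule P.integrable_const_bound[of _ \<delta>])
      have "(\<lambda>p. w (fst p + (\<rho> i - c * snd p))) \<in> borel_measurable (M \<Otimes>\<^sub>M \<nu>)"
        by (intro measurable_compose[OF _ \<open>w \<in> borel_measurable borel\<close>] borel_measurable_add
            borel_measurable_diff borel_measurable_times fst_M snd_nu borel_measurable_const)
      then show "(\<lambda>(z, s). w (z + x i s)) \<in> borel_measurable (M \<Otimes>\<^sub>M \<nu>)"
        by (simp add: split_beta' x_def)
    qed (use w(2,3) in \<open>auto simp: split_beta'\<close>)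
    have [measurable]: "w \<in> borel_measurable M"
      unfolding M_def by (rule measurable_restrict_space1) simp
    have w_M: "integrable M w"
      by (rule M.integrable_const_bound[of _ \<delta>]) (use w(2,3) in \<open>auto\<close>)
    have inner: "integrable M (\<lambda>z. \<integral>s. w (z + x i s) \<partial>\<nu>)" "integrable \<nu> (\<lambda>s. \<integral>z. w (z + x i s) \<partial>M)"
      for i using integrable_fst'[OF Pint[of i]] integrable_snd[OF Pint[of i]] by auto
    have lower: "I - x i s * w A - \<bar>x i s\<bar> * w (B - \<bar>x i s\<bar>) \<le> (\<integral>z. w (z + x i s) \<partial>M)" for i s
      unfolding I_def int_M by (rule interval_shift_bound[OF w(1,2) AB])
    have "(\<Sum>i\<in>UNIV. a i) * I - drift a \<rho> c * w A - \<epsilon> B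
        = (\<Sum>i\<in>UNIV. a i * (\<integral>s. I - x i s * w A - \<bar>x i s\<bar> * w (B - \<bar>x i s\<bar>) \<partial>\<nu>))"
    proof -
      have eq: "(\<integral>s. I - x i s * w A - \<bar>x i s\<bar> * w (B - \<bar>x i s\<bar>) \<partial>\<nu>)
        = I - (\<rho> i - c * (\<integral>s. s \<partial>\<nu>)) * w A - (\<integral>s. \<bar>x i s\<bar> * w (B - \<bar>x i s\<bar>) \<partial>\<nu>)" for i
        using x_int[of i] xw_int[of i B] integrable_nu by (simp add: x_def prob_space)
      show ?thesis
        unfolding eq \<epsilon>_def drift_def sum_distrib_right sum_subtractf[symmetric]
        by (intro sum.cong) (auto simp: algebra_simps)
    qed
    also have "\<dots> \<le> (\<Sum>i\<in>UNIV. a i * (\<integral>s. (\<integral>z. w (z + x i s) \<partial>M) \<partial>\<nu>))"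
      using inner(2) x_int xw_int lower a(1)
      by (intro sum_mono mult_left_mono integral_mono) auto
    also have "\<dots> = (\<Sum>i\<in>UNIV. a i * (\<integral>z. (\<integral>s. w (z + x i s) \<partial>\<nu>) \<partial>M))"
      using Fubini_integral[OF Pint] by simp
    also have "\<dots> = (\<integral>z. (\<Sum>i\<in>UNIV. a i * (\<integral>s. w (z + x i s) \<partial>\<nu>)) \<partial>M)"
      using inner(1) by (subst Bochner_Integration.integral_sum) auto
    also have "\<dots> \<le> I"
      unfolding I_def using inner(1) w_M le
      by (intro integral_mono) (auto simp: M_space x_def algebra_simps)
    finally have "((\<Sum>i\<in>UNIV. a i) - 1) * I \<le> \<epsilon> B + drift a \<rho> c * w A" by (simp add: algebra_simps)
    also have "\<dots> \<le> \<epsilon> B" using mult_nonpos_nonneg[OF drift w(2)] by simp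
    finally have 1: "((\<Sum>i\<in>UNIV. a i) - 1) * I \<le> \<epsilon> B" .
    \<comment> \<open>Since \<open>w\<close> decreases, it is at least \<open>w z\<close> on
      \<open>[A, z]\<close>; the integral \<open>I\<close> thus controls a single value.\<close>
    have "(z - A) * w z = (\<integral>y. indicator {A..z} y * w z \<partial>M)"
      unfolding int_M using z B by (simp add: indicator_inter_arith[symmetric] mult.assoc[symmetric])
    also have "\<dots> \<le> I"
      unfolding I_def
    proof (rule integral_mono[OF _ w_M])
      show "integrable M (\<lambda>y. indicator {A..z} y * w z)"
      proof (rule M.integrable_const_bound[of _ "w z"])
        show "(\<lambda>y. indicator {A..z} y * w z) \<in> borel_measurable M"
          unfolding M_def by (rule measurable_restrict_space1) auto
      qed (use w(2) in \<open>auto simp: indicator_def\<close>)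
      show "indicator {A..z} y * w z \<le> w y" for y
        using w(1,2) by (auto simp: indicator_def antimono_def)
    qed
    finally have "((\<Sum>i\<in>UNIV. a i) - 1) * ((z - A) * w z) \<le> ((\<Sum>i\<in>UNIV. a i) - 1) * I"
      using a(2) by (intro mult_left_mono) auto
    with 1 show ?thesis by simp
  qed
  have "(\<lambda>n. \<epsilon> (real n)) \<longlonglongrightarrow> (\<Sum>i\<in>UNIV. a i * (\<integral>s. 0 \<partial>\<nu>))"
    unfolding \<epsilon>_def
  proof (intro tendsto_sum tendsto_mult tendsto_const)
    fix i
    show "(\<lambda>n. \<integral>s. \<bar>x i s\<bar> * w (real n - \<bar>x i s\<bar>) \<partial>\<nu>) \<longlonglongrightarrow> (\<integral>s. 0 \<partial>\<nu>)"
    proof (rule integral_dominated_convergence[where w = "\<lambda>s. \<bar>x i s\<bar> * \<delta>"])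
      show "AE s in \<nu>. (\<lambda>n. \<bar>x i s\<bar> * w (real n - \<bar>x i s\<bar>)) \<longlonglongrightarrow> 0"
      proof (intro AE_I2 tendsto_mult_right_zero filterlim_compose[OF w(4)])
        show "filterlim (\<lambda>n. real n - \<bar>x i s\<bar>) at_top sequentially" for s
          using filterlim_tendsto_add_at_top[OF tendsto_const[of "- \<bar>x i s\<bar>"] filterlim_real_sequentially] by simp
      qed
      show "AE s in \<nu>. norm (\<bar>x i s\<bar> * w (real n - \<bar>x i s\<bar>)) \<le> \<bar>x i s\<bar> * \<delta>" for n
        using w(2,3) by (auto simp: abs_mult intro!: mult_left_mono)
      show "integrable \<nu> (\<lambda>s. \<bar>x i s\<bar> * \<delta>)" using x_int by auto
    qed (auto simp: x_def)
  qed
  then have lim: "(\<lambda>n. \<epsilon> (real n)) \<longlonglongrightarrow> 0" by simp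
  \<comment> \<open>The left side does not depend on \<open>B\<close>, and its factors other than
    \<open>w z\<close> are positive.\<close>
  have "((\<Sum>i\<in>UNIV. a i) - 1) * ((z - A) * w z) \<le> 0"
  proof (rule tendsto_lowerbound[OF lim])
    show "\<forall>\<^sub>F n in sequentially. ((\<Sum>i\<in>UNIV. a i) - 1) * ((z - A) * w z) \<le> \<epsilon> (real n)"
      using eventually_ge_at_top[of "nat \<lceil>z\<rceil>"] by eventually_elim (intro main, linarith)
  qed auto
  then show ?thesis using a(2) z w(2)[of z] by (auto simp: mult_le_0_iff)
qed

text \<open>Far out the cutoff is inactive, so \<open>superharmonic_vanishes\<close> gives
  \<open>w\<close> an edge \<open>e\<close> beyond which it is zero. Beyond the edge no displacement
  may lead back into the support, so all displacements of positive weight are non-negative; as their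
  mean is not positive, they vanish.\<close>

lemma front_rigid:
  fixes w :: "real \<Rightarrow> real"
  assumes w: "antimono w" "\<And>z. 0 \<le> w z" "(w \<longlongrightarrow> 0) at_top" "0 < w y"
    and a: "\<And>i. 0 \<le> a i" "1 < (\<Sum>i\<in>UNIV. a i)" and \<delta>: "0 < \<delta>"
    and drift: "drift a \<rho> c \<le> 0"
    and le: "\<And>z. (\<Sum>i\<in>UNIV. a i * (\<integral>s. min \<delta> (w (z + \<rho> i - c * s)) \<partial>\<nu>)) \<le> w z"
  shows "c = 0 \<and> drift a \<rho> c = 0 \<and> (\<exists>A. \<forall>z\<ge>A. w z = 0)"
proof -
  define u where "u z = min \<delta> (w z)" for z
  have [measurable]: "w \<in> borel_measurable borel"
    using borel_measurable_mono[of "\<lambda>z. - w z"] w(1) by (simp add: mono_def antimono_def)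
  have [measurable]: "u \<in> borel_measurable borel" unfolding u_def by measurable
  have anti: "w v \<le> w u" if "u \<le> v" for u v using w(1) that by (simp add: antimono_def)
  \<comment> \<open>From here on \<open>u = w\<close>, so the hypothesis on \<open>w\<close> becomes
    superharmonicity of \<open>u\<close>.\<close>
  obtain A where A: "\<And>z. A \<le> z \<Longrightarrow> w z < \<delta>"
    using order_tendstoD(2)[OF w(3) \<delta>] by (auto simp: eventually_at_top_linorder)
  have van: "w z = 0" if "A < z" for z
  proof -
    have "u z = 0"
    proof (rule superharmonic_vanishes[of u \<delta> a \<rho> c A])
      show "antimono u" using anti by (auto simp: u_def antimono_def min_def intro: order_trans)
      show "(u \<longlongrightarrow> 0) at_top"
        unfolding u_def using tendsto_min[OF tendsto_const[of \<delta>] w(3)] \<delta> by simp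
      show "(\<Sum>i\<in>UNIV. a i * (\<integral>s. u (z + \<rho> i - c * s) \<partial>\<nu>)) \<le> u z" if "A \<le> z" for z
        using le[of z] A[OF that] by (simp add: u_def)
    qed (use a drift that w(2) \<delta> in \<open>auto simp: u_def\<close>)
    then show ?thesis using A[of z] that by (auto simp: u_def min_def split: if_splits)
  qed
  let ?S = "{z. 0 < w z}"
  have bdd: "bdd_above ?S" using van by (intro bdd_aboveI[of _ A]) (metis leI less_irrefl mem_Collect_eq)
  have ne: "?S \<noteq> {}" using w(4) by auto
  define e where "e = Sup ?S"
  have below: "0 < w z" if "z < e" for z
    using less_cSupD[OF ne that[unfolded e_def]] anti[of z] by (metis less_imp_le less_le_trans mem_Collect_eq)
  have above: "w z = 0" if "e < z" for z
    using cSup_upper[OF _ bdd, of z] that w(2)[of z] unfolding e_def by force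
  have int_u: "integrable \<nu> (\<lambda>s. u (z + \<rho> i - c * s))" for z i
    by (rule integrable_const_bound[of _ \<delta>]) (use w(2) \<delta> in \<open>auto simp: u_def\<close>)
  \<comment> \<open>The inequality is evaluated at points just right of \<open>e\<close>, where its
    right side is 0; every term on the left must then vanish.\<close>
  have nonneg: "AE s in \<nu>. 0 \<le> \<rho> i - c * s" if "0 < a i" for i
  proof -
    have "AE s in \<nu>. u (e + 1 / Suc k + \<rho> i - c * s) = 0" for k
    proof -
      let ?z = "e + 1 / real (Suc k)"
      have nn: "0 \<le> a j * (\<integral>s. u (?z + \<rho> j - c * s) \<partial>\<nu>)" for j
        using a(1)[of j] w(2) \<delta> by (intro mult_nonneg_nonneg integral_nonneg) (auto simp: u_def)
      have "(\<Sum>j\<in>UNIV. a j * (\<integral>s. u (?z + \<rho> j - c * s) \<partial>\<nu>)) \<le> 0"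
        using le[of ?z] above[of ?z] by (simp add: u_def)
      then have "(\<Sum>j\<in>UNIV. a j * (\<integral>s. u (?z + \<rho> j - c * s) \<partial>\<nu>)) = 0"
        by (intro antisym sum_nonneg nn)
      then have "a i * (\<integral>s. u (?z + \<rho> i - c * s) \<partial>\<nu>) = 0"
        using nn by (subst (asm) sum_nonneg_eq_0_iff) auto
      then have "(\<integral>s. u (?z + \<rho> i - c * s) \<partial>\<nu>) = 0" using that by simp
      then show ?thesis
        using int_u w(2) \<delta> by (subst (asm) integral_nonneg_eq_0_iff_AE) (auto simp: u_def)
    qed
    then have "AE s in \<nu>. \<forall>k. u (e + 1 / Suc k + \<rho> i - c * s) = 0" by (simp add: AE_all_countable)
    then show ?thesis
    proof eventually_elim
      case (elim s)
      show ?case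
      proof (rule ccontr)
        assume "\<not> 0 \<le> \<rho> i - c * s"
        then obtain k where "1 / real (Suc k) < - (\<rho> i - c * s)"
          using nat_approx_posE[of "- (\<rho> i - c * s)"] by (auto simp: not_le)
        then have "0 < w (e + 1 / Suc k + \<rho> i - c * s)" by (intro below) auto
        then show False using elim[rule_format, of k] \<delta> by (auto simp: u_def min_def split: if_splits)
      qed
    qed
  qed
  have mean: "(\<integral>s. \<rho> i - c * s \<partial>\<nu>) = \<rho> i - c * (\<integral>s. s \<partial>\<nu>)" for i
    using integrable_nu by (simp add: prob_space)
  have terms: "0 \<le> a i * (\<rho> i - c * (\<integral>s. s \<partial>\<nu>))" for i
  proof (cases "0 < a i")
    case True
    then show ?thesis using integral_nonneg_AE[OF nonneg[OF True]] by (simp add: mean)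
  qed (use a(1)[of i] in auto)
  have d0: "drift a \<rho> c = 0"
    using drift terms unfolding drift_def by (intro antisym sum_nonneg) auto
  \<comment> \<open>Non-negative displacements of mean zero are almost surely zero; with
    \<open>c \<noteq> 0\<close> that would concentrate \<open>s\<close> at the single value \<rho> i
    / c.\<close>
  have "c = 0"
  proof (rule ccontr)
    assume "c \<noteq> 0"
    obtain i where i: "0 < a i" using a by (metis less_le_not_le sum_nonpos not_le zero_less_one order.trans less_imp_le)
    have "a i * (\<rho> i - c * (\<integral>s. s \<partial>\<nu>)) = 0"
      using d0 terms unfolding drift_def by (subst (asm) sum_nonneg_eq_0_iff) auto
    then have "\<rho> i - c * (\<integral>s. s \<partial>\<nu>) = 0" using i by auto
    then have "(\<integral>s. \<rho> i - c * s \<partial>\<nu>) = 0" unfolding mean .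
    then have "AE s in \<nu>. \<rho> i - c * s = 0"
      using nonneg[OF i] integrable_nu by (subst (asm) integral_nonneg_eq_0_iff_AE) auto
    then have "AE s in \<nu>. False"
      using no_atom[of "\<rho> i / c"] by eventually_elim (use \<open>c \<noteq> 0\<close> in \<open>auto simp: field_simps\<close>)
    then show False using AE_False by simp
  qed
  then show ?thesis using d0 van by (intro conjI exI[of _ "A + 1"]) auto
qed

section \<open>Limits at infinity are fixed points on the diagonal\<close>

lemma shape_limit_top:
  assumes "shape c l \<infinity> \<phi>" "l \<noteq> \<infinity>"
  obtains p where "(\<phi> \<longlongrightarrow> p) at_top" "0 \<le> p" "p \<le> 1" "G (vec p) = p"
proof -
  have p: "profile \<phi>" using assms by (simp add: shape_def)
  have inc: "incseq (\<lambda>n. \<phi> (real n))"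
    using profileD(1)[OF p] by (auto simp: incseq_def mono_def)
  obtain q where q: "(\<lambda>n. \<phi> (real n)) \<longlonglongrightarrow> q"
    using incseq_convergent[OF inc, of 1] profileD(3)[OF p] by blast
  have lim: "(\<phi> \<longlongrightarrow> q) at_top"
    by (rule tendsto_at_topI_sequentially_real[OF profileD(1)[OF p] q])
  have bds: "0 \<le> q" "q \<le> 1"
    using LIMSEQ_le_const[OF q, of 0] LIMSEQ_le_const2[OF q, of 1] profileD[OF p] by auto
  \<comment> \<open>Along \<open>z = n\<close> all arguments run off to infinity, so that the
    equation becomes \<open>q = G (vec q)\<close> in the limit.\<close>
  have "(\<lambda>n. transfer c \<phi> (real n)) \<longlonglongrightarrow> transfer c (\<lambda>_. q) 0"
  proof (rule transfer_tendsto[where \<phi>s = "\<lambda>_. \<phi>" and zs = real and cs = "\<lambda>_. c" and \<phi> = "\<lambda>_. q"])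
    have "filterlim (\<lambda>n. real n + r i - c * s) at_top sequentially" for i s
      using filterlim_tendsto_add_at_top[OF tendsto_const[of "r i - c * s"] filterlim_real_sequentially]
      by (simp add: algebra_simps)
    then show "AE s in \<nu>. \<forall>i. (\<lambda>n. \<phi> (real n + r i - c * s)) \<longlonglongrightarrow> q"
      by (intro AE_I2 allI filterlim_compose[OF lim])
  qed (use profileD[OF p] in auto)
  moreover have "transfer c (\<lambda>_. q) 0 = G (vec q)"
    by (simp add: transfer_def react_def vec_def prob_space)
  moreover have "\<forall>\<^sub>F n in sequentially. transfer c \<phi> (real n) = \<phi> (real n)"
  proof -
    obtain N :: nat where "l \<le> ereal (real N)"
    proof (cases l)
      case (real x)
      obtain N :: nat where "x \<le> real N" using real_arch_simple by blast
      then show ?thesis using real by (intro that[of N]) auto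
    qed (use assms(2) that in auto)
    then have "l \<le> ereal (real n)" if "N \<le> n" for n
      using that by (meson ereal_less_eq(3) of_nat_le_iff order_trans)
    then show ?thesis
      unfolding eventually_sequentially using assms(1) by (intro exI[of _ N]) (auto simp: shape_def)
  qed
  ultimately have "(\<lambda>n. \<phi> (real n)) \<longlonglongrightarrow> G (vec q)"
    by (simp only:) (rule Lim_transform_eventually)
  then have "G (vec q) = q" using q LIMSEQ_unique by blast
  then show ?thesis using that lim bds by blast
qed

lemma shape_limit_bot:
  assumes "shape c (-\<infinity>) m \<phi>" "m \<noteq> -\<infinity>"
  obtains p where "(\<phi> \<longlongrightarrow> p) at_bot" "0 \<le> p" "p \<le> 1" "G (vec p) = p"
proof -
  have p: "profile \<phi>" using assms by (simp add: shape_def)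
  have inc: "decseq (\<lambda>n. \<phi> (- real n))"
    using profileD(1)[OF p] by (auto simp: decseq_def mono_def)
  obtain q where q: "(\<lambda>n. \<phi> (- real n)) \<longlonglongrightarrow> q"
    using decseq_convergent[OF inc, of 0] profileD(2)[OF p] by blast
  have "((\<lambda>z. - \<phi> (- z)) \<longlongrightarrow> - q) at_top"
  proof (rule tendsto_at_topI_sequentially_real)
    show "mono (\<lambda>z. - \<phi> (- z))" using profileD(1)[OF p] by (auto simp: mono_def)
    show "(\<lambda>n. - \<phi> (- real n)) \<longlonglongrightarrow> - q" using q by (rule tendsto_minus)
  qed
  then have lim: "(\<phi> \<longlongrightarrow> q) at_bot"
    unfolding filterlim_at_bot_mirror by (rule tendsto_minus_cancel)
  have bds: "0 \<le> q" "q \<le> 1"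
    using LIMSEQ_le_const[OF q, of 0] LIMSEQ_le_const2[OF q, of 1] profileD[OF p] by auto
  have "(\<lambda>n. transfer c \<phi> (- real n)) \<longlonglongrightarrow> transfer c (\<lambda>_. q) 0"
  proof (rule transfer_tendsto[where \<phi>s = "\<lambda>_. \<phi>" and zs = "\<lambda>n. - real n" and cs = "\<lambda>_. c" and \<phi> = "\<lambda>_. q"])
    have "filterlim (\<lambda>n. - real n + r i - c * s) at_bot sequentially" for i s
      unfolding filterlim_uminus_at_bot
      using filterlim_tendsto_add_at_top[OF tendsto_const[of "- r i + c * s"] filterlim_real_sequentially]
      by (simp add: algebra_simps)
    then show "AE s in \<nu>. \<forall>i. (\<lambda>n. \<phi> (- real n + r i - c * s)) \<longlonglongrightarrow> q"
      by (intro AE_I2 allI filterlim_compose[OF lim])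
  qed (use profileD[OF p] in auto)
  moreover have "transfer c (\<lambda>_. q) 0 = G (vec q)"
    by (simp add: transfer_def react_def vec_def prob_space)
  moreover have "\<forall>\<^sub>F n in sequentially. transfer c \<phi> (- real n) = \<phi> (- real n)"
  proof -
    obtain N :: nat where "ereal (- real N) < m"
    proof (cases m)
      case (real x)
      obtain N :: nat where "- x < real N" using reals_Archimedean2 by blast
      then show ?thesis using real by (intro that[of N]) auto
    qed (use assms(2) that in auto)
    then have "ereal (- real n) < m" if "N \<le> n" for n
      using that by (meson ereal_less_eq(3) le_less_trans neg_le_iff_le of_nat_le_iff)
    then show ?thesis
      unfolding eventually_sequentially using assms(1) by (intro exI[of _ N]) (auto simp: shape_def)
  qed
  ultimately have "(\<lambda>n. \<phi> (- real n)) \<longlonglongrightarrow> G (vec q)"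
    by (simp only:) (rule Lim_transform_eventually)
  then have "G (vec q) = q" using q LIMSEQ_unique by blast
  then show ?thesis using that lim bds by blast
qed

lemma shape_limits:
  assumes \<phi>: "shape c l m \<phi>" and lm: "l = -\<infinity> \<or> m = \<infinity>" "l \<noteq> \<infinity>" "m \<noteq> -\<infinity>"
  obtains q p where "(\<phi> \<longlongrightarrow> q) at_bot" "(\<phi> \<longlongrightarrow> p) at_top" "0 \<le> q" "q \<le> 1" "0 \<le> p" "p \<le> 1"
    "G (vec q) = q" "G (vec p) = p" "l \<noteq> -\<infinity> \<Longrightarrow> q = 0" "m \<noteq> \<infinity> \<Longrightarrow> p = 1"
proof -
  have "\<exists>q. (\<phi> \<longlongrightarrow> q) at_bot \<and> 0 \<le> q \<and> q \<le> 1 \<and> G (vec q) = q \<and> (l \<noteq> -\<infinity> \<longrightarrow> q = 0)"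
  proof (cases l)
    case (real x)
    have "\<forall>\<^sub>F z in at_bot. \<phi> z = 0"
      using \<phi> real unfolding eventually_at_bot_linorder by (intro exI[of _ "x - 1"]) (auto simp: shape_def)
    then show ?thesis using G_0 tendsto_eventually by (intro exI[of _ 0]) auto
  qed (use lm \<phi> in \<open>auto elim: shape_limit_bot\<close>)
  moreover have "\<exists>p. (\<phi> \<longlongrightarrow> p) at_top \<and> 0 \<le> p \<and> p \<le> 1 \<and> G (vec p) = p \<and> (m \<noteq> \<infinity> \<longrightarrow> p = 1)"
  proof (cases m)
    case (real x)
    have "\<forall>\<^sub>F z in at_top. \<phi> z = 1"
      using \<phi> real unfolding eventually_at_top_linorder by (intro exI[of _ "x"]) (auto simp: shape_def)
    then show ?thesis using G_1 tendsto_eventually by (intro exI[of _ 1]) auto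
  qed (use lm \<phi> in \<open>auto elim: shape_limit_top\<close>)
  ultimately show ?thesis using that by blast
qed

text \<open>A derivative-free form of the statement that the linearisation of \<open>G\<close> at
  \<open>b\<close> has non-negative coefficients with sum above 1. Ordered pairs suffice because a
  front stays on one side of \<open>b\<close>.\<close>

definition expanding_at :: "real \<Rightarrow> bool" where
  "expanding_at b \<longleftrightarrow> (\<exists>\<delta> a. 0 < \<delta> \<and> (\<forall>i. 0 \<le> a i) \<and> 1 < (\<Sum>i\<in>UNIV. a i) \<and>
     (\<forall>X Y. (\<forall>i. b - \<delta> \<le> X $ i \<and> X $ i \<le> Y $ i \<and> Y $ i \<le> b + \<delta>) \<longrightarrow>
       (\<Sum>i\<in>UNIV. a i * (Y $ i - X $ i)) \<le> G Y - G X))"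

text \<open>Both \<open>b - \<phi>\<close> and the reflection of \<open>\<psi> - b\<close> satisfy
  the inequality of \<open>front_rigid\<close>, with drifts of opposite sign. So one of them is
  rigid, which gives \<open>c = 0\<close> and zero drift; then the other is rigid as well, and both
  fronts reach \<open>b\<close> at finite points.\<close>

lemma front_collision:
  assumes b: "0 < b" "b < 1" "G (vec b) = b" and exp: "expanding_at b"
    and \<phi>: "shape c l \<infinity> \<phi>" "(\<phi> \<longlongrightarrow> 0) at_bot" "(\<phi> \<longlongrightarrow> b) at_top"
    and \<psi>: "shape c (-\<infinity>) m \<psi>" "(\<psi> \<longlongrightarrow> b) at_bot" "(\<psi> \<longlongrightarrow> 1) at_top"
  shows "c = 0 \<and> (\<exists>d. connects c l (m + ereal d))"
proof -
  obtain \<delta> a where \<delta>: "0 < \<delta>" and a: "\<And>i. 0 \<le> a i" "1 < (\<Sum>i\<in>UNIV. a i)"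
    and lin: "\<And>X Y. (\<And>i. b - \<delta> \<le> X $ i \<and> X $ i \<le> Y $ i \<and> Y $ i \<le> b + \<delta>) \<Longrightarrow>
       (\<Sum>i\<in>UNIV. a i * (Y $ i - X $ i)) \<le> G Y - G X"
    using exp unfolding expanding_at_def by blast
  have p\<phi>: "profile \<phi>" and p\<psi>: "profile \<psi>" using \<phi> \<psi> by (auto simp: shape_def)
  note P = profileD[OF p\<phi>] and Q = profileD[OF p\<psi>]
  have \<phi>_le: "\<phi> z \<le> b" for z
    by (rule tendsto_lowerbound[OF \<phi>(3)]) (auto simp: eventually_at_top_linorder intro!: exI[of _ z] monoD[OF P(1)])
  have \<psi>_ge: "b \<le> \<psi> z" for z
    by (rule tendsto_upperbound[OF \<psi>(2)]) (auto simp: eventually_at_bot_linorder intro!: exI[of _ z] monoD[OF Q(1)])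
  have \<phi>_sub: "\<phi> z \<le> transfer c \<phi> z" for z
    using \<phi>(1) transfer_bounds(1)[of \<phi> c z] P by (cases "ereal z < l") (auto simp: shape_def not_less)
  have \<psi>_sup: "transfer c \<psi> z \<le> \<psi> z" for z
    using \<psi>(1) transfer_bounds(2)[of \<psi> c z] Q by (cases "m \<le> ereal z") (auto simp: shape_def not_le)
  have [measurable]: "\<phi> \<in> borel_measurable borel" "\<psi> \<in> borel_measurable borel" using P Q by auto
  \<comment> \<open>Raising the arguments to at least \<open>b - \<delta>\<close> brings them into
    the range of \<open>lin\<close>; monotonicity of \<open>G\<close> removes this cutoff again. The
    same is done from above for \<psi>.\<close>
  have lin\<phi>: "(\<Sum>i\<in>UNIV. a i * min \<delta> (b - \<phi> (z + r i))) \<le> b - react \<phi> z" for z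
  proof -
    have "(\<Sum>i\<in>UNIV. a i * min \<delta> (b - \<phi> (z + r i))) \<le> G (vec b) - G (\<chi> i. max (\<phi> (z + r i)) (b - \<delta>))"
    proof -
      have "b - max (\<phi> (z + r i)) (b - \<delta>) = min \<delta> (b - \<phi> (z + r i))" for i by (simp add: min_def max_def)
      then show ?thesis
        using lin[of "\<chi> i. max (\<phi> (z + r i)) (b - \<delta>)" "vec b"] \<phi>_le \<delta> by simp
    qed
    also have "\<dots> \<le> b - react \<phi> z"
      unfolding react_def using G_mono[of "\<lambda>i. \<phi> (z + r i)" "\<lambda>i. max (\<phi> (z + r i)) (b - \<delta>)"] b by simp
    finally show ?thesis .
  qed
  have lin\<psi>: "(\<Sum>i\<in>UNIV. a i * min \<delta> (\<psi> (z + r i) - b)) \<le> react \<psi> z - b" for z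
  proof -
    have "(\<Sum>i\<in>UNIV. a i * min \<delta> (\<psi> (z + r i) - b)) \<le> G (\<chi> i. min (\<psi> (z + r i)) (b + \<delta>)) - G (vec b)"
    proof -
      have "min (\<psi> (z + r i)) (b + \<delta>) - b = min \<delta> (\<psi> (z + r i) - b)" for i by (simp add: min_def)
      then show ?thesis
        using lin[of "vec b" "\<chi> i. min (\<psi> (z + r i)) (b + \<delta>)"] \<psi>_ge \<delta> by simp
    qed
    also have "\<dots> \<le> react \<psi> z - b"
      unfolding react_def using G_mono[of "\<lambda>i. min (\<psi> (z + r i)) (b + \<delta>)" "\<lambda>i. \<psi> (z + r i)"] b by simp
    finally show ?thesis .
  qed
  have i\<phi>: "integrable \<nu> (\<lambda>s. min \<delta> (b - \<phi> (z - c * s + r i)))" for z i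
    by (rule integrable_const_bound[of _ \<delta>]) (use \<phi>_le \<delta> in auto)
  have i\<psi>: "integrable \<nu> (\<lambda>s. min \<delta> (\<psi> (z - c * s + r i) - b))" for z i
    by (rule integrable_const_bound[of _ \<delta>]) (use \<psi>_ge \<delta> in auto)
  have front\<phi>: "c = 0 \<and> drift a r c = 0 \<and> (\<exists>A. \<forall>z\<ge>A. b - \<phi> z = 0)" if "drift a r c \<le> 0"
  proof -
    obtain z1 where z1: "\<phi> z1 < b"
      using order_tendstoD(2)[OF \<phi>(2) b(1)] by (auto simp: eventually_at_bot_linorder)
    show ?thesis
    proof (rule front_rigid[where y = z1 and a = a and \<delta> = \<delta>])
      show "antimono (\<lambda>z. b - \<phi> z)" using P(1) by (auto simp: antimono_def mono_def)
      show "((\<lambda>z. b - \<phi> z) \<longlongrightarrow> 0) at_top" using tendsto_diff[OF tendsto_const[of b] \<phi>(3)] by simp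
      fix z
      have "(\<Sum>i\<in>UNIV. a i * (\<integral>s. min \<delta> (b - \<phi> (z + r i - c * s)) \<partial>\<nu>))
          = (\<integral>s. (\<Sum>i\<in>UNIV. a i * min \<delta> (b - \<phi> (z - c * s + r i))) \<partial>\<nu>)"
        using i\<phi>[of z] by (subst Bochner_Integration.integral_sum) (auto simp: algebra_simps)
      also have "\<dots> \<le> (\<integral>s. b - react \<phi> (z - c * s) \<partial>\<nu>)"
        using i\<phi>[of z] lin\<phi> P integrable_react by (intro integral_mono) auto
      also have "\<dots> = b - transfer c \<phi> z"
        using P integrable_react by (simp add: transfer_def prob_space)
      also have "\<dots> \<le> b - \<phi> z" using \<phi>_sub by simp
      finally show "(\<Sum>i\<in>UNIV. a i * (\<integral>s. min \<delta> (b - \<phi> (z + r i - c * s)) \<partial>\<nu>)) \<le> b - \<phi> z" .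
    qed (use a \<delta> that z1 \<phi>_le in auto)
  qed
  have front\<psi>: "c = 0 \<and> drift a r c = 0 \<and> (\<exists>A. \<forall>z\<ge>A. \<psi> (- z) - b = 0)" if "0 \<le> drift a r c"
  proof -
    obtain z1 where z1: "b < \<psi> z1"
      using order_tendstoD(1)[OF \<psi>(3) b(2)] by (auto simp: eventually_at_top_linorder)
    have "- c = 0 \<and> drift a (\<lambda>i. - r i) (- c) = 0 \<and> (\<exists>A. \<forall>z\<ge>A. \<psi> (- z) - b = 0)"
    proof (rule front_rigid[where y = "- z1" and a = a and \<delta> = \<delta>])
      show "antimono (\<lambda>z. \<psi> (- z) - b)" using Q(1) by (auto simp: antimono_def mono_def)
      show "((\<lambda>z. \<psi> (- z) - b) \<longlongrightarrow> 0) at_top"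
        using tendsto_diff[OF filterlim_compose[OF \<psi>(2) filterlim_uminus_at_bot_at_top] tendsto_const[of b]] by simp
      show "drift a (\<lambda>i. - r i) (- c) \<le> 0" using that by (simp add: drift_uminus)
      fix z
      have "(\<Sum>i\<in>UNIV. a i * (\<integral>s. min \<delta> (\<psi> (- (z + - r i - - c * s)) - b) \<partial>\<nu>))
          = (\<integral>s. (\<Sum>i\<in>UNIV. a i * min \<delta> (\<psi> (- z - c * s + r i) - b)) \<partial>\<nu>)"
        using i\<psi>[of "- z"] by (subst Bochner_Integration.integral_sum) (auto simp: algebra_simps)
      also have "\<dots> \<le> (\<integral>s. react \<psi> (- z - c * s) - b \<partial>\<nu>)"
        using i\<psi>[of "- z"] lin\<psi> Q integrable_react by (intro integral_mono) auto
      also have "\<dots> = transfer c \<psi> (- z) - b"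
        using Q integrable_react by (simp add: transfer_def prob_space)
      also have "\<dots> \<le> \<psi> (- z) - b" using \<psi>_sup by simp
      finally show "(\<Sum>i\<in>UNIV. a i * (\<integral>s. min \<delta> (\<psi> (- (z + - r i - - c * s)) - b) \<partial>\<nu>)) \<le> \<psi> (- z) - b" .
    qed (use a \<delta> z1 \<psi>_ge in auto)
    then show ?thesis unfolding drift_uminus neg_equal_0_iff_equal .
  qed
  have "c = 0 \<and> drift a r c = 0"
    by (cases "drift a r c \<le> 0") (use front\<phi> front\<psi> in \<open>blast, force\<close>)
  then have c0: "c = 0" and d0: "drift a r c = 0" by blast+
  obtain A where A: "\<And>z. A \<le> z \<Longrightarrow> \<phi> z = b" using front\<phi>[OF eq_refl[OF d0]] by auto
  obtain A1 where "\<forall>z\<ge>A1. \<psi> (- z) - b = 0" using front\<psi>[OF eq_refl[OF d0[symmetric]]] by blast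
  then have A1: "\<psi> z = b" if "z \<le> - A1" for z using that by (auto dest: spec[of _ "- z"])
  define R where "R = (\<Sum>i\<in>UNIV. \<bar>r i\<bar>)"
  have R: "\<bar>r i\<bar> \<le> R" for i unfolding R_def by (rule member_le_sum) auto
  then have R0: "0 \<le> R" by (rule order_trans[OF abs_ge_zero])
  \<comment> \<open>With this shift both fronts equal \<open>b\<close> on
    \<open>[A, A + 2 * R]\<close>. A window of radius \<open>R\<close> around any point therefore
    sees only one of them, and \<open>A + R\<close> separates the two cases.\<close>
  define d where "d = A + 2 * R + A1"
  text \<open>
    At speed zero the operator has finite range, so the two fronts can be glued along their common
    plateau at height \<open>b\<close>.
  \<close>
  define g where "g z = \<phi> z + \<psi> (z + - d) - b" for z
  have g1: "g z = \<phi> z" if "z \<le> A + 2 * R" for z using that A1[of "z + - d"] by (simp add: g_def d_def)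
  have g2: "g z = \<psi> (z + - d)" if "A \<le> z" for z using A that by (simp add: g_def)
  have pg: "profile g"
  proof -
    note Qd = profileD[OF profile_translate[OF p\<psi>, of "- d"]]
    have "continuous (at_right z) g" for z
      unfolding g_def[abs_def] using P(4)[of z] Qd(4)[of z] by (intro continuous_intros)
    moreover have "mono g"
      using P(1) Qd(1) by (auto simp: g_def mono_def intro: add_mono)
    moreover have "0 \<le> g z \<and> g z \<le> 1" for z
      using g1[of z] g2[of z] P Q R0 by (cases "z \<le> A") auto
    ultimately show ?thesis by (auto simp: profile_def)
  qed
  have "shape c l (m + ereal d) g"
    unfolding shape_def
  proof (intro conjI allI impI pg)
    fix z assume z: "ereal z < l"
    then have "\<phi> z = 0" using \<phi> by (auto simp: shape_def)
    then have "z < A" using A[of z] b by force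
    then show "g z = 0" using g1[of z] R0 \<open>\<phi> z = 0\<close> by simp
  next
    fix z assume z: "m + ereal d \<le> ereal z"
    then have "m \<le> ereal (z + - d)" by (cases m) auto
    then have "\<psi> (z + - d) = 1" using \<psi> by (auto simp: shape_def)
    then have "- A1 < z - d" using A1[of "z + - d"] b by force
    then show "g z = 1" using g2[of z] R0 \<open>\<psi> (z + - d) = 1\<close> by (simp add: d_def)
  next
    fix z assume z: "l \<le> ereal z \<and> ereal z < m + ereal d"
    then have zm: "ereal (z + - d) < m" by (cases m) auto
    show "g z = transfer c g z"
    proof (cases "z \<le> A + R")
      case True
      have "g (z + r i) = \<phi> (z + r i)" for i using True R[of i] by (intro g1) auto
      moreover have "\<phi> z = transfer c \<phi> z" using \<phi> z by (auto simp: shape_def)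
      ultimately show ?thesis using g1[of z] True R0 by (simp add: c0 transfer_0 react_def)
    next
      case False
      have "g (z + r i) = \<psi> (z + - d + r i)" for i
        using False R[of i] g2[of "z + r i"] by (simp add: algebra_simps)
      moreover have "\<psi> (z + - d) = transfer c \<psi> (z + - d)" using \<psi> zm by (auto simp: shape_def)
      ultimately show ?thesis using g2[of z] False R0 by (simp add: c0 transfer_0 react_def)
    qed
  qed
  moreover have "(g \<longlongrightarrow> 0) at_bot"
  proof (rule Lim_transform_eventually[OF \<phi>(2)])
    show "\<forall>\<^sub>F z in at_bot. \<phi> z = g z"
      using eventually_le_at_bot[of A] by eventually_elim (use R0 g1 in auto)
  qed
  moreover have "(g \<longlongrightarrow> 1) at_top"
  proof (rule Lim_transform_eventually)
    show "((\<lambda>z. \<psi> (- d + z)) \<longlongrightarrow> 1) at_top"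
      by (rule filterlim_compose[OF \<psi>(3)]) (rule filterlim_tendsto_add_at_top[OF tendsto_const filterlim_ident])
    show "\<forall>\<^sub>F z in at_top. \<psi> (- d + z) = g z"
      using eventually_ge_at_top[of A] by eventually_elim (simp add: g2 add.commute)
  qed
  ultimately show ?thesis using c0 by (auto simp: connects_def)
qed

subsection \<open>Compactness and existence of a speed\<close>

text \<open>By \<open>long\<close> at most one end can stay at finite distance from the fixed level.
  \<open>ends\<close> matters at speed 0: gluing combines the left end of the lower front with the
  right end of the upper one, and both could be finite unless one side is infinite
  throughout.\<close>

lemma connects_compact:
  assumes b: "0 \<le> b" "b \<le> 1" and zeros: "\<And>p. 0 \<le> p \<Longrightarrow> p \<le> 1 \<Longrightarrow> G (vec p) = p \<Longrightarrow> p \<in> {0, b, 1}"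
    and exp: "0 < b \<Longrightarrow> b < 1 \<Longrightarrow> G (vec b) = b \<and> expanding_at b"
    and conn: "\<And>n. connects (cs n) (ls n) (ms n)" and cs: "cs \<longlonglongrightarrow> c"
    and long: "\<And>n. ls n + ereal (real n) \<le> ms n"
    and ends: "c \<noteq> 0 \<or> (\<forall>n. ls n = -\<infinity>) \<or> (\<forall>n. ms n = \<infinity>)"
  shows "\<exists>l m. connects c l m \<and> (l = -\<infinity> \<or> m = \<infinity>) \<and> l \<noteq> \<infinity> \<and> m \<noteq> -\<infinity> \<and>
    ((\<forall>n. ls n = -\<infinity>) \<longrightarrow> l = -\<infinity>) \<and> ((\<forall>n. ms n = \<infinity>) \<longrightarrow> m = \<infinity>)"
proof -
  define good where "good l m \<longleftrightarrow> (l = -\<infinity> \<or> m = \<infinity>) \<and> l \<noteq> \<infinity> \<and> m \<noteq> -\<infinity> \<and>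
    ((\<forall>n. ls n = -\<infinity>) \<longrightarrow> l = -\<infinity>) \<and> ((\<forall>n. ms n = \<infinity>) \<longrightarrow> m = \<infinity>)" for l m :: ereal
  obtain \<phi>s where \<phi>s: "\<And>n. shape (cs n) (ls n) (ms n) (\<phi>s n)"
    "\<And>n. (\<phi>s n \<longlongrightarrow> 0) at_bot" "\<And>n. (\<phi>s n \<longlongrightarrow> 1) at_top"
    using conn unfolding connects_def by metis
  define front where "front \<theta> \<phi> l m q p \<longleftrightarrow> good l m \<and> shape c l m \<phi> \<and> (\<phi> \<longlongrightarrow> q) at_bot \<and> (\<phi> \<longlongrightarrow> p) at_top \<and>
      q \<in> {0, b, 1} \<and> p \<in> {0, b, 1} \<and> q \<le> \<theta> \<and> \<theta> \<le> p \<and> (l \<noteq> -\<infinity> \<longrightarrow> q = 0) \<and> (m \<noteq> \<infinity> \<longrightarrow> p = 1)" for \<theta> \<phi> l m q p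
  have lim: "\<exists>\<phi> l m q p. front \<theta> \<phi> l m q p"
    if \<theta>: "0 < \<theta>" "\<theta> < 1" for \<theta>
  proof -
    have "\<exists>a. (\<forall>z<0. \<phi>s n (z + a) \<le> \<theta>) \<and> (\<forall>z\<ge>0. \<theta> \<le> \<phi>s n (z + a))" for n
      using profile_crossing[OF _ \<phi>s(2,3)[of n] \<theta>] \<phi>s(1)[of n] unfolding shape_def by metis
    then obtain a where a: "\<And>n z. z < 0 \<Longrightarrow> \<phi>s n (z + a n) \<le> \<theta>" "\<And>n z. 0 \<le> z \<Longrightarrow> \<theta> \<le> \<phi>s n (z + a n)"
      by metis
    define ls' where "ls' n = ls n - ereal (a n)" for n
    define ms' where "ms' n = ms n - ereal (a n)" for n
    obtain \<phi> l m s where s: "strict_mono (s :: nat \<Rightarrow> nat)" and l: "(ls' \<circ> s) \<longlonglongrightarrow> l" and m: "(ms' \<circ> s) \<longlonglongrightarrow> m"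
      and \<phi>: "shape c l m \<phi>" and lev: "\<forall>z<0. \<phi> z \<le> \<theta>" "\<forall>z\<ge>0. \<theta> \<le> \<phi> z"
      using shape_compact[of cs ls' ms' "\<lambda>n z. \<phi>s n (z + a n)" c \<theta>, OF _ cs a \<theta>]
        shape_translate[OF \<phi>s(1)] unfolding ls'_def ms'_def by blast
    have l_fin: "l \<noteq> \<infinity>"
    proof
      assume "l = \<infinity>"
      then have "\<phi> 0 = 0" using \<phi> by (auto simp: shape_def)
      then show False using lev(2) \<theta> by force
    qed
    have m_fin: "m \<noteq> -\<infinity>"
    proof
      assume "m = -\<infinity>"
      then have "\<phi> (-1) = 1" using \<phi> by (auto simp: shape_def)
      then show False using lev(1)[rule_format, of "-1"] \<theta> by force
    qed
    have inf: "l = -\<infinity> \<or> m = \<infinity>"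
    proof (rule ccontr)
      assume "\<not> ?thesis"
      then obtain x y where xy: "l = ereal x" "m = ereal y" using l_fin m_fin by (cases l; cases m) auto
      have "\<forall>\<^sub>F n in sequentially. ereal (x - 1) < ls' (s n)"
        using order_tendstoD(1)[OF l, of "ereal (x - 1)"] xy by simp
      moreover have "\<forall>\<^sub>F n in sequentially. ms' (s n) < ereal (y + 1)"
        using order_tendstoD(2)[OF m, of "ereal (y + 1)"] xy by simp
      moreover have "\<forall>\<^sub>F n in sequentially. nat \<lceil>y - x + 2\<rceil> \<le> n" by (rule eventually_ge_at_top)
      ultimately have "\<forall>\<^sub>F n in sequentially. False"
      proof eventually_elim
        case (elim n)
        have "n \<le> s n" using s by (rule seq_suble)
        then have "y - x + 2 \<le> real (s n)" using elim(3) by linarith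
        then show False
          using elim(1,2) long[of "s n"] unfolding ls'_def ms'_def
          by (cases "ls (s n)"; cases "ms (s n)") auto
      qed
      then show False by simp
    qed
    have l_inf: "l = -\<infinity>" if "\<forall>n. ls n = -\<infinity>"
    proof -
      have "(ls' \<circ> s) = (\<lambda>_. -\<infinity>)" using that by (auto simp: ls'_def o_def)
      then show ?thesis using l by (simp add: LIMSEQ_const_iff)
    qed
    have m_inf: "m = \<infinity>" if "\<forall>n. ms n = \<infinity>"
    proof -
      have "(ms' \<circ> s) = (\<lambda>_. \<infinity>)" using that by (auto simp: ms'_def o_def)
      then show ?thesis using m by (simp add: LIMSEQ_const_iff)
    qed
    obtain q p where qp: "(\<phi> \<longlongrightarrow> q) at_bot" "(\<phi> \<longlongrightarrow> p) at_top" "0 \<le> q" "q \<le> 1" "0 \<le> p" "p \<le> 1"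
      "G (vec q) = q" "G (vec p) = p" "l \<noteq> -\<infinity> \<Longrightarrow> q = 0" "m \<noteq> \<infinity> \<Longrightarrow> p = 1"
      using shape_limits[OF \<phi> inf l_fin m_fin] by blast
    have "q \<le> \<theta>"
      by (rule tendsto_upperbound[OF qp(1)]) (use lev(1) in \<open>auto simp: eventually_at_bot_linorder intro!: exI[of _ "-1"]\<close>)
    moreover have "\<theta> \<le> p"
      by (rule tendsto_lowerbound[OF qp(2)]) (use lev(2) in \<open>auto simp: eventually_at_top_linorder intro!: exI[of _ "0"]\<close>)
    ultimately show ?thesis
      using \<phi> qp zeros[of q] zeros[of p] inf l_fin m_fin l_inf m_inf unfolding good_def front_def by blast
  qed
  have "\<exists>l m. connects c l m \<and> good l m"
  proof (cases "0 < b \<and> b < 1")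
    case False
    then have "b = 0 \<or> b = 1" using b by linarith
    obtain \<phi> l m q p where "front (1 / 2) \<phi> l m q p" using lim[of "1 / 2"] by force
    note \<phi> = this[unfolded front_def]
    have "q = 0" "p = 1" using \<phi> \<open>b = 0 \<or> b = 1\<close> by auto
    then have "connects c l m" using \<phi> unfolding connects_def by (intro exI[of _ \<phi>]) simp
    then show ?thesis using \<phi> by blast
  next
    case True
    \<comment> \<open>Level \<open>b / 2\<close> excludes the left limits \<open>b\<close> and 1,
      level \<open>(1 + b) / 2\<close> the right limits 0 and \<open>b\<close>. Each front thus has
      only one uncertain limit.\<close>
    obtain \<phi> l m q p where "front (b / 2) \<phi> l m q p" using lim[of "b / 2"] True by force
    note \<phi> = this[unfolded front_def]
    then have q: "q = 0" using True by auto
    obtain \<psi> l' m' q' p' where "front ((1 + b) / 2) \<psi> l' m' q' p'" using lim[of "(1 + b) / 2"] True by force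
    note \<psi> = this[unfolded front_def]
    then have p': "p' = 1" using True by auto
    have "p = b \<or> p = 1" using \<phi> True by auto
    moreover have "q' = b \<or> q' = 0" using \<psi> True by auto
    ultimately consider "p = 1" | "q' = 0" | "p = b" "q' = b" by blast
    then show ?thesis
    proof cases
      case 1
      then have "connects c l m" using \<phi> q unfolding connects_def by (intro exI[of _ \<phi>]) simp
      then show ?thesis using \<phi> by blast
    next
      case 2
      then have "connects c l' m'" using \<psi> p' unfolding connects_def by (intro exI[of _ \<psi>]) simp
      then show ?thesis using \<psi> by blast
    next
      case 3
      \<comment> \<open>A finite end would prescribe the limit 1 on the right, or 0 on the left,
        instead of \<open>b\<close>.\<close>
      have m: "m = \<infinity>" using \<phi> 3 True by force
      have l': "l' = -\<infinity>" using \<psi> 3 True by force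
      have "c = 0 \<and> (\<exists>d. connects c l (m' + ereal d))"
      proof (rule front_collision[of b])
        show "0 < b" "b < 1" "G (vec b) = b" "expanding_at b" using True exp by auto
        show "shape c l \<infinity> \<phi>" "(\<phi> \<longlongrightarrow> 0) at_bot" "(\<phi> \<longlongrightarrow> b) at_top" using \<phi> q 3 m by simp_all
        show "shape c (-\<infinity>) m' \<psi>" "(\<psi> \<longlongrightarrow> b) at_bot" "(\<psi> \<longlongrightarrow> 1) at_top" using \<psi> p' 3 l' by simp_all
      qed
      then obtain d where "c = 0" "connects c l (m' + ereal d)" by blast
      moreover have "good l (m' + ereal d)"
      proof -
        have "good l m" "good l' m'" using \<phi> \<psi> by blast+
        then show ?thesis using ends \<open>c = 0\<close> unfolding good_def by (cases m') auto
      qed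
      ultimately show ?thesis by blast
    qed
  qed
  then show ?thesis unfolding good_def .
qed

theorem ex_wave:
  assumes b: "0 \<le> b" "b \<le> 1" and zeros: "\<And>p. 0 \<le> p \<Longrightarrow> p \<le> 1 \<Longrightarrow> G (vec p) = p \<Longrightarrow> p \<in> {0, b, 1}"
    and exp: "0 < b \<Longrightarrow> b < 1 \<Longrightarrow> G (vec b) = b \<and> expanding_at b"
  shows "\<exists>c. connects c (-\<infinity>) \<infinity>"
proof (rule ccontr)
  assume no: "\<not> ?thesis"
  define S where "S = {c. connects c 0 \<infinity>}"
  define P where "P = {c. connects c (-\<infinity>) 0}"
  \<comment> \<open>Without a wave exactly one end is finite, and translating it to 0 shows which
    kind of speed \<open>c\<close> is.\<close>
  have norm: "c \<in> S \<and> m = \<infinity> \<or> c \<in> P \<and> l = -\<infinity>" if lm: "connects c l m" "l = -\<infinity> \<or> m = \<infinity>" "l \<noteq> \<infinity>" "m \<noteq> -\<infinity>" for c l m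
  proof (cases l)
    case (real x)
    then show ?thesis using connects_translate[OF lm(1), of x] lm by (auto simp: S_def zero_ereal_def)
  next
    case MInf
    then have "m \<noteq> \<infinity>" using no lm by auto
    then obtain y where "m = ereal y" using lm(4) by (cases m) auto
    then show ?thesis using connects_translate[OF lm(1), of y] MInf by (auto simp: P_def zero_ereal_def)
  qed (use lm in auto)
  have "closed S"
    unfolding closed_sequential_limits
  proof (intro allI impI)
    fix cs c assume "(\<forall>n. cs n \<in> S) \<and> cs \<longlonglongrightarrow> c"
    then have "\<exists>l m. connects c l m \<and> (l = -\<infinity> \<or> m = \<infinity>) \<and> l \<noteq> \<infinity> \<and> m \<noteq> -\<infinity> \<and>
        ((\<forall>n::nat. (0::ereal) = -\<infinity>) \<longrightarrow> l = -\<infinity>) \<and> ((\<forall>n::nat. (\<infinity>::ereal) = \<infinity>) \<longrightarrow> m = \<infinity>)"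
      by (intro connects_compact[where b = b and cs = cs]) (use b zeros exp in \<open>auto simp: S_def\<close>)
    then obtain l m where lm: "connects c l m" "l = -\<infinity> \<or> m = \<infinity>" "l \<noteq> \<infinity>" "m \<noteq> -\<infinity>" "m = \<infinity>"
      by blast
    then have "l \<noteq> -\<infinity>" using no by auto
    then show "c \<in> S" using norm[OF lm(1-4)] by auto
  qed
  moreover have "closed P"
    unfolding closed_sequential_limits
  proof (intro allI impI)
    fix cs c assume "(\<forall>n. cs n \<in> P) \<and> cs \<longlonglongrightarrow> c"
    then have "\<exists>l m. connects c l m \<and> (l = -\<infinity> \<or> m = \<infinity>) \<and> l \<noteq> \<infinity> \<and> m \<noteq> -\<infinity> \<and>
        ((\<forall>n::nat. (-\<infinity>::ereal) = -\<infinity>) \<longrightarrow> l = -\<infinity>) \<and> ((\<forall>n::nat. (0::ereal) = \<infinity>) \<longrightarrow> m = \<infinity>)"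
      by (intro connects_compact[where b = b and cs = cs]) (use b zeros exp in \<open>auto simp: P_def\<close>)
    then obtain l m where lm: "connects c l m" "l = -\<infinity> \<or> m = \<infinity>" "l \<noteq> \<infinity>" "m \<noteq> -\<infinity>" "l = -\<infinity>"
      by blast
    then have "m \<noteq> \<infinity>" using no by auto
    then show "c \<in> P" using norm[OF lm(1-4)] by auto
  qed
  moreover have "S \<union> P = UNIV"
  proof -
    \<comment> \<open>Bounded intervals violate \<open>ends\<close> at speed 0; that speed is
      recovered below from closedness.\<close>
    have "c \<in> S \<union> P" if "c \<noteq> 0" for c
    proof -
      have "\<exists>l m. connects c l m \<and> (l = -\<infinity> \<or> m = \<infinity>) \<and> l \<noteq> \<infinity> \<and> m \<noteq> -\<infinity> \<and>
          ((\<forall>n::nat. (0::ereal) = -\<infinity>) \<longrightarrow> l = -\<infinity>) \<and> ((\<forall>n. ereal (real (Suc n)) = \<infinity>) \<longrightarrow> m = \<infinity>)"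
      proof (rule connects_compact[where b = b and cs = "\<lambda>_. c"])
        \<comment> \<open>\<open>Suc n\<close> rather than \<open>n\<close>, since
          \<open>connects_truncated\<close> requires positive length already at
          \<open>n = 0\<close>.\<close>
        show "connects c 0 (ereal (real (Suc n)))" for n by (rule connects_truncated) simp
      qed (use b zeros exp that in auto)
      then obtain l m where lm: "connects c l m" "l = -\<infinity> \<or> m = \<infinity>" "l \<noteq> \<infinity>" "m \<noteq> -\<infinity>"
        by blast
      then show ?thesis using norm[OF lm] by auto
    qed
    then have "- {0} \<subseteq> S \<union> P" by auto
    moreover have "closed (S \<union> P)" using \<open>closed S\<close> \<open>closed P\<close> by (rule closed_Un)
    ultimately have "closure (- {0}) \<subseteq> S \<union> P" by (rule closure_minimal)
    moreover have "closure (- {0::real}) = UNIV" by (simp add: closure_complement)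
    ultimately show ?thesis by blast
  qed
  moreover have "S \<noteq> {}" "P \<noteq> {}" using ex_connects_left ex_connects_right by (auto simp: S_def P_def)
  moreover have "S \<inter> P = {}" using no connects_between by (auto simp: S_def P_def)
  ultimately show False
    using connected_closedD[OF connected_UNIV, of S P] by auto
qed

end

section \<open>The wave map of a bistable nonlinearity\<close>

text \<open>The map is the contraction of [0,1] towards its centre 1/2; it will move points on faces
  of the cube into the interior.\<close>

lemma convex_unit_cube_comp:
  assumes "0 \<le> x" "x \<le> 1" "0 \<le> (e::real)" "e \<le> 1/2"
  shows "0 \<le> (1 - 2 * e) * x + e" "(1 - 2 * e) * x + e \<le> 1"
    "0 < e \<Longrightarrow> 0 < (1 - 2 * e) * x + e" "0 < e \<Longrightarrow> (1 - 2 * e) * x + e < 1"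
proof -
  define y where "y = (1 - 2 * e) * x"
  have "0 \<le> y" "y \<le> (1 - 2 * e) * 1"
    unfolding y_def using assms by (intro mult_nonneg_nonneg mult_left_mono; simp)+
  then show "0 \<le> (1 - 2 * e) * x + e" "(1 - 2 * e) * x + e \<le> 1"
    "0 < e \<Longrightarrow> 0 < (1 - 2 * e) * x + e" "0 < e \<Longrightarrow> (1 - 2 * e) * x + e < 1"
    unfolding y_def[symmetric] using assms by auto
qed

text \<open>Nearest-point projection onto the cube. Composing with it extends \<open>F\<close> to
  the whole space with the same Lipschitz constant, and it preserves order.\<close>

definition clamp_cube :: "real ^ 'n \<Rightarrow> real ^ 'n" where
  "clamp_cube X = (\<chi> i. max 0 (min 1 (X $ i)))"

lemma clamp_cube_in: "clamp_cube X \<in> unit_cube"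
  by (simp add: clamp_cube_def unit_cube_def)

lemma clamp_cube_id: "X \<in> unit_cube \<Longrightarrow> clamp_cube X = X"
  by (auto simp: clamp_cube_def unit_cube_def vec_eq_iff)

lemma clamp_cube_mono: "X \<le> Y \<Longrightarrow> clamp_cube X \<le> clamp_cube Y"
  unfolding less_eq_vec_def clamp_cube_def by (auto simp: max_def min_def intro: order_trans)

lemma dist_clamp_cube: "dist (clamp_cube X) (clamp_cube Y) \<le> dist X Y"
  unfolding dist_norm
  by (rule norm_le_componentwise_cart) (auto simp: clamp_cube_def max_def min_def)

lemma lipschitz_clamp:
  assumes "L-lipschitz_on unit_cube F"
  shows "L-lipschitz_on UNIV (\<lambda>X. F (clamp_cube X))"
proof (rule lipschitz_onI)
  show L: "0 \<le> L" using assms by (rule lipschitz_on_nonneg)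
  fix X Y
  have "dist (F (clamp_cube X)) (F (clamp_cube Y)) \<le> L * dist (clamp_cube X) (clamp_cube Y)"
    using assms clamp_cube_in by (metis lipschitz_onD)
  also have "\<dots> \<le> L * dist X Y" using L dist_clamp_cube by (rule mult_left_mono[rotated])
  finally show "dist (F (clamp_cube X)) (F (clamp_cube Y)) \<le> L * dist X Y" .
qed

lemma AE_lebesgue_translate:
  fixes a :: "'a::euclidean_space"
  assumes "AE X in lebesgue. P X"
  shows "AE Y in lebesgue. P (Y + a)"
proof -
  obtain N where N: "N \<in> null_sets lebesgue" "{X. \<not> P X} \<subseteq> N"
    using assms by (auto simp: eventually_ae_filter)
  have "negligible ((+) (- a) ` N)"
    using N(1) by (intro negligible_translation) (simp add: negligible_iff_null_sets)
  moreover have "{Y. \<not> P (Y + a)} \<subseteq> (+) (- a) ` N"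
  proof
    fix Y assume "Y \<in> {Y. \<not> P (Y + a)}"
    then have "Y + a \<in> N" using N(2) by auto
    then show "Y \<in> (+) (- a) ` N" by (intro image_eqI[of _ _ "Y + a"]) auto
  qed
  ultimately show ?thesis
    by (intro AE_I'[of "(+) (- a) ` N"]) (auto simp: negligible_iff_null_sets)
qed

text \<open>
  Averaging \<open>H = 2 F + \<alpha>0 X_0\<close> over a small ball turns the almost everywhere condition into
  \<open>D' \<ge> 0\<close> for the average \<open>D t\<close> of \<open>H\<close> over the ball shifted by \<open>t\<close> in direction \<open>X_0\<close>.
\<close>

lemma nondecreasing_slot_0_interior:
  fixes F :: "real ^ 'n::{finite,zero} \<Rightarrow> real"
  assumes lip: "L-lipschitz_on unit_cube F"
    and ae: "AE X in lebesgue. X \<in> unit_cube \<longrightarrow> (\<exists>d. has_partial_derivative_0 F d X \<and> 2 * d + \<alpha>0 > 0)"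
    and X: "\<And>i. 0 < X $ i" "\<And>i. X $ i < 1" and h: "0 < h" "X $ 0 + h < 1"
  shows "2 * F X + \<alpha>0 * X $ 0 \<le> 2 * F (X + h *\<^sub>R axis 0 1) + \<alpha>0 * (X $ 0 + h)"
proof (rule ccontr)
  assume neg: "\<not> ?thesis"
  define e where "e = (axis 0 1 :: real ^ 'n::{finite,zero})"
  define H where "H X = 2 * F (clamp_cube X) + \<alpha>0 * X $ 0" for X
  define K where "K = 2 * L + \<bar>\<alpha>0\<bar>"
  have L: "0 \<le> L" using lip by (rule lipschitz_on_nonneg)
  have lipH: "\<bar>H X - H Y\<bar> \<le> K * dist X Y" for X Y
  proof -
    have "\<bar>F (clamp_cube X) - F (clamp_cube Y)\<bar> \<le> L * dist X Y"
      using lipschitz_onD[OF lipschitz_clamp[OF lip], of X Y] by (simp add: dist_real_def)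
    moreover have "\<bar>\<alpha>0 * X $ 0 - \<alpha>0 * Y $ 0\<bar> \<le> \<bar>\<alpha>0\<bar> * dist X Y"
      using mult_left_mono[OF component_le_norm_cart[of "X - Y" 0], of "\<bar>\<alpha>0\<bar>"]
      by (simp add: dist_norm right_diff_distrib[symmetric] abs_mult)
    ultimately show ?thesis by (simp add: H_def K_def algebra_simps abs_le_iff)
  qed
  have K: "0 \<le> K" using L by (simp add: K_def)
  have contH: "continuous_on UNIV H"
    using lipH K by (intro lipschitz_on_continuous_on[of K] lipschitz_onI) (auto simp: dist_real_def)
  have [measurable]: "H \<in> borel_measurable borel" using contH by (rule borel_measurable_continuous_onI)
  have norm_e: "norm e = 1" by (simp add: e_def norm_axis_1)
  have He: "H (X + h *\<^sub>R e) < H X"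
  proof -
    have "X \<in> unit_cube" "X + h *\<^sub>R e \<in> unit_cube"
      using X h by (auto simp: unit_cube_def axis_def e_def less_imp_le)
    then show ?thesis
      using neg by (simp add: H_def clamp_cube_id axis_def e_def)
  qed
  \<comment> \<open>Half of the supposed drop of \<open>H\<close>: one half is given up to the
    variation of \<open>H\<close> over the ball, the other remains for the contradiction.\<close>
  define \<eta> where "\<eta> = (H X - H (X + h *\<^sub>R e)) / 2"
  have \<eta>: "0 < \<eta>" using He by (simp add: \<eta>_def)
  \<comment> \<open>Distance to the faces of the cube along the whole segment; only coordinate 0
    moves, up to \<open>X $ 0 + h\<close>.\<close>
  define mu where "mu = Min (insert (1 - (X $ 0 + h)) (range (\<lambda>i. min (X $ i) (1 - X $ i))))"
  have mu: "0 < mu" unfolding mu_def using X h by (subst Min_gr_iff) auto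
  have mu_le: "mu \<le> 1 - (X $ 0 + h)" "mu \<le> X $ i" "mu \<le> 1 - X $ i" for i
  proof -
    show "mu \<le> 1 - (X $ 0 + h)" unfolding mu_def by (rule Min_le) auto
    have "mu \<le> min (X $ i) (1 - X $ i)" unfolding mu_def by (rule Min_le) auto
    then show "mu \<le> X $ i" "mu \<le> 1 - X $ i" by auto
  qed
  \<comment> \<open>The first bound keeps all shifted balls in the open cube, the second leaves a
    drop of at least \<eta> at every point of the ball.\<close>
  define \<rho> where "\<rho> = min (mu / 2) (\<eta> / (2 * (K + 1)))"
  have \<rho>: "0 < \<rho>" "\<rho> < mu" "2 * K * \<rho> \<le> \<eta>"
  proof -
    show "0 < \<rho>" using mu \<eta> K by (simp add: \<rho>_def)
    show "\<rho> < mu" using mu unfolding \<rho>_def by linarith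
    have "2 * K * \<rho> \<le> 2 * (K + 1) * (\<eta> / (2 * (K + 1)))"
      using K \<eta> \<open>0 < \<rho>\<close> by (intro mult_mono) (auto simp: \<rho>_def)
    also have "\<dots> = \<eta>" using K by simp
    finally show "2 * K * \<rho> \<le> \<eta>" .
  qed
  define B where "B = cball X \<rho>"
  have comp: "\<bar>Y $ i - X $ i\<bar> \<le> \<rho>" if "Y \<in> B" for Y i
    using component_le_norm_cart[of "Y - X" i] that by (simp add: B_def dist_norm norm_minus_commute)
  have inside: "0 < (Y + t *\<^sub>R e) $ i" "(Y + t *\<^sub>R e) $ i < 1" if "Y \<in> B" "0 \<le> t" "t \<le> h" for Y t i
    using comp[OF that(1), of i] mu_le(1) mu_le(2,3)[of i] \<rho>(2) that by (auto simp: e_def axis_def split: if_splits)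
  have [measurable]: "B \<in> sets lebesgue" "B \<in> sets borel" by (auto simp: B_def)
  have fin: "emeasure lebesgue B < \<infinity>" unfolding B_def using emeasure_bounded_finite[OF bounded_cball] by simp
  have int: "integrable lebesgue (\<lambda>Y. indicator B Y * H (Y + t *\<^sub>R e))" for t
  proof -
    have "integrable lborel (\<lambda>Y. indicator B Y *\<^sub>R H (Y + t *\<^sub>R e))"
      unfolding B_def
      by (intro borel_integrable_compact continuous_on_compose2[OF contH] continuous_intros) auto
    then show ?thesis by (subst integrable_completion) auto
  qed
  define D where "D t = (\<integral>Y. indicator B Y * H (Y + t *\<^sub>R e) \<partial>lebesgue)" for t
  define q where "q t k Y = (H (Y + (t + k) *\<^sub>R e) - H (Y + t *\<^sub>R e)) / k" for t k Y
  have qK: "\<bar>q t k Y\<bar> \<le> K" for t k Y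
  proof (cases "k = 0")
    case False
    have "\<bar>H (Y + (t + k) *\<^sub>R e) - H (Y + t *\<^sub>R e)\<bar> \<le> K * \<bar>k\<bar>"
      using lipH[of "Y + (t + k) *\<^sub>R e" "Y + t *\<^sub>R e"] norm_e by (simp add: dist_norm algebra_simps)
    then show ?thesis using False by (simp add: q_def abs_divide field_simps)
  qed (use K in \<open>simp add: q_def\<close>)
  have quot: "(D (t + k) - D t) / k = (\<integral>Y. indicator B Y * q t k Y \<partial>lebesgue)" for t k
  proof -
    have "(D (t + k) - D t) / k = (\<integral>Y. (indicator B Y * H (Y + (t + k) *\<^sub>R e) - indicator B Y * H (Y + t *\<^sub>R e)) / k \<partial>lebesgue)"
      unfolding D_def using int by simp
    also have "\<dots> = (\<integral>Y. indicator B Y * q t k Y \<partial>lebesgue)"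
      by (simp add: q_def right_diff_distrib)
    finally show ?thesis .
  qed
  have meas_q: "(\<lambda>Y. indicator B Y * q t k Y) \<in> borel_measurable lebesgue" for t k
    unfolding q_def by (intro measurable_completion) measurable
  \<comment> \<open>A segment in direction \<open>e\<close> may lie entirely in the exceptional null
    set. For each fixed \<open>t\<close>, however, the translated null set is null in
    \<open>Y\<close>, and that is enough after averaging.\<close>
  have lim_q: "AE Y in lebesgue. Y \<in> B \<longrightarrow> (\<exists>d\<ge>0. ((\<lambda>k. q t k Y) \<longlongrightarrow> d) (at 0))" if t: "0 \<le> t" "t \<le> h" for t
    using AE_lebesgue_translate[OF ae, of "t *\<^sub>R e"]
  proof eventually_elim
    case (elim Y)
    show ?case
    proof
      assume Y: "Y \<in> B"
      define Z where "Z = Y + t *\<^sub>R e"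
      have Z: "0 < Z $ i" "Z $ i < 1" for i using inside[OF Y t] by (auto simp: Z_def)
      then have "Z \<in> unit_cube" by (auto simp: unit_cube_def intro: less_imp_le)
      then obtain d where d: "has_partial_derivative_0 F d Z" "2 * d + \<alpha>0 > 0" using elim by (auto simp: Z_def)
      let ?f = "\<lambda>x. F (\<chi> j. if j = 0 then x else Z $ j)"
      have "(?f has_real_derivative d) (at (Z $ 0))"
        using d(1) Z(1)[of 0] Z(2)[of 0] unfolding has_partial_derivative_0_def
        by (subst (asm) at_within_interior) (auto simp: interior_atLeastAtMost_real)
      then have "((\<lambda>x. 2 * ?f x + \<alpha>0 * x) has_real_derivative (2 * d + \<alpha>0)) (at (Z $ 0))"
        by (auto intro!: derivative_eq_intros)
      then have lim: "((\<lambda>k. ((2 * ?f (Z $ 0 + k) + \<alpha>0 * (Z $ 0 + k)) - (2 * ?f (Z $ 0) + \<alpha>0 * Z $ 0)) / k) \<longlongrightarrow> 2 * d + \<alpha>0) (at 0)"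
        unfolding DERIV_def .
      have "\<forall>\<^sub>F k in at 0. ((2 * ?f (Z $ 0 + k) + \<alpha>0 * (Z $ 0 + k)) - (2 * ?f (Z $ 0) + \<alpha>0 * Z $ 0)) / k = q t k Y"
        unfolding eventually_at
      proof (intro exI[of _ "min (Z $ 0) (1 - Z $ 0)"] conjI ballI impI)
        show "0 < min (Z $ 0) (1 - Z $ 0)" using Z[of 0] by simp
        fix k :: real assume k: "k \<noteq> 0 \<and> dist k 0 < min (Z $ 0) (1 - Z $ 0)"
        have eq: "Y + (t + s) *\<^sub>R e = (\<chi> j. if j = 0 then Z $ 0 + s else Z $ j)" for s
          by (auto simp: vec_eq_iff e_def axis_def Z_def)
        have cube: "(\<chi> j. if j = 0 then Z $ 0 + s else Z $ j) \<in> unit_cube" if "\<bar>s\<bar> < min (Z $ 0) (1 - Z $ 0)" for s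
          using that Z by (auto simp: unit_cube_def intro: less_imp_le)
        have val: "H (Y + (t + s) *\<^sub>R e) = 2 * ?f (Z $ 0 + s) + \<alpha>0 * (Z $ 0 + s)" if "\<bar>s\<bar> < min (Z $ 0) (1 - Z $ 0)" for s
          unfolding H_def eq clamp_cube_id[OF cube[OF that]] by simp
        have "H (Y + t *\<^sub>R e) = 2 * ?f (Z $ 0) + \<alpha>0 * Z $ 0"
          using val[of 0] Z[of 0] by (simp cong: if_cong)
        then show "((2 * ?f (Z $ 0 + k) + \<alpha>0 * (Z $ 0 + k)) - (2 * ?f (Z $ 0) + \<alpha>0 * Z $ 0)) / k = q t k Y"
          using val[of k] k by (simp add: q_def)
      qed
      then have "((\<lambda>k. q t k Y) \<longlongrightarrow> 2 * d + \<alpha>0) (at 0)"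
        using lim by (rule Lim_transform_eventually[rotated])
      then show "\<exists>d\<ge>0. ((\<lambda>k. q t k Y) \<longlongrightarrow> d) (at 0)" using d(2) by (intro exI[of _ "2 * d + \<alpha>0"]) auto
    qed
  qed
  have seq0: "(\<lambda>n. inverse (real (Suc n))) \<longlonglongrightarrow> 0" "inverse (real (Suc n)) \<noteq> 0" for n
    using LIMSEQ_inverse_real_of_nat by auto
  have "\<exists>y. DERIV D t :> y \<and> 0 \<le> y" if t: "0 \<le> t" "t \<le> h" for t
  proof -
    \<comment> \<open>The limit along one fixed sequence is measurable by construction and agrees
      almost everywhere with the full limit.\<close>
    define g where "g Y = lim (\<lambda>n. indicator B Y * q t (inverse (real (Suc n))) Y)" for Y
    have g_meas: "g \<in> borel_measurable lebesgue" unfolding g_def by (intro borel_measurable_lim_metric meas_q)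
    have g: "AE Y in lebesgue. 0 \<le> g Y \<and> ((\<lambda>k. indicator B Y * q t k Y) \<longlongrightarrow> g Y) (at 0)"
      using lim_q[OF t]
    proof eventually_elim
      case (elim Y)
      show ?case
      proof (cases "Y \<in> B")
        case True
        then obtain d where d: "d \<ge> 0" "((\<lambda>k. q t k Y) \<longlongrightarrow> d) (at 0)" using elim by auto
        have "(\<lambda>n. q t (inverse (real (Suc n))) Y) \<longlonglongrightarrow> d"
          using d(2) seq0 unfolding tendsto_at_iff_sequentially by (auto simp: o_def)
        then have "g Y = d" using True by (simp add: g_def limI)
        then show ?thesis using True d by simp
      qed (simp add: g_def)
    qed
    have "((\<lambda>k. (D (t + k) - D t) / k) \<longlongrightarrow> (\<integral>Y. g Y \<partial>lebesgue)) (at 0)"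
      unfolding quot tendsto_at_iff_sequentially
    proof (intro allI impI)
      fix ks :: "nat \<Rightarrow> real" assume ks: "\<forall>i. ks i \<in> UNIV - {0}" "ks \<longlonglongrightarrow> 0"
      show "((\<lambda>k. \<integral>Y. indicator B Y * q t k Y \<partial>lebesgue) \<circ> ks) \<longlonglongrightarrow> (\<integral>Y. g Y \<partial>lebesgue)"
        unfolding o_def
      proof (rule integral_dominated_convergence[where w = "\<lambda>Y. K * indicator B Y"])
        show "AE Y in lebesgue. (\<lambda>n. indicator B Y * q t (ks n) Y) \<longlonglongrightarrow> g Y"
          using g by eventually_elim (use ks in \<open>auto simp: tendsto_at_iff_sequentially o_def\<close>)
        show "AE Y in lebesgue. norm (indicator B Y * q t (ks n) Y) \<le> K * indicator B Y" for n
          using qK by (auto simp: indicator_def)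
        show "integrable lebesgue (\<lambda>Y. K * indicator B Y)"
          using fin by (intro integrable_mult_right integrable_real_indicator) auto
      qed (use g_meas meas_q in auto)
    qed
    moreover have "0 \<le> (\<integral>Y. g Y \<partial>lebesgue)"
      using g by (intro integral_nonneg_AE) (auto elim: eventually_mono)
    ultimately show ?thesis by (auto simp: DERIV_def)
  qed
  then have "D 0 \<le> D h" using h by (intro DERIV_nonneg_imp_nondecreasing[of 0 h D]) auto
  moreover have "D h \<le> D 0 - \<eta> * measure lebesgue B"
  proof -
    have drop: "H (Y + h *\<^sub>R e) \<le> H Y - \<eta>" if "Y \<in> B" for Y
    proof -
      have d: "dist Y X \<le> \<rho>" using that by (simp add: B_def dist_commute)
      have "\<bar>H Y - H X\<bar> \<le> K * \<rho>" using lipH[of Y X] mult_left_mono[OF d K] by linarith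
      moreover have "\<bar>H (Y + h *\<^sub>R e) - H (X + h *\<^sub>R e)\<bar> \<le> K * \<rho>"
        using lipH[of "Y + h *\<^sub>R e" "X + h *\<^sub>R e"] mult_left_mono[OF d K] by simp
      moreover have "H X - H (X + h *\<^sub>R e) = 2 * \<eta>" by (simp add: \<eta>_def)
      ultimately show ?thesis using \<rho>(3) by (simp add: abs_le_iff)
    qed
    have "D h \<le> (\<integral>Y. indicator B Y * H (Y + 0 *\<^sub>R e) - \<eta> * indicator B Y \<partial>lebesgue)"
      unfolding D_def
    proof (rule integral_mono[OF int])
      show "integrable lebesgue (\<lambda>Y. indicator B Y * H (Y + 0 *\<^sub>R e) - \<eta> * indicator B Y)"
        using fin by (intro Bochner_Integration.integrable_diff int integrable_mult_right integrable_real_indicator) auto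
    qed (use drop in \<open>auto simp: indicator_def\<close>)
    also have "\<dots> = D 0 - \<eta> * measure lebesgue B"
      unfolding D_def using fin
      by (subst Bochner_Integration.integral_diff) (auto intro!: int[of 0, simplified])
    finally show ?thesis .
  qed
  moreover have "0 < measure lebesgue B"
    unfolding B_def using \<rho>(1) content_cball_pos[of \<rho> X] by simp
  ultimately show False using \<eta> mult_pos_pos[of \<eta> "measure lebesgue B"] by linarith
qed

text \<open>The ball average needs interior points. Both points are contracted towards the centre of
  the cube, compared there, and released by continuity of \<open>F\<close>.\<close>

lemma nondecreasing_slot_0:
  fixes F :: "real ^ 'n::{finite,zero} \<Rightarrow> real"
  assumes lip: "L-lipschitz_on unit_cube F"
    and ae: "AE X in lebesgue. X \<in> unit_cube \<longrightarrow> (\<exists>d. has_partial_derivative_0 F d X \<and> 2 * d + \<alpha>0 > 0)"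
    and XY: "X \<in> unit_cube" "Y \<in> unit_cube" "X $ 0 \<le> Y $ 0" "\<And>j. j \<noteq> 0 \<Longrightarrow> X $ j = Y $ j"
  shows "2 * F X + \<alpha>0 * X $ 0 \<le> 2 * F Y + \<alpha>0 * Y $ 0"
proof (cases "X $ 0 = Y $ 0")
  case True
  then have "X = Y" unfolding vec_eq_iff using XY(4) by metis
  then show ?thesis by simp
next
  case False
  \<comment> \<open>As \<open>e 0 = 1/2\<close> collapses the cube to its centre, the comparison
    starts at \<open>n = 1\<close>.\<close>
  define e where "e n = inverse (real (Suc n)) / 2" for n
  define S where "S n Z = (1 - 2 * e n) *\<^sub>R Z + vec (e n)" for n and Z :: "real ^ 'n::{finite,zero}"
  have e: "0 < e n" "e n \<le> 1/2" "e n < 1/2 \<or> n = 0" for n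
    by (auto simp: e_def inverse_eq_divide)
  have e0: "e \<longlonglongrightarrow> 0" unfolding e_def using LIMSEQ_inverse_real_of_nat tendsto_divide_zero by blast
  have S_cube: "S n Z \<in> unit_cube" if "Z \<in> unit_cube" for n Z
    using that convex_unit_cube_comp(1,2)[of "Z $ i" "e n" for i] e[of n]
    by (auto simp: S_def unit_cube_def less_imp_le)
  have lim: "(\<lambda>n. 2 * F (S n Z) + \<alpha>0 * S n Z $ 0) \<longlonglongrightarrow> 2 * F Z + \<alpha>0 * Z $ 0" if Z: "Z \<in> unit_cube" for Z
  proof -
    have "(\<lambda>n. S n Z) \<longlonglongrightarrow> (1 - 2 * 0) *\<^sub>R Z + vec 0"
      unfolding S_def vec_def by (intro tendsto_intros e0)
    then have S: "(\<lambda>n. S n Z) \<longlonglongrightarrow> Z" by simp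
    have "(\<lambda>n. F (S n Z)) \<longlonglongrightarrow> F Z"
      using continuous_on_tendsto_compose[OF lipschitz_on_continuous_on[OF lip] S Z] S_cube[OF Z] by auto
    then show ?thesis by (intro tendsto_intros S)
  qed
  show ?thesis
  proof (rule LIMSEQ_le[OF lim[OF XY(1)] lim[OF XY(2)]], intro exI[of _ 1] allI impI)
    fix n :: nat assume n: "1 \<le> n"
    let ?h = "S n Y $ 0 - S n X $ 0"
    have e': "0 < 1 - 2 * e n" using e(3)[of n] n by auto
    have h: "0 < ?h" using XY(3) False e' by (simp add: S_def)
    have eq: "S n X + ?h *\<^sub>R axis 0 1 = S n Y"
    proof -
      have "S n X $ j = S n Y $ j" if "j \<noteq> 0" for j using XY(4)[OF that] by (simp add: S_def)
      then show ?thesis by (auto simp: vec_eq_iff axis_def)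
    qed
    have int: "0 < S n Z $ i \<and> S n Z $ i < 1" if "Z \<in> unit_cube" for Z i
      using that convex_unit_cube_comp(3,4)[of "Z $ i" "e n"] e[of n] by (auto simp: S_def unit_cube_def intro: less_imp_le)
    have "2 * F (S n X) + \<alpha>0 * S n X $ 0 \<le> 2 * F (S n X + ?h *\<^sub>R axis 0 1) + \<alpha>0 * (S n X $ 0 + ?h)"
      using int[OF XY(1)] int[OF XY(2), of 0] h by (intro nondecreasing_slot_0_interior[OF lip ae]) auto
    then show "2 * F (S n X) + \<alpha>0 * S n X $ 0 \<le> 2 * F (S n Y) + \<alpha>0 * S n Y $ 0"
      unfolding eq by simp
  qed
qed

section \<open>The map \<open>G\<close> and its expansion at \<open>b\<close>\<close>

definition wave_map :: "real \<Rightarrow> (real ^ 'n::{finite,zero} \<Rightarrow> real) \<Rightarrow> real ^ 'n::{finite,zero} \<Rightarrow> real" where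
  "wave_map \<alpha>0 F X = clamp_cube X $ 0 + 2 / \<alpha>0 * F (clamp_cube X)"

text \<open>Slot 0 is covered by the averaging argument, the other slots by hypothesis. An ordered
  pair in the cube is joined by replacing one coordinate at a time, which never leaves the
  cube.\<close>

lemma mono_wave_map:
  fixes F :: "real ^ 'n::{finite,zero} \<Rightarrow> real"
  assumes \<alpha>: "0 < \<alpha>0" and A: "assumption_A \<alpha>0 F"
  shows "mono (wave_map \<alpha>0 F)"
proof -
  define h where "h X = X $ 0 + 2 / \<alpha>0 * F X" for X
  obtain L where L: "L-lipschitz_on unit_cube F" using A by (auto simp: assumption_A_def)
  have slot: "h X \<le> h Y" if XY: "X \<in> unit_cube" "Y \<in> unit_cube" "X $ i \<le> Y $ i" "\<And>j. j \<noteq> i \<Longrightarrow> X $ j = Y $ j" for X Y i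
  proof (cases "i = 0")
    case True
    have "2 * F X + \<alpha>0 * X $ 0 \<le> 2 * F Y + \<alpha>0 * Y $ 0"
      using A XY True by (intro nondecreasing_slot_0[OF L]) (auto simp: assumption_A_def)
    then have "(2 * F X + \<alpha>0 * X $ 0) / \<alpha>0 \<le> (2 * F Y + \<alpha>0 * Y $ 0) / \<alpha>0"
      using \<alpha> by (intro divide_right_mono) auto
    then show ?thesis using \<alpha> by (simp add: h_def add_divide_distrib)
  next
    case False
    have "F X \<le> F Y" using A XY False unfolding assumption_A_def by blast
    moreover have "X $ 0 = Y $ 0" using XY(4) False by metis
    ultimately show ?thesis using \<alpha> by (simp add: h_def divide_right_mono)
  qed
  have cube: "h X \<le> h Y" if XY: "X \<in> unit_cube" "Y \<in> unit_cube" "X \<le> Y" for X Y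
  proof -
    have "h X \<le> h (\<chi> j. if j \<in> A then Y $ j else X $ j)" if "finite A" for A
      using that
    proof (induction A rule: finite_induct)
      case empty
      then show ?case by simp
    next
      case (insert i A)
      note insert.IH
      also have "h (\<chi> j. if j \<in> A then Y $ j else X $ j) \<le> h (\<chi> j. if j \<in> insert i A then Y $ j else X $ j)"
        using XY insert.hyps by (intro slot[of _ _ i]) (auto simp: unit_cube_def less_eq_vec_def)
      finally show ?case .
    qed
    from this[of UNIV] show ?thesis by simp
  qed
  have "wave_map \<alpha>0 F X = h (clamp_cube X)" for X by (simp add: wave_map_def h_def)
  then show ?thesis by (auto intro!: monoI cube clamp_cube_in clamp_cube_mono)
qed

lemma lipschitz_wave_map:
  fixes F :: "real ^ 'n::{finite,zero} \<Rightarrow> real"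
  assumes \<alpha>: "0 < \<alpha>0" and L: "L-lipschitz_on unit_cube F"
  shows "(1 + 2 / \<alpha>0 * L)-lipschitz_on UNIV (wave_map \<alpha>0 F)"
proof (rule lipschitz_onI)
  have "0 \<le> L" using L by (rule lipschitz_on_nonneg)
  then show "0 \<le> 1 + 2 / \<alpha>0 * L" using \<alpha> by simp
  fix X Y
  have "\<bar>F (clamp_cube X) - F (clamp_cube Y)\<bar> \<le> L * dist X Y"
    using lipschitz_onD[OF lipschitz_clamp[OF L], of X Y] by (simp add: dist_real_def)
  then have "\<bar>2 / \<alpha>0 * (F (clamp_cube X) - F (clamp_cube Y))\<bar> \<le> 2 / \<alpha>0 * (L * dist X Y)"
    using \<alpha> by (simp only: abs_mult) (intro mult_mono, auto)
  moreover have "\<bar>clamp_cube X $ 0 - clamp_cube Y $ 0\<bar> \<le> dist X Y"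
    using component_le_norm_cart[of "clamp_cube X - clamp_cube Y" 0] dist_clamp_cube[of X Y]
    by (simp add: dist_norm)
  ultimately show "dist (wave_map \<alpha>0 F X) (wave_map \<alpha>0 F Y) \<le> (1 + 2 / \<alpha>0 * L) * dist X Y"
    by (simp add: wave_map_def dist_real_def algebra_simps abs_le_iff)
qed

lemma wave_map_vec:
  fixes F :: "real ^ 'n::{finite,zero} \<Rightarrow> real"
  assumes "0 \<le> p" "p \<le> 1"
  shows "wave_map \<alpha>0 F (vec p) = p + 2 / \<alpha>0 * diagonal F p"
proof -
  have "clamp_cube (vec p :: real ^ 'n::{finite,zero}) = vec p"
    using assms by (intro clamp_cube_id) (simp add: unit_cube_def)
  then show ?thesis by (simp add: wave_map_def diagonal_def)
qed

text \<open>Monotonicity makes the partial derivatives non-negative near \<open>b\<close>, and at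
  \<open>b\<close> their sum is \<open>1 + 2 / \<alpha>0 * d\<close>. Continuity of the gradient
  lets each be lowered by a small \<epsilon> to hold in a whole box, and the mean value theorem
  turns this into the inequality for increments.\<close>

lemma wave_map_expanding:
  fixes F :: "real ^ 'n::{finite,zero} \<Rightarrow> real"
  assumes \<alpha>: "0 < \<alpha>0" and mono: "mono (wave_map \<alpha>0 F)" and b: "0 < b" "b < 1"
    and C1: "C1_near F (vec b)"
    and d: "0 < d" "(diagonal F has_real_derivative d) (at b within {0..1})"
  shows "\<exists>\<delta> a. 0 < \<delta> \<and> (\<forall>i. 0 \<le> a i) \<and> 1 < (\<Sum>i\<in>UNIV. a i) \<and>
     (\<forall>X Y. (\<forall>i. b - \<delta> \<le> X $ i \<and> X $ i \<le> Y $ i \<and> Y $ i \<le> b + \<delta>) \<longrightarrow>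
       (\<Sum>i\<in>UNIV. a i * (Y $ i - X $ i)) \<le> wave_map \<alpha>0 F Y - wave_map \<alpha>0 F X)"
proof -
  obtain U Gr where U: "open U" "vec b \<in> U"
    and der: "\<And>X. X \<in> U \<Longrightarrow> X \<in> unit_cube \<Longrightarrow> (F has_derivative (\<lambda>h. Gr X \<bullet> h)) (at X within unit_cube)"
    and cont: "continuous_on (U \<inter> unit_cube) Gr"
    using C1 unfolding C1_near_def by blast
  \<comment> \<open>Inside the open cube the derivative relative to the cube is an ordinary
    derivative; \<open>0 < b < 1\<close> keeps the diagonal point there.\<close>
  define V where "V = U \<inter> box (vec 0) (vec 1)"
  have V: "open V" "vec b \<in> V" using U b by (auto simp: V_def mem_box_cart)
  have V_cube: "V \<subseteq> unit_cube" by (auto simp: V_def mem_box_cart unit_cube_def less_imp_le)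
  have derF: "(F has_derivative (\<lambda>h. Gr Z \<bullet> h)) (at Z)" if "Z \<in> V" for Z
  proof -
    have "Z \<in> interior unit_cube" using V(1) V_cube that by (meson interior_maximal subsetD)
    then have "at Z within unit_cube = at Z" by (rule at_within_interior)
    moreover have "Z \<in> U" "Z \<in> unit_cube" using that V_cube by (auto simp: V_def)
    ultimately show ?thesis using der[of Z] by simp
  qed
  define p where "p Z i = (if i = 0 then 1 else 0) + 2 / \<alpha>0 * Gr Z $ i" for Z i
  have p_sum: "h $ 0 + 2 / \<alpha>0 * (Gr Z \<bullet> h) = (\<Sum>i\<in>UNIV. p Z i * h $ i)" for Z h
  proof -
    have "(\<Sum>i\<in>UNIV. p Z i * h $ i) = (\<Sum>i\<in>UNIV. (if i = 0 then h $ i else 0) + 2 / \<alpha>0 * (Gr Z $ i * h $ i))"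
      by (intro sum.cong) (auto simp: p_def algebra_simps)
    also have "\<dots> = h $ 0 + 2 / \<alpha>0 * (Gr Z \<bullet> h)"
      by (simp add: sum.distrib inner_vec_def sum_distrib_left)
    finally show ?thesis by simp
  qed
  have derW: "(wave_map \<alpha>0 F has_derivative (\<lambda>h. \<Sum>i\<in>UNIV. p Z i * h $ i)) (at Z)" if Z: "Z \<in> V" for Z
  proof -
    have "((\<lambda>X. X $ 0 + 2 / \<alpha>0 * F X) has_derivative (\<lambda>h. h $ 0 + 2 / \<alpha>0 * (Gr Z \<bullet> h))) (at Z)"
      by (intro has_derivative_add has_derivative_mult_right derF Z bounded_linear_imp_has_derivative bounded_linear_vec_nth)
    then have "(wave_map \<alpha>0 F has_derivative (\<lambda>h. h $ 0 + 2 / \<alpha>0 * (Gr Z \<bullet> h))) (at Z)"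
      by (rule has_derivative_transform_within_open[OF _ V(1) Z]) (use V_cube in \<open>auto simp: wave_map_def clamp_cube_id\<close>)
    then show ?thesis by (simp only: p_sum)
  qed
  have p_nonneg: "0 \<le> p Z i" if Z: "Z \<in> V" for Z i
  proof -
    let ?f = "\<lambda>t. wave_map \<alpha>0 F (Z + t *\<^sub>R axis i 1)"
    have "((\<lambda>t. Z + t *\<^sub>R axis i 1) has_derivative (\<lambda>s. s *\<^sub>R axis i 1)) (at (0::real))"
      by (auto intro!: derivative_eq_intros)
    moreover have "(wave_map \<alpha>0 F has_derivative (\<lambda>h. \<Sum>j\<in>UNIV. p Z j * h $ j)) (at (Z + 0 *\<^sub>R axis i 1))"
      using derW[OF Z] by simp
    ultimately have "((wave_map \<alpha>0 F \<circ> (\<lambda>t. Z + t *\<^sub>R axis i 1)) has_derivative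
        ((\<lambda>h. \<Sum>j\<in>UNIV. p Z j * h $ j) \<circ> (\<lambda>s. s *\<^sub>R axis i 1))) (at 0)"
      by (rule diff_chain_at)
    moreover have "(\<lambda>h. \<Sum>j\<in>UNIV. p Z j * h $ j) \<circ> (\<lambda>s. s *\<^sub>R axis i 1) = (\<lambda>s. p Z i * s)"
      by (auto simp: fun_eq_iff axis_def if_distrib cong: if_cong)
    ultimately have "(?f has_real_derivative p Z i) (at 0)"
      by (simp add: has_field_derivative_def o_def)
    moreover have "mono_on UNIV ?f"
    proof (rule mono_onI)
      fix s t :: real assume "s \<le> t"
      then have "Z + s *\<^sub>R axis i 1 \<le> Z + t *\<^sub>R axis i 1" by (auto simp: less_eq_vec_def axis_def)
      then show "?f s \<le> ?f t" using mono by (rule monoD[rotated])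
    qed
    ultimately show ?thesis
      using mono_on_imp_deriv_nonneg[of UNIV ?f "p Z i" 0] by simp
  qed
  \<comment> \<open>The chain rule along the diagonal identifies the sum of the partial derivatives
    of \<open>F\<close> with \<open>f'(b) = d\<close>; the summand 1 comes from the term
    X_0.\<close>
  have p_b: "(\<Sum>i\<in>UNIV. p (vec b) i) = 1 + 2 / \<alpha>0 * d"
  proof -
    have eq: "s *\<^sub>R (vec 1 :: real ^ 'n::{finite,zero}) = vec s" for s
      by (simp add: vec_eq_iff)
    have "((\<lambda>s. s *\<^sub>R (vec 1 :: real ^ 'n::{finite,zero})) has_derivative (\<lambda>s. s *\<^sub>R vec 1)) (at b)"
      by (auto intro!: derivative_eq_intros)
    then have "((\<lambda>t. vec t :: real ^ 'n::{finite,zero}) has_derivative (\<lambda>s. vec s)) (at b)"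
      by (simp only: eq)
    from diff_chain_at[OF this, of F "\<lambda>h. Gr (vec b) \<bullet> h"] derF[OF V(2)]
    have "(diagonal F has_derivative (\<lambda>s. Gr (vec b) \<bullet> vec s)) (at b)"
      by (simp add: o_def diagonal_def[abs_def])
    moreover have "(\<lambda>s. Gr (vec b) \<bullet> vec s) = (\<lambda>s. (\<Sum>i\<in>UNIV. Gr (vec b) $ i) * s)"
      by (auto simp: fun_eq_iff inner_vec_def sum_distrib_right)
    ultimately have "(diagonal F has_real_derivative (\<Sum>i\<in>UNIV. Gr (vec b) $ i)) (at b)"
      by (simp add: has_field_derivative_def)
    moreover have "(diagonal F has_real_derivative d) (at b)"
      using d(2) b by (subst (asm) at_within_interior) auto
    ultimately have "(\<Sum>i\<in>UNIV. Gr (vec b) $ i) = d" by (rule DERIV_unique)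
    then show ?thesis unfolding p_def sum.distrib sum_distrib_left[symmetric] by simp
  qed
  define n where "n = real CARD('n)"
  have n: "1 \<le> n" by (simp add: n_def)
  \<comment> \<open>The \<open>n\<close> coefficients together lose \<open>d / \<alpha>0\<close>,
    half of their excess \<open>2 * d / \<alpha>0\<close> over 1.\<close>
  define \<epsilon> where "\<epsilon> = d / (\<alpha>0 * n)"
  have \<epsilon>: "0 < \<epsilon>" "n * \<epsilon> = d / \<alpha>0" using d \<alpha> n by (auto simp: \<epsilon>_def)
  have "continuous_on V Gr" by (rule continuous_on_subset[OF cont]) (use V_cube in \<open>auto simp: V_def\<close>)
  then have "isCont Gr (vec b)" using V by (simp add: continuous_on_eq_continuous_at)
  then have "(Gr \<longlongrightarrow> Gr (vec b)) (nhds (vec b))" by (simp add: isCont_def tendsto_at_iff_tendsto_nhds)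
  then have "\<forall>\<^sub>F Z in nhds (vec b). dist (Gr Z) (Gr (vec b)) < \<epsilon> * \<alpha>0 / 2"
    using \<epsilon> \<alpha> by (intro tendstoD) auto
  moreover have "\<forall>\<^sub>F Z in nhds (vec b). Z \<in> V" using V by (rule eventually_nhds_in_open)
  ultimately have "\<forall>\<^sub>F Z in nhds (vec b). Z \<in> V \<and> dist (Gr Z) (Gr (vec b)) < \<epsilon> * \<alpha>0 / 2"
    by eventually_elim auto
  then obtain r0 where r0: "0 < r0" "\<And>Z. dist Z (vec b) < r0 \<Longrightarrow> Z \<in> V \<and> dist (Gr Z) (Gr (vec b)) < \<epsilon> * \<alpha>0 / 2"
    unfolding eventually_nhds_metric by auto
  \<comment> \<open>The box of half-width \<delta> lies in the Euclidean ball of radius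
    \<open>r0\<close>, by comparison with the sum of the \<open>n\<close> coordinate
    distances.\<close>
  define \<delta> where "\<delta> = r0 / (2 * n)"
  have \<delta>: "0 < \<delta>" "n * \<delta> < r0" using r0 n by (auto simp: \<delta>_def)
  have near: "Z \<in> V" "\<And>i. p (vec b) i - \<epsilon> \<le> p Z i" if Z: "\<And>i. \<bar>Z $ i - b\<bar> \<le> \<delta>" for Z
  proof -
    have "dist Z (vec b) \<le> (\<Sum>i\<in>UNIV. \<bar>Z $ i - b\<bar>)"
      using norm_le_l1_cart[of "Z - vec b"] by (simp add: dist_norm)
    also have "\<dots> \<le> (\<Sum>i\<in>(UNIV::'n set). \<delta>)" using Z by (intro sum_mono)
    also have "\<dots> < r0" using \<delta> by (simp add: n_def)
    finally have *: "Z \<in> V" "dist (Gr Z) (Gr (vec b)) < \<epsilon> * \<alpha>0 / 2" using r0(2) by auto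
    then show "Z \<in> V" by simp
    fix i
    have "\<bar>Gr Z $ i - Gr (vec b) $ i\<bar> < \<epsilon> * \<alpha>0 / 2"
      using component_le_norm_cart[of "Gr Z - Gr (vec b)" i] *(2) by (simp add: dist_norm)
    then have "Gr (vec b) $ i - \<epsilon> * \<alpha>0 / 2 \<le> Gr Z $ i" by linarith
    then have "2 / \<alpha>0 * (Gr (vec b) $ i - \<epsilon> * \<alpha>0 / 2) \<le> 2 / \<alpha>0 * Gr Z $ i"
      using \<alpha> by (intro mult_left_mono) auto
    then show "p (vec b) i - \<epsilon> \<le> p Z i" using \<alpha> by (simp add: p_def field_simps)
  qed
  \<comment> \<open>Cutting off at 0 keeps the weights non-negative; they stay below the partial
    derivatives because those are non-negative too.\<close>
  define a where "a i = max 0 (p (vec b) i - \<epsilon>)" for i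
  show ?thesis
  proof (intro exI conjI allI impI)
    show "0 < \<delta>" by (rule \<delta>)
    show "0 \<le> a i" for i by (simp add: a_def)
    have "1 < 1 + 2 / \<alpha>0 * d - n * \<epsilon>" using \<epsilon> d \<alpha> by (simp add: field_simps)
    also have "\<dots> = (\<Sum>i\<in>UNIV. p (vec b) i - \<epsilon>)" by (simp add: sum_subtractf p_b n_def)
    also have "\<dots> \<le> (\<Sum>i\<in>UNIV. a i)" by (intro sum_mono) (simp add: a_def)
    finally show "1 < (\<Sum>i\<in>UNIV. a i)" .
    fix X Y :: "real ^ 'n::{finite,zero}"
    assume XY: "\<forall>i. b - \<delta> \<le> X $ i \<and> X $ i \<le> Y $ i \<and> Y $ i \<le> b + \<delta>"
    define \<gamma> where "\<gamma> t = X + t *\<^sub>R (Y - X)" for t :: real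
    have \<gamma>: "\<bar>\<gamma> t $ i - b\<bar> \<le> \<delta>" if "0 \<le> t" "t \<le> 1" for t i
    proof -
      have "0 \<le> t * (Y $ i - X $ i)" "t * (Y $ i - X $ i) \<le> 1 * (Y $ i - X $ i)"
        using XY that by (intro mult_nonneg_nonneg mult_right_mono; simp)+
      then show ?thesis using XY[rule_format, of i] by (auto simp: \<gamma>_def abs_le_iff)
    qed
    have "\<exists>t\<in>{0<..<1}. (wave_map \<alpha>0 F \<circ> \<gamma>) 1 - (wave_map \<alpha>0 F \<circ> \<gamma>) 0
        = (\<lambda>s. \<Sum>i\<in>UNIV. p (\<gamma> t) i * (s *\<^sub>R (Y - X)) $ i) (1 - 0)"
    proof (rule mvt_simple)
      fix t :: real assume t: "0 \<le> t" "t \<le> 1"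
      have "(\<gamma> has_derivative (\<lambda>s. s *\<^sub>R (Y - X))) (at t)"
        unfolding \<gamma>_def by (auto intro!: derivative_eq_intros)
      from diff_chain_at[OF this derW[OF near(1)[OF \<gamma>[OF t]]]]
      show "((wave_map \<alpha>0 F \<circ> \<gamma>) has_derivative (\<lambda>s. \<Sum>i\<in>UNIV. p (\<gamma> t) i * (s *\<^sub>R (Y - X)) $ i)) (at t within {0..1})"
        by (simp add: o_def has_derivative_at_withinI)
    qed simp
    then obtain t where t: "0 < t" "t < 1"
      and eq: "wave_map \<alpha>0 F Y - wave_map \<alpha>0 F X = (\<Sum>i\<in>UNIV. p (\<gamma> t) i * (Y $ i - X $ i))"
      by (auto simp: \<gamma>_def)
    have "a i \<le> p (\<gamma> t) i" for i
      using near[of "\<gamma> t", OF \<gamma>] p_nonneg t by (auto simp: a_def)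
    then show "(\<Sum>i\<in>UNIV. a i * (Y $ i - X $ i)) \<le> wave_map \<alpha>0 F Y - wave_map \<alpha>0 F X"
      unfolding eq using XY by (intro sum_mono mult_right_mono) auto
  qed
qed

section \<open>Exponential averages\<close>

definition exp_law :: "real \<Rightarrow> real measure" where
  "exp_law \<alpha> = density lborel (\<lambda>x. ennreal (exponential_density \<alpha> x))"

lemma sets_exp_law [measurable_cong]: "sets (exp_law \<alpha>) = sets borel"
  by (simp add: exp_law_def)

lemma prob_exp_law: "0 < \<alpha> \<Longrightarrow> prob_space (exp_law \<alpha>)"
  unfolding exp_law_def by (rule prob_space_exponential_density)

lemma AE_exp_law_pos: "0 < \<alpha> \<Longrightarrow> AE s in exp_law \<alpha>. 0 < s"
  unfolding exp_law_def using AE_lborel_singleton[of 0]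
  by (subst AE_density) (auto simp: exponential_density_def elim!: eventually_mono)

lemma AE_exp_law_neq: "AE s in exp_law \<alpha>. s \<noteq> a"
  unfolding exp_law_def using AE_lborel_singleton[of a]
  by (subst AE_density) (auto elim!: eventually_mono)

lemma integrable_exp_law: 
  assumes "0 < \<alpha>"
  shows "integrable (exp_law \<alpha>) (\<lambda>s. s)"
proof -
  have "integrable lborel (\<lambda>x. exponential_density \<alpha> x * x)"
  proof (rule integrableI_nonneg)
    show "AE x in lborel. 0 \<le> exponential_density \<alpha> x * x"
      using assms by (auto simp: exponential_density_def)
    show "(\<integral>\<^sup>+ x. ennreal (exponential_density \<alpha> x * x) \<partial>lborel) < \<infinity>"
      using nn_integral_erlang_ith_moment[OF assms, of 0 1] by simp
  qed simp
  then show ?thesis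
    unfolding exp_law_def using assms by (subst integrable_density) (auto simp: exponential_density_nonneg)
qed

text \<open>The substitution \<open>s = d - t\<close> gives the variation-of-constants form, where
  \<open>d\<close> occurs only in an exponential factor and in the upper limit of
  integration.\<close>

lemma exp_average_shift:
  fixes h :: "real \<Rightarrow> real"
  assumes \<alpha>: "0 < \<alpha>" and cont: "continuous_on UNIV h" and bdd: "\<And>z. \<bar>h z\<bar> \<le> B"
  shows "integrable lborel (\<lambda>t. indicator {..d} t * (exp (\<alpha> * t) * h (z + c * t)))" (is ?int)
    and "(\<integral>s. h (z + c * d - c * s) \<partial>exp_law \<alpha>)
      = \<alpha> * exp (- \<alpha> * d) * (\<integral>t. indicator {..d} t * (exp (\<alpha> * t) * h (z + c * t)) \<partial>lborel)" (is ?eq)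
proof -
  interpret prob_space "exp_law \<alpha>" by (rule prob_exp_law[OF \<alpha>])
  have [measurable]: "h \<in> borel_measurable borel" using cont by (rule borel_measurable_continuous_onI)
  let ?f = "\<lambda>s. exponential_density \<alpha> s * h (z + c * d - c * s)"
  have "integrable (exp_law \<alpha>) (\<lambda>s. h (z + c * d - c * s))"
    by (rule integrable_const_bound[of _ B]) (use bdd in auto)
  then have f: "integrable lborel ?f"
    unfolding exp_law_def using \<alpha> by (subst (asm) integrable_density) (auto simp: exponential_density_nonneg)
  have f_eq: "?f (d + -1 * t) = \<alpha> * exp (- \<alpha> * d) * (indicator {..d} t * (exp (\<alpha> * t) * h (z + c * t)))" for t
    by (auto simp: exponential_density_def indicator_def algebra_simps exp_diff exp_minus divide_inverse)
  have "integrable lborel (\<lambda>t. ?f (d + -1 * t))" by (rule lborel_integrable_real_affine[OF f]) simp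
  then have "integrable lborel (\<lambda>t. \<alpha> * exp (- \<alpha> * d) * (indicator {..d} t * (exp (\<alpha> * t) * h (z + c * t))))"
    unfolding f_eq .
  then show ?int using \<alpha> by (subst (asm) integrable_mult_left_iff) auto
  have "(\<integral>s. h (z + c * d - c * s) \<partial>exp_law \<alpha>) = (\<integral>s. ?f s \<partial>lborel)"
    unfolding exp_law_def using \<alpha> by (subst integral_density) (auto simp: exponential_density_nonneg)
  also have "\<dots> = (\<integral>t. ?f (d + -1 * t) \<partial>lborel)"
    by (subst lborel_integral_real_affine[where c = "-1" and t = d]) auto
  finally show ?eq unfolding f_eq by simp
qed

text \<open>Duhamel's formula read backwards: for either sign of \<open>c\<close> the average solves
  \<open>c k' = \<alpha> (h - k)\<close>, by the fundamental theorem of calculus.\<close>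

lemma exp_average_has_derivative:
  fixes h :: "real \<Rightarrow> real"
  assumes \<alpha>: "0 < \<alpha>" and c: "c \<noteq> 0" and cont: "continuous_on UNIV h" and bdd: "\<And>z. \<bar>h z\<bar> \<le> B"
  defines "k \<equiv> \<lambda>z. \<integral>s. h (z - c * s) \<partial>exp_law \<alpha>"
  shows "(k has_real_derivative \<alpha> * (h z - k z) / c) (at z)"
proof -
  \<comment> \<open>With this base point \<open>z\<close> corresponds to \<open>d = 1\<close>,
    interior to the interval \<open>{0..2}\<close> on which the integral is differentiated.\<close>
  define y where "y = z - c"
  define g where "g t = exp (\<alpha> * t) * h (y + c * t)" for t
  define \<Phi> where "\<Phi> d = (\<integral>t. indicator {..d} t * g t \<partial>lborel)" for d
  have int: "integrable lborel (\<lambda>t. indicator {..d} t * g t)" for d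
    unfolding g_def by (rule exp_average_shift[OF \<alpha> cont bdd])
  have k: "k (y + c * d) = \<alpha> * exp (- \<alpha> * d) * \<Phi> d" for d
    unfolding k_def \<Phi>_def g_def by (rule exp_average_shift[OF \<alpha> cont bdd])
  have contg: "continuous_on S g" for S
    unfolding g_def by (intro continuous_intros continuous_on_compose2[OF cont]) auto
  have \<Phi>: "\<Phi> d = \<Phi> 0 + integral {0..d} g" if "0 \<le> d" for d
  proof -
    have *: "set_integrable lborel {0..d} g"
      by (intro borel_integrable_atLeastAtMost' contg)
    have "\<Phi> d = (\<integral>t. indicator {..0} t * g t + indicator {0..d} t * g t \<partial>lborel)"
      unfolding \<Phi>_def
    proof (rule integral_cong_AE)
      show "AE t in lborel. indicator {..d} t * g t = indicator {..0} t * g t + indicator {0..d} t * g t"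
        using AE_lborel_singleton[of 0] by eventually_elim (use that in \<open>auto simp: indicator_def\<close>)
    qed (use int[of d] int[of 0] * in \<open>auto simp: set_integrable_def intro!: borel_measurable_integrable\<close>)
    also have "\<dots> = \<Phi> 0 + (LINT t:{0..d}|lborel. g t)"
      unfolding \<Phi>_def set_lebesgue_integral_def using int[of 0] * by (simp add: set_integrable_def)
    also have "(LINT t:{0..d}|lborel. g t) = integral {0..d} g"
      by (rule set_borel_integral_eq_integral[OF *])
    finally show ?thesis .
  qed
  have "((\<lambda>d. integral {0..d} g) has_real_derivative g 1) (at 1 within {0..2})"
    by (rule integral_has_real_derivative[OF contg]) auto
  then have "((\<lambda>d. integral {0..d} g) has_real_derivative g 1) (at 1)"
    by (subst (asm) at_within_interior) auto
  then have "((\<lambda>d. \<Phi> 0 + integral {0..d} g) has_real_derivative g 1) (at 1)"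
    by (auto intro!: derivative_eq_intros)
  then have d\<Phi>: "(\<Phi> has_real_derivative g 1) (at 1)"
  proof (rule has_field_derivative_transform_within_open[of _ _ _ "{0<..<2}"])
    show "\<Phi> 0 + integral {0..d} g = \<Phi> d" if "d \<in> {0<..<2}" for d
      by (rule \<Phi>[symmetric]) (use that in auto)
  qed auto
  have "((\<lambda>d. k (y + c * d)) has_real_derivative \<alpha> * (h z - k z)) (at 1)"
  proof -
    have "((\<lambda>d. \<alpha> * exp (- \<alpha> * d) * \<Phi> d) has_real_derivative
        \<alpha> * (- \<alpha> * exp (- \<alpha> * 1)) * \<Phi> 1 + \<alpha> * exp (- \<alpha> * 1) * g 1) (at 1)"
      by (auto intro!: derivative_eq_intros d\<Phi>)
    moreover have "\<alpha> * (- \<alpha> * exp (- \<alpha> * 1)) * \<Phi> 1 + \<alpha> * exp (- \<alpha> * 1) * g 1 = \<alpha> * (h z - k z)"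
      using k[of 1] by (simp add: y_def g_def exp_minus field_simps)
    ultimately show ?thesis by (simp only: k)
  qed
  moreover have "((\<lambda>w. (w - y) / c) has_real_derivative 1 / c) (at z)"
    using c by (auto intro!: derivative_eq_intros)
  moreover have "(z - y) / c = 1" using c by (simp add: y_def)
  ultimately have "((\<lambda>w. k (y + c * ((w - y) / c))) has_real_derivative \<alpha> * (h z - k z) * (1 / c)) (at z)"
    using DERIV_chain2[of "\<lambda>d. k (y + c * d)" "\<alpha> * (h z - k z)" "\<lambda>w. (w - y) / c" z "1 / c" UNIV] by simp
  then show ?thesis using c by simp
qed

lemma exp_average_tendsto:
  fixes h :: "real \<Rightarrow> real"
  assumes \<alpha>: "0 < \<alpha>" and meas [measurable]: "h \<in> borel_measurable borel" and bdd: "\<And>z. \<bar>h z\<bar> \<le> B"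
    and lim: "\<And>s. (\<lambda>n. h (zs n - c * s)) \<longlonglongrightarrow> l"
  shows "(\<lambda>n. \<integral>s. h (zs n - c * s) \<partial>exp_law \<alpha>) \<longlonglongrightarrow> l"
proof -
  interpret prob_space "exp_law \<alpha>" by (rule prob_exp_law[OF \<alpha>])
  have "(\<lambda>n. \<integral>s. h (zs n - c * s) \<partial>exp_law \<alpha>) \<longlonglongrightarrow> (\<integral>s. l \<partial>exp_law \<alpha>)"
    by (rule integral_dominated_convergence[where w = "\<lambda>_. B"]) (use lim bdd in auto)
  then show ?thesis by (simp add: prob_space)
qed

text \<open>The gamma law of shape 2, kept as an image of the product measure so that its integrals
  split into two exponential averages, one for each equation of the system.\<close>

definition sum_law :: "real \<Rightarrow> real measure" where
  "sum_law \<alpha> = distr (exp_law \<alpha> \<Otimes>\<^sub>M exp_law \<alpha>) borel (\<lambda>(s, t). s + t)"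

lemma measurable_sum_pair: "(\<lambda>(s, t). s + t) \<in> borel_measurable (exp_law \<alpha> \<Otimes>\<^sub>M exp_law \<alpha>)"
proof -
  have "(\<lambda>s. s) \<in> borel_measurable (exp_law \<alpha>)" by measurable
  from borel_measurable_add[OF measurable_compose[OF measurable_fst this] measurable_compose[OF measurable_snd this]]
  show ?thesis by (simp add: split_beta')
qed

lemma prob_sum_law:
  assumes "0 < \<alpha>" shows "prob_space (sum_law \<alpha>)"
proof -
  interpret E: prob_space "exp_law \<alpha>" by (rule prob_exp_law[OF assms])
  interpret P: pair_prob_space "exp_law \<alpha>" "exp_law \<alpha>" ..
  show ?thesis unfolding sum_law_def by (rule P.prob_space_distr[OF measurable_sum_pair])
qed

lemma AE_sum_law:
  assumes \<alpha>: "0 < \<alpha>" and P [measurable]: "Measurable.pred borel P"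
    and ae: "AE s in exp_law \<alpha>. AE t in exp_law \<alpha>. P (s + t)"
  shows "AE s in sum_law \<alpha>. P s"
proof -
  interpret E: prob_space "exp_law \<alpha>" by (rule prob_exp_law[OF \<alpha>])
  interpret P: pair_prob_space "exp_law \<alpha>" "exp_law \<alpha>" ..
  have "Measurable.pred (exp_law \<alpha> \<Otimes>\<^sub>M exp_law \<alpha>) (\<lambda>x. P (case x of (s, t) \<Rightarrow> s + t))"
    by (rule measurable_compose[OF measurable_sum_pair P])
  then have "AE x in exp_law \<alpha> \<Otimes>\<^sub>M exp_law \<alpha>. P (case x of (s, t) \<Rightarrow> s + t)"
    using ae by (intro P.AE_pair_measure) (auto simp: pred_def)
  then show ?thesis
    unfolding sum_law_def by (subst AE_distr_iff[OF measurable_sum_pair]) auto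
qed

lemma integral_sum_law:
  fixes f :: "real \<Rightarrow> real"
  assumes \<alpha>: "0 < \<alpha>" and [measurable]: "f \<in> borel_measurable borel" and bdd: "\<And>z. \<bar>f z\<bar> \<le> B"
  shows "(\<integral>s. f s \<partial>sum_law \<alpha>) = (\<integral>s. (\<integral>t. f (s + t) \<partial>exp_law \<alpha>) \<partial>exp_law \<alpha>)"
proof -
  interpret E: prob_space "exp_law \<alpha>" by (rule prob_exp_law[OF \<alpha>])
  interpret P: pair_prob_space "exp_law \<alpha>" "exp_law \<alpha>" ..
  have "integrable (exp_law \<alpha> \<Otimes>\<^sub>M exp_law \<alpha>) (\<lambda>x. f (case x of (s, t) \<Rightarrow> s + t))"
    by (rule P.integrable_const_bound[of _ B])
      (use bdd measurable_compose[OF measurable_sum_pair \<open>f \<in> borel_measurable borel\<close>] in auto)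
  from P.integral_fst'[OF this] show ?thesis
    unfolding sum_law_def by (subst integral_distr[OF measurable_sum_pair]) auto
qed

lemma integrable_sum_law:
  assumes \<alpha>: "0 < \<alpha>"
  shows "integrable (sum_law \<alpha>) (\<lambda>s. s)"
proof -
  interpret E: prob_space "exp_law \<alpha>" by (rule prob_exp_law[OF \<alpha>])
  interpret P: pair_prob_space "exp_law \<alpha>" "exp_law \<alpha>" ..
  note i = integrable_exp_law[OF \<alpha>]
  have id: "(\<lambda>s. s) \<in> borel_measurable (exp_law \<alpha>)" by measurable
  have "integrable (exp_law \<alpha> \<Otimes>\<^sub>M exp_law \<alpha>) fst"
    by (rule P.Fubini_integrable[OF measurable_compose[OF measurable_fst id]])
      (use i in \<open>auto simp: E.prob_space\<close>)
  moreover have "integrable (exp_law \<alpha> \<Otimes>\<^sub>M exp_law \<alpha>) snd"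
    by (rule P.Fubini_integrable[OF measurable_compose[OF measurable_snd id]]) (use i in auto)
  ultimately have "integrable (exp_law \<alpha> \<Otimes>\<^sub>M exp_law \<alpha>) (\<lambda>x. fst x + snd x)"
    by (rule Bochner_Integration.integrable_add)
  then show ?thesis
    unfolding sum_law_def by (subst integrable_distr_eq[OF measurable_sum_pair]) (auto simp: split_beta')
qed

section \<open>From the fixed point back to the system\<close>

lemma wave_solution_of_fixed_point:
  fixes F :: "real ^ 'n::{finite,zero} \<Rightarrow> real"
  assumes \<alpha>: "0 < \<alpha>0" and r0: "r 0 = 0"
    and T: "transfer_operator (wave_map \<alpha>0 F) (sum_law \<alpha>0) L"
    and p: "profile \<phi>" and fixed: "\<And>z. \<phi> z = transfer_operator.transfer (wave_map \<alpha>0 F) r (sum_law \<alpha>0) c \<phi> z"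
    and lim: "(\<phi> \<longlongrightarrow> 0) at_bot" "(\<phi> \<longlongrightarrow> 1) at_top"
  shows "\<exists>\<phi>2. wave_solution \<alpha>0 F r c \<phi> \<phi>2 \<and> mono \<phi>2 \<and> (\<phi>2 \<longlongrightarrow> 0) at_bot \<and> (\<phi>2 \<longlongrightarrow> 1) at_top"
proof -
  interpret transfer_operator "wave_map \<alpha>0 F" r "sum_law \<alpha>0" L by (rule T)
  interpret E: prob_space "exp_law \<alpha>0" by (rule prob_exp_law[OF \<alpha>])
  note P = profileD[OF p]
  \<comment> \<open>The convention \<open>r 0 = 0\<close> makes slot 0 see \<open>\<phi> z\<close>
    itself, and clamping does not change values in [0,1].\<close>
  have react: "react \<phi> z = \<phi> z + 2 / \<alpha>0 * F (\<chi> i. \<phi> (z + r i))" for z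
  proof -
    have "clamp_cube (\<chi> i. \<phi> (z + r i)) = (\<chi> i. \<phi> (z + r i))"
      using P by (intro clamp_cube_id) (simp add: unit_cube_def)
    then show ?thesis by (simp add: react_def wave_map_def r0)
  qed
  show ?thesis
  proof (cases "c = 0")
    case True
    \<comment> \<open>At speed 0 the fixed point equation says that \<open>F\<close> vanishes along
      the profile, so the two components may coincide.\<close>
    have "F (\<chi> i. \<phi> (z + r i)) = 0" for z
      using fixed[of z] react[of z] \<alpha> by (simp add: True transfer_0)
    then have "wave_solution \<alpha>0 F r c \<phi> \<phi>"
      by (simp add: wave_solution_def wave_equations_at_def True)
    then show ?thesis using P(1) lim by blast
  next
    case False
    define h where "h = react \<phi>"
    \<comment> \<open>The first exponential delay produces \<phi>2 from \<open>h\<close>, the second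
      recovers \<phi> from \<phi>2; differentiating each average gives one equation.\<close>
    define \<phi>2 where "\<phi>2 z = (\<integral>s. h (z - c * s) \<partial>exp_law \<alpha>0)" for z
    have h_bds: "0 \<le> h z" "h z \<le> 1" "\<bar>h z\<bar> \<le> 1" for z
      using react_bounds[of \<phi> z] P by (auto simp: h_def)
    \<comment> \<open>Averaging over a law without atoms makes the profile continuous;
      \<open>h\<close> is then continuous, as differentiating its average requires.\<close>
    have cont\<phi>: "continuous_on UNIV \<phi>"
    proof -
      have "transfer c \<phi> = \<phi>" by (rule ext) (rule fixed[symmetric])
      then show ?thesis using continuous_transfer[OF p False] by simp
    qed
    have conth: "continuous_on UNIV h" unfolding h_def by (rule continuous_react[OF cont\<phi>])
    have meas_h [measurable]: "h \<in> borel_measurable borel" using conth by (rule borel_measurable_continuous_onI)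
    have mono_h: "h x \<le> h y" if "x \<le> y" for x y
      unfolding h_def using that by (rule react_mono[OF P(1)])
    have int_h: "integrable (exp_law \<alpha>0) (\<lambda>s. h (z - c * s))" for z
      by (rule E.integrable_const_bound[of _ 1]) (use h_bds in auto)
    have d2: "(\<phi>2 has_real_derivative \<alpha>0 * (h z - \<phi>2 z) / c) (at z)" for z
      unfolding \<phi>2_def by (rule exp_average_has_derivative[OF \<alpha> False conth h_bds(3)])
    have cont2: "continuous_on UNIV \<phi>2"
      using d2 by (intro continuous_at_imp_continuous_on) (auto intro: DERIV_isCont)
    have bds2: "0 \<le> \<phi>2 z" "\<phi>2 z \<le> 1" for z
      unfolding \<phi>2_def using int_h h_bds
      by (auto intro!: integral_nonneg E.integral_le_const)
    have \<phi>_eq: "\<phi> z = (\<integral>s. \<phi>2 (z - c * s) \<partial>exp_law \<alpha>0)" for z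
    proof -
      have "\<phi> z = (\<integral>s. h (z - c * s) \<partial>sum_law \<alpha>0)" using fixed[of z] by (simp add: transfer_def h_def)
      also have "\<dots> = (\<integral>s. (\<integral>t. h (z - c * (s + t)) \<partial>exp_law \<alpha>0) \<partial>exp_law \<alpha>0)"
        by (rule integral_sum_law[OF \<alpha>, of _ 1]) (use h_bds in auto)
      also have "\<dots> = (\<integral>s. \<phi>2 (z - c * s) \<partial>exp_law \<alpha>0)"
        by (simp add: \<phi>2_def algebra_simps)
      finally show ?thesis .
    qed
    have d1: "(\<phi> has_real_derivative \<alpha>0 * (\<phi>2 z - \<phi> z) / c) (at z)" for z
      using exp_average_has_derivative[OF \<alpha> False cont2, of 1 z] bds2 by (simp add: \<phi>_eq[symmetric])
    have C1: "\<phi> C1_differentiable_on UNIV" "\<phi>2 C1_differentiable_on UNIV"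
      unfolding C1_differentiable_on_def
      using d1 d2 False
      by (intro exI[of _ "\<lambda>z. \<alpha>0 * (\<phi>2 z - \<phi> z) / c"] exI[of _ "\<lambda>z. \<alpha>0 * (h z - \<phi>2 z) / c"] conjI ballI
          continuous_intros cont\<phi> cont2 conth; simp add: has_real_derivative_iff_has_vector_derivative)+
    have "wave_equations_at \<alpha>0 F r c \<phi> \<phi>2 z" for z
      unfolding wave_equations_at_def DERIV_imp_deriv[OF d1] DERIV_imp_deriv[OF d2]
      using False \<alpha> react[of z] by (simp add: h_def field_simps)
    then have "wave_solution \<alpha>0 F r c \<phi> \<phi>2" using C1 False unfolding wave_solution_def by auto
    moreover have "mono \<phi>2"
      unfolding \<phi>2_def by (intro monoI integral_mono int_h mono_h) simp
    moreover have "(\<phi>2 \<longlongrightarrow> 0) at_bot"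
    proof (rule tendsto_at_botI_sequentially)
      fix zs :: "nat \<Rightarrow> real" assume zs: "filterlim zs at_bot sequentially"
      show "(\<lambda>n. \<phi>2 (zs n)) \<longlonglongrightarrow> 0"
        unfolding \<phi>2_def
      proof (rule exp_average_tendsto[OF \<alpha> meas_h h_bds(3)])
        fix s
        have "filterlim (\<lambda>n. zs n - c * s + r i) at_bot sequentially" for i
          using zs filterlim_tendsto_add_at_top[OF tendsto_const[of "c * s - r i"], of "\<lambda>n. - zs n" sequentially]
          unfolding filterlim_uminus_at_bot by (simp add: algebra_simps)
        then have "(\<lambda>n. h (zs n - c * s)) \<longlonglongrightarrow> wave_map \<alpha>0 F (\<chi> i. 0)"
          unfolding h_def react_def by (intro tendsto_G filterlim_compose[OF lim(1)])
        then show "(\<lambda>n. h (zs n - c * s)) \<longlonglongrightarrow> 0" by (simp add: G_const)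
      qed
    qed
    moreover have "(\<phi>2 \<longlongrightarrow> 1) at_top"
    proof (rule tendsto_at_topI_sequentially)
      fix zs :: "nat \<Rightarrow> real" assume zs: "filterlim zs at_top sequentially"
      show "(\<lambda>n. \<phi>2 (zs n)) \<longlonglongrightarrow> 1"
        unfolding \<phi>2_def
      proof (rule exp_average_tendsto[OF \<alpha> meas_h h_bds(3)])
        fix s
        have "filterlim (\<lambda>n. zs n - c * s + r i) at_top sequentially" for i
          using filterlim_tendsto_add_at_top[OF tendsto_const[of "r i - c * s"] zs] by (simp add: algebra_simps)
        then have "(\<lambda>n. h (zs n - c * s)) \<longlonglongrightarrow> wave_map \<alpha>0 F (\<chi> i. 1)"
          unfolding h_def react_def by (intro tendsto_G filterlim_compose[OF lim(2)])
        then show "(\<lambda>n. h (zs n - c * s)) \<longlonglongrightarrow> 1" by (simp add: G_const)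
      qed
    qed
    ultimately show ?thesis by blast
  qed
qed

theorem theorem1p2:
  fixes \<alpha>0 :: real
    and r :: "'n::{finite,zero} \<Rightarrow> real"
    and F :: "real ^ 'n::{finite,zero} \<Rightarrow> real"
  assumes "\<alpha>0 > 0"
    and "r 0 = 0"
    and "Max (range (\<lambda>i. \<bar>r i\<bar>)) > 0"
    and "assumption_A \<alpha>0 F"
    and "assumption_B F"
  shows "\<exists>(c::real) (\<phi>1::real \<Rightarrow> real) (\<phi>2::real \<Rightarrow> real).
           wave_solution \<alpha>0 F r c \<phi>1 \<phi>2 \<and>
           mono \<phi>1 \<and> mono \<phi>2 \<and>
           (\<phi>1 \<longlongrightarrow> 0) at_bot \<and> (\<phi>1 \<longlongrightarrow> 1) at_top \<and>
           (\<phi>2 \<longlongrightarrow> 0) at_bot \<and> (\<phi>2 \<longlongrightarrow> 1) at_top"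
proof -
  note \<alpha> = assms(1)
  obtain L where L: "L-lipschitz_on unit_cube F" using assms(4) by (auto simp: assumption_A_def)
  have mono_G: "mono (wave_map \<alpha>0 F)" by (rule mono_wave_map[OF \<alpha> assms(4)])
  obtain b where b: "0 \<le> b" "b \<le> 1" "diagonal F b = 0"
      "\<And>v. 0 < v \<Longrightarrow> v < b \<Longrightarrow> diagonal F v < 0" "\<And>v. b < v \<Longrightarrow> v < 1 \<Longrightarrow> 0 < diagonal F v"
      "\<exists>d>0. (diagonal F has_real_derivative d) (at b within {0..1})" "C1_near F (vec b)"
    and ends: "diagonal F 0 = 0" "diagonal F 1 = 0"
    using assms(5) unfolding assumption_B_def by (metis atLeastAtMost_iff greaterThanLessThan_iff)
  interpret transfer_operator "wave_map \<alpha>0 F" r "sum_law \<alpha>0" "1 + 2 / \<alpha>0 * L"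
  proof (rule transfer_operator.intro)
    show "(1 + 2 / \<alpha>0 * L)-lipschitz_on UNIV (wave_map \<alpha>0 F)" by (rule lipschitz_wave_map[OF \<alpha> L])
    show "wave_map \<alpha>0 F (vec 0) = 0" "wave_map \<alpha>0 F (vec 1) = 1"
      using wave_map_vec[of 0 \<alpha>0 F] wave_map_vec[of 1 \<alpha>0 F] ends by simp_all
    show "AE s in sum_law \<alpha>0. 0 < s"
    proof (rule AE_sum_law[OF \<alpha>])
      show "AE s in exp_law \<alpha>0. AE t in exp_law \<alpha>0. 0 < s + t"
        using AE_exp_law_pos[OF \<alpha>]
      proof eventually_elim
        case (elim s)
        show ?case using AE_exp_law_pos[OF \<alpha>] by eventually_elim (use elim in simp)
      qed
    qed simp
    show "AE s in sum_law \<alpha>0. s \<noteq> a" for a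
    proof (rule AE_sum_law[OF \<alpha>])
      show "AE s in exp_law \<alpha>0. AE t in exp_law \<alpha>0. s + t \<noteq> a"
      proof (rule AE_I2)
        show "AE t in exp_law \<alpha>0. s + t \<noteq> a" for s
          using AE_exp_law_neq[of "a - s" \<alpha>0] by eventually_elim auto
      qed
    qed simp
    show "sets (sum_law \<alpha>0) = sets borel" by (simp add: sum_law_def)
  qed (rule mono_G prob_sum_law[OF \<alpha>] integrable_sum_law[OF \<alpha>])+
  have "\<exists>c. connects c (-\<infinity>) \<infinity>"
  proof (rule ex_wave[OF b(1,2)])
    fix p :: real assume p: "0 \<le> p" "p \<le> 1" "wave_map \<alpha>0 F (vec p) = p"
    \<comment> \<open>On the diagonal \<open>G\<close> is \<open>p + 2 / \<alpha>0 * f(p)\<close>,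
      so its fixed points are the zeros of \<open>f\<close>.\<close>
    have "2 / \<alpha>0 * diagonal F p = 0" using wave_map_vec[OF p(1,2), of \<alpha>0 F] p(3) by linarith
    then have "diagonal F p = 0" using \<alpha> by simp
    then have "\<not> (0 < p \<and> p < b)" "\<not> (b < p \<and> p < 1)" using b(4)[of p] b(5)[of p] by auto
    then have "p = 0 \<or> p = b \<or> p = 1" using p(1,2) by linarith
    then show "p \<in> {0, b, 1}" by simp
  next
    assume b': "0 < b" "b < 1"
    obtain d where d: "0 < d" "(diagonal F has_real_derivative d) (at b within {0..1})" using b(6) by blast
    show "wave_map \<alpha>0 F (vec b) = b \<and> expanding_at b"
      unfolding expanding_at_def
      using wave_map_vec[OF b(1,2), of \<alpha>0 F] b(3) wave_map_expanding[OF \<alpha> mono_G b' b(7) d] by simp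
  qed
  then obtain c \<phi> where \<phi>: "shape c (-\<infinity>) \<infinity> \<phi>" "(\<phi> \<longlongrightarrow> 0) at_bot" "(\<phi> \<longlongrightarrow> 1) at_top"
    by (auto simp: connects_def)
  have p: "profile \<phi>" and eq: "\<And>z. \<phi> z = transfer c \<phi> z" using \<phi>(1) by (auto simp: shape_def)
  obtain \<phi>2 where "wave_solution \<alpha>0 F r c \<phi> \<phi>2" "mono \<phi>2" "(\<phi>2 \<longlongrightarrow> 0) at_bot" "(\<phi>2 \<longlongrightarrow> 1) at_top"
    using wave_solution_of_fixed_point[where r = r, OF \<alpha> assms(2) transfer_operator_axioms p eq \<phi>(2,3)] by blast
  then show ?thesis using \<phi>(2,3) profileD(1)[OF p] by blast
qed

end
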